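(* Let $X$ be a 4-manifold with a pseudocomplex structure $E\subset\widetilde{\mathrm{Gr}}_2(TX)$, and let $Y$ be a smooth 4-parameter family (a 4-manifold) of $E$ curves in $X$. Let $Z$ be the 6-manifold of pairs $(x,C)$ with $C\in Y$, $x\in C$, with the maps $\lambda:Z\to X$, $\lambda(x,C)=x$, and $\rho:Z\to Y$, $\rho(x,C)=C$, and suppose that $\tau:Z\to E$, $\tau(x,C)=T_xC$, is a local diffeomorphism, so that $Z$ gives locally a pseudocomplex structure on $X$ (via $\tau$) and a dual pseudocomplex structure on $Y$. Suppose that the pseudocomplex structure given (locally) by $Z$ is an almost complex structure (locally) both on $X$ and on $Y$. Then it is a complex structure on both.
   Context: $\widetilde{\mathrm{Gr}}_2(V)$ is the Grassmannian of oriented real 2-planes in a 4-dimensional real vector space $V$, with $T_P\widetilde{\mathrm{Gr}}_2(V)=\mathrm{Lin}(P,V/P)$. An immersed surface in $\widetilde{\mathrm{Gr}}_2(V)$ is an elliptic line congruence if each of its tangent planes, as a 2-plane in $\mathrm{Lin}(P,V/P)$, contains no linear map of rank 1. A pseudocomplex structure on a 4-manifold $M$ is a six-dimensional submanifold $E\subset\widetilde{\mathrm{Gr}}_2(TM)$ which is a fiber subbundle over $M$ (locally: submersing to an open subset of $M$), each of whose fibers is an elliptic line congruence. An $E$ curve in $M$ is an oriented surface all of whose tangent planes belong to $E$. A pseudocomplex structure is (locally) an almost complex structure if (locally) there is an almost complex structure on $M$ such that $E$ consists of (an open subset of) its complex lines with their complex orientations; it is a complex structure if moreover this almost complex structure is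 integrable. Dual structure on $Y$: let $\Theta_z=\lambda'(z)^{-1}(\tau(z))\subset T_zZ$, a 4-plane field on $Z$ with $\Theta_z=\ker\lambda'(z)\oplus\ker\rho'(z)$. The dual pseudocomplex structure is given locally by the map $Z\to\widetilde{\mathrm{Gr}}_2(TY)$, $z\mapsto\rho'(z)\Theta_z\cong\ker\lambda'(z)$. These 2-planes are oriented as follows: at $z$, with $P=\tau(z)$ and $x=\lambda(z)$, $\tau$ identifies $\ker\lambda'(z)$ with $T_PE_x\subset\mathrm{Lin}(P,T_xX/P)$; there are unique complex structures on $P$ (compatible with its orientation) and on $T_xX/P$ for which $T_PE_x$ is the set of complex linear maps $P\to T_xX/P$, and this makes $T_PE_x$ a complex line, hence oriented. *)

theory Defs
  imports "HOL-Analysis.Analysis"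
begin

section \<open>Smooth functions between open subsets of Euclidean spaces\<close>

fun Ck_on :: "nat \<Rightarrow> 'e::euclidean_space set \<Rightarrow> ('e \<Rightarrow> 'f::euclidean_space) \<Rightarrow> bool" where
  "Ck_on 0 S f \<longleftrightarrow> continuous_on S f"
| "Ck_on (Suc k) S f \<longleftrightarrow>
     (\<forall>x\<in>S. f differentiable at x) \<and> (\<forall>v. Ck_on k S (\<lambda>x. frechet_derivative f (at x) v))"

(* Only meaningful for open S, since the derivatives are taken at x and not at x within S. *)
definition smooth_on :: "'e::euclidean_space set \<Rightarrow> ('e \<Rightarrow> 'f::euclidean_space) \<Rightarrow> bool" where
  "smooth_on S f \<longleftrightarrow> (\<forall>k. Ck_on k S f)"


section \<open>Smooth manifolds\<close>

(* A chart is a domain U together with a coordinate function, whose values off U are irrelevant.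
   The dimension of a manifold is that of the model space 'e. *)
type_synonym ('a, 'e) chart = "'a set \<times> ('a \<Rightarrow> 'e)"
type_synonym ('a, 'e) atlas = "('a, 'e) chart set"

definition mcarrier :: "('a, 'e) atlas \<Rightarrow> 'a set" where
  "mcarrier A = \<Union> (fst ` A)"

definition mtop :: "('a, 'e::euclidean_space) atlas \<Rightarrow> 'a topology" where
  "mtop A = topology_generated_by {U \<inter> \<phi> -` G | U \<phi> G. (U, \<phi>) \<in> A \<and> open G}"

definition is_chart :: "('a, 'e::euclidean_space) chart \<Rightarrow> bool" where
  "is_chart c \<longleftrightarrow> inj_on (snd c) (fst c) \<and> open (snd c ` fst c)"

definition smoothly_compatible ::
    "('a, 'e::euclidean_space) chart \<Rightarrow> ('a, 'f::euclidean_space) chart \<Rightarrow> bool" where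
  "smoothly_compatible = (\<lambda>(U, \<phi>) (V, \<psi>).
     open (\<phi> ` (U \<inter> V)) \<and> open (\<psi> ` (U \<inter> V)) \<and>
     smooth_on (\<phi> ` (U \<inter> V)) (\<psi> \<circ> inv_into U \<phi>) \<and>
     smooth_on (\<psi> ` (U \<inter> V)) (\<phi> \<circ> inv_into V \<psi>))"

definition smooth_manifold :: "('a, 'e::euclidean_space) atlas \<Rightarrow> bool" where
  "smooth_manifold A \<longleftrightarrow>
     (\<forall>c\<in>A. is_chart c) \<and> (\<forall>c\<in>A. \<forall>d\<in>A. smoothly_compatible c d) \<and>
     Hausdorff_space (mtop A) \<and> second_countable (mtop A)"

(* The charts of the smooth structure determined by A; the model space 'f may differ from 'e. *)
definition manifold_chart ::
    "('a, 'e::euclidean_space) atlas \<Rightarrow> ('a, 'f::euclidean_space) chart \<Rightarrow> bool" where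
  "manifold_chart A c \<longleftrightarrow>
     fst c \<subseteq> mcarrier A \<and> is_chart c \<and> (\<forall>d\<in>A. smoothly_compatible c d)"

definition restrict_atlas :: "('a, 'e) atlas \<Rightarrow> 'a set \<Rightarrow> ('a, 'e) atlas" where
  "restrict_atlas A W = {(U \<inter> W, \<phi>) | U \<phi>. (U, \<phi>) \<in> A}"

definition smooth_map ::
    "('a, 'e::euclidean_space) atlas \<Rightarrow> ('b, 'f::euclidean_space) atlas \<Rightarrow> ('a \<Rightarrow> 'b) \<Rightarrow> bool" where
  "smooth_map A B f \<longleftrightarrow> continuous_map (mtop A) (mtop B) f \<and>
     (\<forall>(U, \<phi>)\<in>A. \<forall>(V, \<psi>)\<in>B. smooth_on (\<phi> ` (U \<inter> f -` V)) (\<psi> \<circ> f \<circ> inv_into U \<phi>))"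

definition local_diffeo ::
    "('a, 'e::euclidean_space) atlas \<Rightarrow> ('b, 'f::euclidean_space) atlas \<Rightarrow> ('a \<Rightarrow> 'b) \<Rightarrow> bool" where
  "local_diffeo A B f \<longleftrightarrow>
     (\<forall>x\<in>mcarrier A. \<exists>W W'. openin (mtop A) W \<and> x \<in> W \<and> openin (mtop B) W' \<and> bij_betw f W W' \<and>
        smooth_map (restrict_atlas A W) (restrict_atlas B W') f \<and>
        smooth_map (restrict_atlas B W') (restrict_atlas A W) (inv_into W f))"


subsection \<open>Tangent spaces and differentials\<close>

(* The tangent space at x is the model space 'e: a tangent vector is given by its components in
   one chosen chart around x. *)
definition chart_at :: "('a, 'e) atlas \<Rightarrow> 'a \<Rightarrow> ('a, 'e) chart" where
  "chart_at A x = (SOME c. c \<in> A \<and> x \<in> fst c)"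

definition coords_at :: "('a, 'e) atlas \<Rightarrow> 'a \<Rightarrow> 'a \<Rightarrow> 'e" where
  "coords_at A x = snd (chart_at A x)"

(* Differential at x of a function with values in a Euclidean space.  For a coordinate function h
   it converts a tangent vector at x into its components in the coordinates h. *)
definition differential ::
    "('a, 'e::euclidean_space) atlas \<Rightarrow> ('a \<Rightarrow> 'f::euclidean_space) \<Rightarrow> 'a \<Rightarrow> 'e \<Rightarrow> 'f" where
  "differential A h x =
     frechet_derivative (h \<circ> inv_into (fst (chart_at A x)) (coords_at A x)) (at (coords_at A x x))"

definition mderiv ::
    "('a, 'e::euclidean_space) atlas \<Rightarrow> ('b, 'f::euclidean_space) atlas \<Rightarrow> ('a \<Rightarrow> 'b) \<Rightarrow> 'a \<Rightarrow> 'e \<Rightarrow> 'f" where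
  "mderiv A B f x = differential A (coords_at B (f x) \<circ> f) x"

definition immersion ::
    "('a, 'e::euclidean_space) atlas \<Rightarrow> ('b, 'f::euclidean_space) atlas \<Rightarrow> ('a \<Rightarrow> 'b) \<Rightarrow> bool" where
  "immersion A B f \<longleftrightarrow> smooth_map A B f \<and> (\<forall>x\<in>mcarrier A. inj (mderiv A B f x))"

definition submersion ::
    "('a, 'e::euclidean_space) atlas \<Rightarrow> ('b, 'f::euclidean_space) atlas \<Rightarrow> ('a \<Rightarrow> 'b) \<Rightarrow> bool" where
  "submersion A B f \<longleftrightarrow> smooth_map A B f \<and> (\<forall>x\<in>mcarrier A. surj (mderiv A B f x))"

definition smooth_curve ::
    "('a, 'e::euclidean_space) atlas \<Rightarrow> real \<Rightarrow> (real \<Rightarrow> 'a) \<Rightarrow> bool" where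
  "smooth_curve A \<epsilon> c \<longleftrightarrow> \<epsilon> > 0 \<and> smooth_map {({-\<epsilon><..<\<epsilon>}, \<lambda>t. t)} A c"

definition curve_velocity :: "('a, 'e::euclidean_space) atlas \<Rightarrow> (real \<Rightarrow> 'a) \<Rightarrow> 'e" where
  "curve_velocity A c = vector_derivative (coords_at A (c 0) \<circ> c) (at 0)"


subsection \<open>Submanifolds\<close>

(* The charts obtained from slice charts: in a chart (U, \<phi>) of the ambient manifold S is cut out by
   the linear subspace range i, and \<psi> is \<phi> followed by the inverse of i. *)
definition submanifold_atlas ::
    "('a, 'e::euclidean_space) atlas \<Rightarrow> 'a set \<Rightarrow> ('a, 'd::euclidean_space) atlas" where
  "submanifold_atlas A S = {(U \<inter> S, \<psi>) | U \<psi>. \<exists>(\<phi> :: 'a \<Rightarrow> 'e) i.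
     manifold_chart A (U, \<phi>) \<and> linear i \<and> inj i \<and>
     \<phi> ` (U \<inter> S) = \<phi> ` U \<inter> range i \<and> (\<forall>p \<in> U \<inter> S. i (\<psi> p) = \<phi> p)}"

definition submanifold ::
    "'d::euclidean_space itself \<Rightarrow> ('a, 'e::euclidean_space) atlas \<Rightarrow> 'a set \<Rightarrow> bool" where
  "submanifold _ A S \<longleftrightarrow> mcarrier (submanifold_atlas A S :: ('a, 'd) atlas) = S"


section \<open>Oriented 2-planes in a 4-dimensional vector space\<close>

type_synonym V = "real^4"

(* An oriented 2-plane is represented by the set of its positively oriented bases. *)
type_synonym oplane = "(V \<times> V) set"

definition oplane :: "V \<Rightarrow> V \<Rightarrow> oplane" where
  "oplane u v = {(a *\<^sub>R u + b *\<^sub>R v, c *\<^sub>R u + d *\<^sub>R v) | a b c d. a * d - b * c > 0}"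

definition indep_pair :: "V \<Rightarrow> V \<Rightarrow> bool" where
  "indep_pair u v \<longleftrightarrow> u \<noteq> v \<and> independent {u, v}"

definition plane :: "oplane \<Rightarrow> V set" where
  "plane P = span (fst ` P)"

(* For a linear isomorphism g from R^2 x R^2 to V, the oriented planes that are graphs over the
   (oriented) first factor form the domain of a chart of the oriented Grassmannian, with the 2x2
   matrix of the graph as coordinate. *)
definition gr_graph :: "((real^2) \<times> (real^2) \<Rightarrow> V) \<Rightarrow> real^2^2 \<Rightarrow> oplane" where
  "gr_graph g a = oplane (g (axis 1 1, a *v axis 1 1)) (g (axis 2 1, a *v axis 2 1))"

definition gr_atlas :: "(oplane, real^2^2) atlas" where
  "gr_atlas = {(range (gr_graph g), inv (gr_graph g)) | g. linear g \<and> bij g}"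

(* The bundle of oriented 2-planes in the tangent spaces of M. *)
definition gr_bundle :: "('x, V) atlas \<Rightarrow> ('x \<times> oplane, V \<times> (real^2^2)) atlas" where
  "gr_bundle M =
     {({(x, P). x \<in> U \<and> map_prod (differential M \<phi> x) (differential M \<phi> x) ` P \<in> range (gr_graph g)},
       \<lambda>(x, P). (\<phi> x, inv (gr_graph g) (map_prod (differential M \<phi> x) (differential M \<phi> x) ` P)))
      | U \<phi> g. (U, \<phi>) \<in> M \<and> linear g \<and> bij g}"


subsection \<open>Tangent vectors of the Grassmannian as linear maps from P to V/P\<close>

(* An element of Lin(P, V/P) is represented by a linear map f on V: restrict f to P and reduce its
   values modulo P.  Representatives are not unique; lin_eq is equality in Lin(P, V/P). *)
definition lin_eq :: "oplane \<Rightarrow> (V \<Rightarrow> V) \<Rightarrow> (V \<Rightarrow> V) \<Rightarrow> bool" where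
  "lin_eq P f h \<longleftrightarrow> (\<forall>u\<in>plane P. f u - h u \<in> plane P)"

definition lin_rank :: "oplane \<Rightarrow> (V \<Rightarrow> V) \<Rightarrow> nat" where
  "lin_rank P f = dim (plane P \<union> f ` plane P) - dim (plane P)"

(* The velocity at t = 0 of a curve of planes with moving basis u t, v t is the element of
   Lin(P, V/P) that takes u 0 to u' 0 and v 0 to v' 0 modulo P. *)
definition gr_velocity :: "(real \<Rightarrow> oplane) \<Rightarrow> (V \<Rightarrow> V) \<Rightarrow> bool" where
  "gr_velocity \<gamma> f \<longleftrightarrow> linear f \<and> (\<exists>u v u' v'.
     (\<forall>\<^sub>F t in nhds 0. indep_pair (u t) (v t) \<and> \<gamma> t = oplane (u t) (v t)) \<and>
     (u has_vector_derivative u') (at 0) \<and> (v has_vector_derivative v') (at 0) \<and>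
     f (u 0) - u' \<in> plane (\<gamma> 0) \<and> f (v 0) - v' \<in> plane (\<gamma> 0))"

definition gr_tangent :: "oplane set \<Rightarrow> oplane \<Rightarrow> (V \<Rightarrow> V) set" where
  "gr_tangent S P = {f. \<exists>\<epsilon> \<gamma>. smooth_curve gr_atlas \<epsilon> \<gamma> \<and> (\<forall>t\<in>{-\<epsilon><..<\<epsilon>}. \<gamma> t \<in> S) \<and>
     \<gamma> 0 = P \<and> gr_velocity \<gamma> f}"

definition elliptic_line_congruence :: "oplane set \<Rightarrow> bool" where
  "elliptic_line_congruence S \<longleftrightarrow> submanifold TYPE(real^2) gr_atlas S \<and>
     (\<forall>P\<in>S. \<forall>f\<in>gr_tangent S P. lin_rank P f \<noteq> 1)"


section \<open>Pseudocomplex structures\<close>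

definition fiber_over :: "('x \<times> oplane) set \<Rightarrow> 'x \<Rightarrow> oplane set" where
  "fiber_over E x = {P. (x, P) \<in> E}"

abbreviation submanifold6_atlas :: "('x, V) atlas \<Rightarrow> ('x \<times> oplane) set \<Rightarrow> ('x \<times> oplane, real^6) atlas" where
  "submanifold6_atlas M E \<equiv> submanifold_atlas (gr_bundle M) E"

(* E is only required to submerse to a (necessarily open) subset of M; this includes the case of a
   fiber subbundle over all of M. *)
definition pseudocomplex_structure :: "('x, V) atlas \<Rightarrow> ('x \<times> oplane) set \<Rightarrow> bool" where
  "pseudocomplex_structure M E \<longleftrightarrow>
     submanifold TYPE(real^6) (gr_bundle M) E \<and>
     submersion (submanifold6_atlas M E) M fst \<and>
     (\<forall>x\<in>mcarrier M. elliptic_line_congruence (fiber_over E x))"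


subsection \<open>Oriented surfaces and E curves\<close>

definition oriented_atlas :: "('a, real^2) atlas \<Rightarrow> bool" where
  "oriented_atlas S \<longleftrightarrow> (\<forall>(U, \<phi>)\<in>S. \<forall>(W, \<psi>)\<in>S. \<forall>q \<in> \<phi> ` (U \<inter> W).
     det (matrix (frechet_derivative (\<psi> \<circ> inv_into U \<phi>) (at q))) > 0)"

(* An (injectively immersed) oriented surface in M: a subset of M with an oriented atlas of its
   own, for which the inclusion into M is an immersion. *)
definition oriented_surface :: "('x, V) atlas \<Rightarrow> ('x, real^2) atlas \<Rightarrow> bool" where
  "oriented_surface M S \<longleftrightarrow> smooth_manifold S \<and> oriented_atlas S \<and> immersion S M (\<lambda>x. x)"

definition tangent_plane :: "('x, V) atlas \<Rightarrow> ('x, real^2) atlas \<Rightarrow> 'x \<Rightarrow> oplane" where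
  "tangent_plane M S x =
     oplane (mderiv S M (\<lambda>x. x) x (axis 1 1)) (mderiv S M (\<lambda>x. x) x (axis 2 1))"

definition E_curve :: "('x, V) atlas \<Rightarrow> ('x \<times> oplane) set \<Rightarrow> ('x, real^2) atlas \<Rightarrow> bool" where
  "E_curve M E S \<longleftrightarrow> oriented_surface M S \<and> (\<forall>x\<in>mcarrier S. (x, tangent_plane M S x) \<in> E)"

(* The 4-manifold Y parametrizes the E curves C y; Z is the 6-manifold of incident pairs (x, y),
   with \<lambda> = fst and \<rho> = snd.  Smoothness of the family: \<lambda> and \<rho> are smooth, \<rho> is a submersion
   and its fibers are the given surfaces C y. *)
definition smooth_curve_family ::
    "('x, V) atlas \<Rightarrow> ('x \<times> oplane) set \<Rightarrow> ('y, V) atlas \<Rightarrow> ('y \<Rightarrow> ('x, real^2) atlas) \<Rightarrow>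
     ('x \<times> 'y, real^6) atlas \<Rightarrow> bool" where
  "smooth_curve_family X E Y C Z \<longleftrightarrow>
     (\<forall>y\<in>mcarrier Y. E_curve X E (C y)) \<and>
     smooth_manifold Z \<and> mcarrier Z = {(x, y). y \<in> mcarrier Y \<and> x \<in> mcarrier (C y)} \<and>
     smooth_map Z X fst \<and> submersion Z Y snd \<and>
     (\<forall>y\<in>mcarrier Y. smooth_map (C y) Z (\<lambda>x. (x, y)))"

definition tau :: "('x, V) atlas \<Rightarrow> ('y \<Rightarrow> ('x, real^2) atlas) \<Rightarrow> 'x \<times> 'y \<Rightarrow> 'x \<times> oplane" where
  "tau X C = (\<lambda>(x, y). (x, tangent_plane X (C y) x))"


subsection \<open>The dual structure\<close>

(* T is the set of complex linear maps from P to V/P for a complex structure i on P compatible with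
   the orientation of P and a complex structure j on V/P.  Both are given by representatives on V:
   j preserves P and satisfies j^2 = -1 modulo P. *)
definition complex_linear_maps ::
    "oplane \<Rightarrow> (V \<Rightarrow> V) set \<Rightarrow> (V \<Rightarrow> V) \<Rightarrow> (V \<Rightarrow> V) \<Rightarrow> bool" where
  "complex_linear_maps P T i j \<longleftrightarrow>
     linear i \<and> (\<forall>u\<in>plane P. i u \<in> plane P \<and> i (i u) = - u) \<and>
     (\<forall>u\<in>plane P. u \<noteq> 0 \<longrightarrow> (u, i u) \<in> P) \<and>
     linear j \<and> (\<forall>u\<in>plane P. j u \<in> plane P) \<and> (\<forall>v. j (j v) + v \<in> plane P) \<and>
     T = {f. linear f \<and> lin_eq P (f \<circ> i) (j \<circ> f)}"

(* (f1, f2) is a positively oriented real basis of the complex line T. *)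
definition positive_pair :: "oplane \<Rightarrow> (V \<Rightarrow> V) set \<Rightarrow> (V \<Rightarrow> V) \<Rightarrow> (V \<Rightarrow> V) \<Rightarrow> bool" where
  "positive_pair P T f1 f2 \<longleftrightarrow> f1 \<in> T \<and> f2 \<in> T \<and> \<not> lin_eq P f1 (\<lambda>u. 0) \<and>
     (\<exists>i j a b. complex_linear_maps P T i j \<and> b > 0 \<and>
        lin_eq P f2 (\<lambda>u. a *\<^sub>R f1 u + b *\<^sub>R j (f1 u)))"

definition ker_lambda :: "('x, V) atlas \<Rightarrow> ('x \<times> 'y, real^6) atlas \<Rightarrow> 'x \<times> 'y \<Rightarrow> (real^6) set" where
  "ker_lambda X Z z = {w. mderiv Z X fst z w = 0}"

definition Theta ::
    "('x, V) atlas \<Rightarrow> ('y \<Rightarrow> ('x, real^2) atlas) \<Rightarrow> ('x \<times> 'y, real^6) atlas \<Rightarrow> 'x \<times> 'y \<Rightarrow> (real^6) set" where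
  "Theta X C Z z = {w. mderiv Z X fst z w \<in> plane (snd (tau X C z))}"

(* The identification of ker \<lambda>'(z) with the tangent plane of the fiber E_x: f represents \<tau>'(z) w.
   Vectors in ker \<lambda>'(z) are velocities of curves in the fiber of \<lambda>, along which \<tau> takes values in
   the single Grassmannian of planes in the tangent space at x. *)
definition tau_deriv ::
    "('x, V) atlas \<Rightarrow> ('y \<Rightarrow> ('x, real^2) atlas) \<Rightarrow> ('x \<times> 'y, real^6) atlas \<Rightarrow> 'x \<times> 'y \<Rightarrow>
     real^6 \<Rightarrow> (V \<Rightarrow> V) \<Rightarrow> bool" where
  "tau_deriv X C Z z w f \<longleftrightarrow> (\<exists>\<epsilon> c. smooth_curve Z \<epsilon> c \<and> c 0 = z \<and>
     (\<forall>t\<in>{-\<epsilon><..<\<epsilon>}. fst (c t) = fst z) \<and> curve_velocity Z c = w \<and>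
     gr_velocity (\<lambda>t. snd (tau X C (c t))) f)"

definition positive_basis_ker_lambda ::
    "('x, V) atlas \<Rightarrow> ('x \<times> oplane) set \<Rightarrow> ('y \<Rightarrow> ('x, real^2) atlas) \<Rightarrow>
     ('x \<times> 'y, real^6) atlas \<Rightarrow> 'x \<times> 'y \<Rightarrow> real^6 \<Rightarrow> real^6 \<Rightarrow> bool" where
  "positive_basis_ker_lambda X E C Z z w1 w2 \<longleftrightarrow> w1 \<in> ker_lambda X Z z \<and> w2 \<in> ker_lambda X Z z \<and>
     (\<exists>f1 f2. tau_deriv X C Z z w1 f1 \<and> tau_deriv X C Z z w2 f2 \<and>
        positive_pair (snd (tau X C z))
          (gr_tangent (fiber_over E (fst z)) (snd (tau X C z))) f1 f2)"

(* The plane \<rho>'(z) \<Theta>_z, with the orientation transported from ker \<lambda>'(z) by \<rho>'(z). *)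
definition dual_plane ::
    "('x, V) atlas \<Rightarrow> ('x \<times> oplane) set \<Rightarrow> ('y, V) atlas \<Rightarrow> ('y \<Rightarrow> ('x, real^2) atlas) \<Rightarrow>
     ('x \<times> 'y, real^6) atlas \<Rightarrow> 'x \<times> 'y \<Rightarrow> oplane" where
  "dual_plane X E Y C Z z =
     {(p, q). p \<in> mderiv Z Y snd z ` Theta X C Z z \<and> q \<in> mderiv Z Y snd z ` Theta X C Z z \<and>
        (\<exists>w1 w2. positive_basis_ker_lambda X E C Z z w1 w2 \<and>
           p = mderiv Z Y snd z w1 \<and> q = mderiv Z Y snd z w2)}"

definition dual_map ::
    "('x, V) atlas \<Rightarrow> ('x \<times> oplane) set \<Rightarrow> ('y, V) atlas \<Rightarrow> ('y \<Rightarrow> ('x, real^2) atlas) \<Rightarrow>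
     ('x \<times> 'y, real^6) atlas \<Rightarrow> 'x \<times> 'y \<Rightarrow> 'y \<times> oplane" where
  "dual_map X E Y C Z z = (snd z, dual_plane X E Y C Z z)"


section \<open>Almost complex and complex structures\<close>

definition almost_complex_on :: "('x, V) atlas \<Rightarrow> 'x set \<Rightarrow> ('x \<Rightarrow> V \<Rightarrow> V) \<Rightarrow> bool" where
  "almost_complex_on M U J \<longleftrightarrow> openin (mtop M) U \<and>
     (\<forall>x\<in>U. linear (J x) \<and> (\<forall>v. J x (J x v) = - v)) \<and>
     (\<forall>(W, \<phi>)\<in>M. \<forall>v. smooth_on (\<phi> ` (U \<inter> W))
        (\<lambda>q. let x = inv_into W \<phi> q; D = differential M \<phi> x in D (J x (inv D v))))"

(* Around each point of U there are complex coordinates in which J is multiplication by \<i>. *)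
definition integrable_on_set :: "('x, V) atlas \<Rightarrow> 'x set \<Rightarrow> ('x \<Rightarrow> V \<Rightarrow> V) \<Rightarrow> bool" where
  "integrable_on_set M U J \<longleftrightarrow> (\<forall>x\<in>U. \<exists>W (\<psi> :: 'x \<Rightarrow> complex^2).
     x \<in> W \<and> W \<subseteq> U \<and> manifold_chart M (W, \<psi>) \<and>
     (\<forall>p\<in>W. \<forall>v. differential M \<psi> p (J p v) = \<i> *s differential M \<psi> p v))"

definition complex_lines :: "'x set \<Rightarrow> ('x \<Rightarrow> V \<Rightarrow> V) \<Rightarrow> ('x \<times> oplane) set" where
  "complex_lines U J = {(x, oplane u (J x u)) | x u. x \<in> U \<and> u \<noteq> 0}"

definition open_set_of_complex_lines ::
    "('x, V) atlas \<Rightarrow> 'x set \<Rightarrow> ('x \<Rightarrow> V \<Rightarrow> V) \<Rightarrow> ('x \<times> oplane) set \<Rightarrow> bool" where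
  "open_set_of_complex_lines M U J E \<longleftrightarrow>
     openin (subtopology (mtop (gr_bundle M)) (complex_lines U J)) E"

(* The pseudocomplex structure given locally by a map F from Z to the Grassmann bundle of M, that
   is by the images under F of small open sets of Z, is locally an almost complex structure,
   respectively a complex structure. *)
definition locally_almost_complex ::
    "('z, 'e::euclidean_space) atlas \<Rightarrow> ('x, V) atlas \<Rightarrow> ('z \<Rightarrow> 'x \<times> oplane) \<Rightarrow> bool" where
  "locally_almost_complex Z M F \<longleftrightarrow> (\<forall>z\<in>mcarrier Z. \<exists>W U J.
     openin (mtop Z) W \<and> z \<in> W \<and> almost_complex_on M U J \<and>
     open_set_of_complex_lines M U J (F ` W))"

definition locally_complex ::
    "('z, 'e::euclidean_space) atlas \<Rightarrow> ('x, V) atlas \<Rightarrow> ('z \<Rightarrow> 'x \<times> oplane) \<Rightarrow> bool" where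
  "locally_complex Z M F \<longleftrightarrow> (\<forall>z\<in>mcarrier Z. \<exists>W U J.
     openin (mtop Z) W \<and> z \<in> W \<and> almost_complex_on M U J \<and> integrable_on_set M U J \<and>
     open_set_of_complex_lines M U J (F ` W))"

end

theory Submission
  imports Defs
begin

text \<open>
  Write \<open>f\<close> and \<open>g\<close> for \<open>\<lambda>\<close> and \<open>\<rho>\<close> in charts. At a point of \<open>Z\<close> the Lie bracket induces a real bilinear map
  \<open>b : ker f' \<times> ker g' \<rightarrow> TZ / (ker f' + ker g')\<close>, which is nondegenerate because \<open>\<tau>\<close> is an immersion.
  Since \<open>J\<close> preserves \<open>f' (ker g')\<close>, the bracket is complex linear in its second argument, and since \<open>J'\<close>
  preserves \<open>g' (ker f')\<close>, it is complex linear in its first; hence \<open>J\<close> and \<open>J'\<close> induce the same complex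
  structure, up to sign, on the quotient and on each of the two kernels.

  Integrability then needs no Newlander--Nirenberg theorem, as holomorphic coordinates can be written down. Fix a
  point \<open>p\<close> of a curve through \<open>x0\<close>. A point \<open>x\<close> near \<open>x0\<close> is joined to \<open>p\<close> by a unique nearby curve of the
  family, and the slope of this curve at \<open>p\<close> is a complex number depending on \<open>x\<close> holomorphically or
  antiholomorphically, with the tangent plane of the joining curve as the kernel of its differential. Two such
  functions, for two curves through \<open>x0\<close>, form a chart. The situation is symmetric in \<open>X\<close> and \<open>Y\<close>.
\<close>

text \<open>Two signs enter, because a displacement of \<open>x\<close> moves the joining curve, and
  the structures on \<open>X\<close> and \<open>Y\<close> are compared both at the end over
  \<open>x\<close> and at the end over \<open>p\<close>. Their product is locally constant by
  continuity; where it is negative, the slope is replaced by its conjugate.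

  The bracket is an expression in derivatives at one point. A field \<open>V\<close> in
  \<open>ker g'\<close> satisfies \<open>g'' (w, V) + g' (V' w) = 0\<close>, so the derivative of
  \<open>f' V\<close> along \<open>w\<close> equals, modulo \<open>f' (ker g')\<close>,
  \<open>f'' (w, V) + f' u\<close> for any \<open>u\<close> with
  \<open>g'' (w, V) + g' u = 0\<close>. Symmetry of second derivatives then governs the exchange of
  \<open>f\<close> and \<open>g\<close>.

  Immersivity of \<tau> gives each \<open>w\<close> in \<open>ker f'\<close> only some partner
  \<open>v\<close>. Since \<open>f'\<close> makes \<open>ker g'\<close> a complex line on which the
  bracket is complex linear, no nonzero pair has zero bracket, and this form is symmetric. Hence
  slopes are available on both sides: those in \<open>X\<close> serve as functions, those in
  \<open>Y\<close> to find a point \<open>p\<close> for which the joining problem is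
  solvable.\<close>

abbreviation D :: "('e::euclidean_space \<Rightarrow> 'f::euclidean_space) \<Rightarrow> 'e \<Rightarrow> 'e \<Rightarrow> 'f" where
  "D f x \<equiv> frechet_derivative f (at x)"

section \<open>Derivatives of maps between Euclidean spaces\<close>

lemma D_cong_open:
  assumes "open S" "x \<in> S" "\<And>y. y \<in> S \<Longrightarrow> f y = g y" "f differentiable at x"
  shows "g differentiable at x" "D g x = D f x"
proof -
  have "(g has_derivative D f x) (at x)"
    using has_derivative_transform_within_open[OF _ assms(1,2), of f "D f x" UNIV g] assms
      frechet_derivative_works by blast
  then show "g differentiable at x" "D g x = D f x"
    using differentiableI frechet_derivative_at by metis+
qed

lemma D_eqI: "(f has_derivative f') (at x) \<Longrightarrow> D f x = f'"
  using frechet_derivative_at by metis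

lemma D_linear: "f differentiable at x \<Longrightarrow> linear (D f x)"
  using frechet_derivative_works has_derivative_linear by blast

lemma D_compose:
  assumes "f differentiable at x" "g differentiable at (f x)"
  shows "D (\<lambda>y. g (f y)) x v = D g (f x) (D f x v)"
proof -
  have "(g \<circ> f has_derivative D g (f x) \<circ> D f x) (at x)"
    by (rule diff_chain_at) (use assms frechet_derivative_works in blast)+
  from D_eqI[OF this] show ?thesis
    by (simp add: o_def)
qed

lemma D_linear_map: "linear L \<Longrightarrow> D L x = L"
  by (rule D_eqI) (simp add: linear_imp_has_derivative)

subsection \<open>Functions of class \<open>C\<^sup>k\<close>\<close>

lemma Ck_on_subset: "Ck_on k S f \<Longrightarrow> T \<subseteq> S \<Longrightarrow> Ck_on k T f"
  by (induction k arbitrary: f) (auto intro: continuous_on_subset)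

text \<open>\<open>Ck_on\<close> takes derivatives in a full neighbourhood of the point, so
  agreement on \<open>S\<close> determines them because \<open>S\<close> is open. Both functions
  vary in the induction, which passes to their derivatives in a fixed direction.\<close>

lemma Ck_on_cong_open:
  assumes "open S" "\<And>y. y \<in> S \<Longrightarrow> f y = g y" "Ck_on k S f"
  shows "Ck_on k S g"
  using assms(2,3)
proof (induction k arbitrary: f g)
  case 0
  then show ?case by (auto cong: continuous_on_cong)
next
  case (Suc k)
  have D: "g differentiable at x \<and> D g x = D f x" if "x \<in> S" for x
    using D_cong_open[OF assms(1) that Suc.prems(1)] Suc.prems that by auto
  have "Ck_on k S (\<lambda>x. D g x v)" for v
    by (rule Suc.IH[of "\<lambda>x. D f x v"]) (use Suc.prems D in auto)
  with D show ?case by auto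
qed

lemma Ck_on_SucD: "Ck_on (Suc k) S f \<Longrightarrow> Ck_on k S f"
proof (induction k arbitrary: f)
  case 0
  then show ?case
    by (auto intro!: differentiable_imp_continuous_on differentiable_at_imp_differentiable_on)
next
  case (Suc k)
  then show ?case by auto
qed

lemma Ck_on_const: "Ck_on k S (\<lambda>x. c)"
proof (induction k arbitrary: c)
  case (Suc k)
  have "D (\<lambda>x. c) x v = 0" for x :: 'a and v
    by (simp)
  then show ?case using Suc by simp
qed simp

lemma Ck_on_linear:
  assumes "linear L" shows "Ck_on k S L"
proof (cases k)
  case 0
  then show ?thesis using assms by (simp add: linear_continuous_on linear_linear)
next
  case (Suc n)
  then show ?thesis using assms
    by (simp add: D_linear_map linear_imp_differentiable Ck_on_const)
qed

lemma Ck_on_add: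
  assumes "open S" "Ck_on k S f" "Ck_on k S g"
  shows "Ck_on k S (\<lambda>x. f x + g x)"
  using assms(2,3)
proof (induction k arbitrary: f g)
  case 0
  then show ?case by (auto intro: continuous_intros)
next
  case (Suc k)
  have D: "D f x v + D g x v = D (\<lambda>x. f x + g x) x v" if "x \<in> S" for x v
    using D_eqI[OF has_derivative_add[of f "D f x" "at x" g "D g x"]] Suc.prems that
    by (simp add: frechet_derivative_works[symmetric])
  have "Ck_on k S (\<lambda>x. D (\<lambda>x. f x + g x) x v)" for v
    by (rule Ck_on_cong_open[OF assms(1) D]) (use Suc in auto)
  with Suc.prems show ?case by auto
qed

text \<open>The derivative of a product is a sum of two products, each of one undifferentiated
  factor with one derivative. The induction generalizes over both factors, and
  \<open>Ck_on_SucD\<close> lowers the undifferentiated one to the class of the other.\<close>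

lemma Ck_on_bilinear:
  assumes "bounded_bilinear p" "open S" "Ck_on k S f" "Ck_on k S g"
  shows "Ck_on k S (\<lambda>x. p (f x) (g x))"
  using assms(3,4)
proof (induction k arbitrary: f g)
  case 0
  then show ?case using bounded_bilinear.continuous_on[OF assms(1)] by auto
next
  case (Suc k)
  have der: "((\<lambda>x. p (f x) (g x)) has_derivative (\<lambda>v. p (f x) (D g x v) + p (D f x v) (g x))) (at x)"
    if "x \<in> S" for x
    using bounded_bilinear.FDERIV[OF assms(1), of f "D f x" x UNIV g "D g x"] Suc.prems that
    by (simp add: frechet_derivative_works[symmetric])
  have "Ck_on k S (\<lambda>x. p (f x) (D g x v) + p (D f x v) (g x))" for v
    by (intro Ck_on_add assms Suc.IH) (use Suc.prems Ck_on_SucD in auto)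
  from Ck_on_cong_open[OF assms(2) _ this]
  have "Ck_on k S (\<lambda>x. D (\<lambda>x. p (f x) (g x)) x v)" for v
    using D_eqI[OF der] by (metis (no_types, lifting))
  with der show ?case by (auto intro: differentiableI)
qed

lemma Ck_on_sum:
  assumes "open S" "\<And>i. i \<in> I \<Longrightarrow> Ck_on k S (f i)"
  shows "Ck_on k S (\<lambda>x. \<Sum>i\<in>I. f i x)"
  using assms(2)
  by (induction I rule: infinite_finite_induct) (auto intro: Ck_on_const Ck_on_add[OF assms(1)])

lemma linear_basis_expansion:
  fixes f :: "'a::euclidean_space \<Rightarrow> 'b::real_vector"
  assumes "linear f"
  shows "f x = (\<Sum>b\<in>Basis. (x \<bullet> b) *\<^sub>R f b)"
proof -
  have "f x = f (\<Sum>b\<in>Basis. (x \<bullet> b) *\<^sub>R b)"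
    by (simp add: euclidean_representation)
  also have "\<dots> = (\<Sum>b\<in>Basis. (x \<bullet> b) *\<^sub>R f b)"
    using assms by (simp add: linear_sum linear_cmul)
  finally show ?thesis .
qed

text \<open>Regularity of a family of linear maps is expressed throughout by the maps
  \<open>\<lambda>x. A x v\<close> for fixed \<open>v\<close>. Expanding \<open>u x\<close> in the
  basis reduces application to a moving vector to a finite sum of scalar multiples of such
  maps.\<close>

lemma Ck_on_apply_linear:
  fixes A :: "'a::euclidean_space \<Rightarrow> 'b::euclidean_space \<Rightarrow> 'c::euclidean_space"
  assumes "open S" "\<And>x. x \<in> S \<Longrightarrow> linear (A x)" "\<And>v. Ck_on k S (\<lambda>x. A x v)" "Ck_on k S u"
  shows "Ck_on k S (\<lambda>x. A x (u x))"
proof -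
  have "Ck_on k S (\<lambda>x. u x \<bullet> b)" for b
    by (rule Ck_on_bilinear[OF bounded_bilinear_inner]) (auto simp: assms Ck_on_const)
  then have "Ck_on k S (\<lambda>x. \<Sum>b\<in>Basis. (u x \<bullet> b) *\<^sub>R A x b)"
    by (intro Ck_on_sum Ck_on_bilinear[OF bounded_bilinear_scaleR]) (auto simp: assms)
  then show ?thesis
    by (rule Ck_on_cong_open[OF assms(1), rotated]) (simp add: linear_basis_expansion[OF assms(2), of _ "u y" for y])
qed

text \<open>The chain rule writes the derivative as \<open>D g (f x)\<close> applied to
  \<open>D f x v\<close>. For a fixed vector, \<open>D g\<close> at \<open>f x\<close> is again a
  composition with the same \<open>f\<close>, so only \<open>g\<close> varies in the
  induction.\<close>

lemma Ck_on_compose: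
  fixes f :: "'a::euclidean_space \<Rightarrow> 'b::euclidean_space" and g :: "'b \<Rightarrow> 'c::euclidean_space"
  assumes "open S" "open T" "f ` S \<subseteq> T" "Ck_on k S f" "Ck_on k T g"
  shows "Ck_on k S (\<lambda>x. g (f x))"
  using assms(4,5)
proof (induction k arbitrary: g)
  case 0
  then show ?case using assms(3) by (auto intro: continuous_on_compose2)
next
  case (Suc k)
  have df: "f differentiable at x" and dg: "g differentiable at (f x)" if "x \<in> S" for x
    using Suc.prems assms(3) that by auto
  have 1: "Ck_on k S (\<lambda>x. D g (f x) v)" for v
    by (rule Suc.IH) (use Suc.prems Ck_on_SucD in auto)
  have "Ck_on k S (\<lambda>x. D g (f x) (D f x v))" for v
    by (rule Ck_on_apply_linear[OF assms(1) _ 1]) (use dg D_linear Suc.prems in auto)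
  from Ck_on_cong_open[OF assms(1) _ this]
  have "Ck_on k S (\<lambda>x. D (\<lambda>x. g (f x)) x v)" for v
    using D_compose[OF df dg] by (metis (no_types, lifting))
  moreover have "(\<lambda>x. g (f x)) differentiable at x" if "x \<in> S" for x
    using differentiable_chain_at[OF df dg] that by (simp add: o_def)
  ultimately show ?case by auto
qed

subsection \<open>Smooth functions\<close>

lemma smooth_on_subset: "smooth_on S f \<Longrightarrow> T \<subseteq> S \<Longrightarrow> smooth_on T f"
  by (auto simp: smooth_on_def intro: Ck_on_subset)

lemma smooth_on_cong_open:
  "open S \<Longrightarrow> (\<And>y. y \<in> S \<Longrightarrow> f y = g y) \<Longrightarrow> smooth_on S f \<Longrightarrow> smooth_on S g"
  unfolding smooth_on_def using Ck_on_cong_open by blast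

lemma smooth_on_differentiable: "smooth_on S f \<Longrightarrow> x \<in> S \<Longrightarrow> f differentiable at x"
  unfolding smooth_on_def by (metis Ck_on.simps(2))

lemma smooth_on_has_derivative: "smooth_on S f \<Longrightarrow> x \<in> S \<Longrightarrow> (f has_derivative D f x) (at x)"
  using smooth_on_differentiable frechet_derivative_works by blast

lemma smooth_on_D: "smooth_on S f \<Longrightarrow> smooth_on S (\<lambda>x. D f x v)"
  unfolding smooth_on_def by (metis Ck_on.simps(2))

lemma smooth_on_continuous: "smooth_on S f \<Longrightarrow> continuous_on S f"
  unfolding smooth_on_def by (metis Ck_on.simps(1))

lemma smooth_on_const: "smooth_on S (\<lambda>x. c)"
  by (simp add: smooth_on_def Ck_on_const)

lemma smooth_on_linear: "linear L \<Longrightarrow> smooth_on S L"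
  by (simp add: smooth_on_def Ck_on_linear)

lemma smooth_on_add: "open S \<Longrightarrow> smooth_on S f \<Longrightarrow> smooth_on S g \<Longrightarrow> smooth_on S (\<lambda>x. f x + g x)"
  by (simp add: smooth_on_def Ck_on_add)

lemma smooth_on_bilinear:
  "bounded_bilinear p \<Longrightarrow> open S \<Longrightarrow> smooth_on S f \<Longrightarrow> smooth_on S g \<Longrightarrow> smooth_on S (\<lambda>x. p (f x) (g x))"
  by (simp add: smooth_on_def Ck_on_bilinear)

lemma smooth_on_apply_linear:
  fixes A :: "'a::euclidean_space \<Rightarrow> 'b::euclidean_space \<Rightarrow> 'c::euclidean_space"
  assumes "open S" "\<And>x. x \<in> S \<Longrightarrow> linear (A x)" "\<And>v. smooth_on S (\<lambda>x. A x v)" "smooth_on S u"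
  shows "smooth_on S (\<lambda>x. A x (u x))"
  using Ck_on_apply_linear[of S A _ u] assms unfolding smooth_on_def by blast

lemma smooth_on_compose:
  fixes f :: "'a::euclidean_space \<Rightarrow> 'b::euclidean_space" and g :: "'b \<Rightarrow> 'c::euclidean_space"
  assumes "open S" "open T" "f ` S \<subseteq> T" "smooth_on S f" "smooth_on T g"
  shows "smooth_on S (\<lambda>x. g (f x))"
  using assms Ck_on_compose unfolding smooth_on_def by blast

lemma smooth_on_linear_compose:
  "open S \<Longrightarrow> linear L \<Longrightarrow> smooth_on S f \<Longrightarrow> smooth_on S (\<lambda>x. L (f x))"
  by (rule smooth_on_compose[of S UNIV f L]) (auto intro: smooth_on_linear)

lemma smooth_on_scaleR_const: "open S \<Longrightarrow> smooth_on S f \<Longrightarrow> smooth_on S (\<lambda>x. c *\<^sub>R f x)"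
  by (rule smooth_on_linear_compose) (auto intro: linear_compose_scale_right linear_id[unfolded id_def])

lemma smooth_on_diff: "open S \<Longrightarrow> smooth_on S f \<Longrightarrow> smooth_on S g \<Longrightarrow> smooth_on S (\<lambda>x. f x - g x)"
  using smooth_on_add[of S f "\<lambda>x. (-1) *\<^sub>R g x"] smooth_on_scaleR_const[of S g "-1"] by simp

lemma smooth_on_Pair:
  assumes "open S" "smooth_on S f" "smooth_on S g"
  shows "smooth_on S (\<lambda>x. (f x, g x))"
proof -
  have "smooth_on S (\<lambda>x. (f x, 0) + (0, g x))"
    by (intro smooth_on_add smooth_on_linear_compose[of S "\<lambda>y. (y, 0)"]
        smooth_on_linear_compose[of S "\<lambda>y. (0, y)"] assms) (auto intro!: linearI)
  then show ?thesis by simp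
qed

lemma smooth_on_fst: "smooth_on S fst" and smooth_on_snd: "smooth_on S snd"
  by (auto intro!: smooth_on_linear linear_fst linear_snd)

lemma D_Pair:
  assumes "f differentiable at x" "g differentiable at x"
  shows "D (\<lambda>x. (f x, g x)) x v = (D f x v, D g x v)"
  by (subst D_eqI[OF has_derivative_Pair]) (use assms frechet_derivative_works in auto)

text \<open>The derivative splits into a term with the vector frozen at \<open>u x\<close> and one
  with the map frozen at \<open>A x\<close>. For \<open>A = D f\<close> and a vector field
  \<open>u\<close> the first is a second derivative of \<open>f\<close>; the computations of
  brackets rest on this case.\<close>

lemma has_derivative_apply_linear:
  fixes A :: "'a::euclidean_space \<Rightarrow> 'b::euclidean_space \<Rightarrow> 'c::euclidean_space"
  assumes "open S" "x \<in> S" "\<And>y. y \<in> S \<Longrightarrow> linear (A y)" "\<And>v. (\<lambda>y. A y v) differentiable at x"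
    and "(u has_derivative u') (at x)"
  shows "((\<lambda>y. A y (u y)) has_derivative (\<lambda>w. D (\<lambda>y. A y (u x)) x w + A x (u' w))) (at x)"
proof -
  have 0: "D (\<lambda>y. A y (u x)) x w = (\<Sum>b\<in>Basis. (u x \<bullet> b) *\<^sub>R D (\<lambda>y. A y b) x w)" for w
  proof -
    have "((\<lambda>y. \<Sum>b\<in>Basis. (u x \<bullet> b) *\<^sub>R A y b) has_derivative
        (\<lambda>w. \<Sum>b\<in>Basis. (u x \<bullet> b) *\<^sub>R D (\<lambda>y. A y b) x w)) (at x)"
      by (intro has_derivative_sum has_derivative_scaleR_right) (use assms(4) frechet_derivative_works in blast)
    from D_eqI[OF has_derivative_transform_within_open[OF this assms(1,2)], of "\<lambda>y. A y (u x)"]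
    show ?thesis by (simp add: linear_basis_expansion[OF assms(3), of _ "u x"])
  qed
  have "((\<lambda>y. \<Sum>b\<in>Basis. (u y \<bullet> b) *\<^sub>R A y b) has_derivative
     (\<lambda>w. \<Sum>b\<in>Basis. (u x \<bullet> b) *\<^sub>R D (\<lambda>y. A y b) x w + (u' w \<bullet> b) *\<^sub>R A x b)) (at x)"
    by (intro has_derivative_sum has_derivative_scaleR has_derivative_inner_left assms)
      (use assms(4) frechet_derivative_works in blast)
  also have "(\<lambda>w. \<Sum>b\<in>Basis. (u x \<bullet> b) *\<^sub>R D (\<lambda>y. A y b) x w + (u' w \<bullet> b) *\<^sub>R A x b)
     = (\<lambda>w. D (\<lambda>y. A y (u x)) x w + A x (u' w))"
    by (simp add: 0 sum.distrib linear_basis_expansion[OF assms(3)[OF assms(2)], of "u' w" for w])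
  finally show ?thesis
    by (rule has_derivative_transform_within_open[OF _ assms(1,2)])
      (simp add: linear_basis_expansion[OF assms(3), of _ "u y" for y])
qed

subsection \<open>Families of linear isomorphisms and the inverse function theorem\<close>

lemma linear_inj_imp_bij:
  fixes A :: "'a::euclidean_space \<Rightarrow> 'b::euclidean_space"
  assumes "linear A" "inj A" "DIM('a) = DIM('b)"
  shows "bij A"
proof -
  have "dim (range A) = DIM('b)"
    using assms dim_image_eq[of A UNIV] by (simp)
  then have "range A = UNIV"
    using assms(1) by (metis dim_eq_full linear_subspace_image span_eq_iff subspace_UNIV)
  then show ?thesis using assms(2) by (simp add: bij_def)
qed

lemma linear_inv_bij:
  assumes "linear f" "bij f"
  shows "linear (inv f)"
proof (rule linearI)
  have [simp]: "f (inv f y) = y" for y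
    using assms(2) by (simp add: bij_is_surj surj_f_inv_f)
  have eqI: "x = y" if "f x = f y" for x y
    using that assms(2) by (metis bij_is_inj injD)
  show "inv f (x + y) = inv f x + inv f y" for x y
    by (rule eqI) (simp add: linear_add[OF assms(1)])
  show "inv f (r *\<^sub>R x) = r *\<^sub>R inv f x" for r x
    by (rule eqI) (simp add: linear_cmul[OF assms(1)])
qed

text \<open>An injective linear map is bounded below: \<open>norm (A x0 v)\<close> is at least
  \<open>B * norm v\<close>. The quantity \<open>e x\<close> bounds the operator norm of
  \<open>A x - A x0\<close>, so a kernel vector of \<open>A x\<close> vanishes as long as
  \<open>e x < B\<close>.\<close>

lemma inj_linear_nbhd:
  fixes A :: "'a::euclidean_space \<Rightarrow> 'b::euclidean_space \<Rightarrow> 'c::euclidean_space"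
  assumes "open S" "x0 \<in> S" "\<And>x. x \<in> S \<Longrightarrow> linear (A x)" "\<And>v. continuous_on S (\<lambda>x. A x v)"
    and "inj (A x0)"
  obtains U where "open U" "x0 \<in> U" "U \<subseteq> S" "\<And>x. x \<in> U \<Longrightarrow> inj (A x)"
proof -
  obtain B where B: "B > 0" "\<And>v. B * norm v \<le> norm (A x0 v)"
    using linear_inj_bounded_below_pos[OF assms(3)[OF assms(2)] assms(5)] by metis
  define e where "e x = (\<Sum>b\<in>Basis. norm (A x b - A x0 b))" for x
  have "continuous_on S e"
    unfolding e_def by (intro continuous_intros assms(4))
  then have "open (S \<inter> e -` {..<B})"
    by (rule continuous_open_preimage) (simp_all add: assms(1))
  moreover have "inj (A x)" if "x \<in> S" "e x < B" for x
  proof -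
    have "v = 0" if "A x v = 0" for v
    proof -
      have "A x0 v = A x0 v - A x v" using that by simp
      also have "\<dots> = (\<Sum>b\<in>Basis. (v \<bullet> b) *\<^sub>R (A x0 b - A x b))"
        unfolding scaleR_diff_right sum_subtractf
        using linear_basis_expansion[OF assms(3)[OF \<open>x \<in> S\<close>], of v]
          linear_basis_expansion[OF assms(3)[OF assms(2)], of v]
        by metis
      finally have "A x0 v = (\<Sum>b\<in>Basis. (v \<bullet> b) *\<^sub>R (A x0 b - A x b))" .
      then have "norm (A x0 v) \<le> (\<Sum>b\<in>Basis. norm ((v \<bullet> b) *\<^sub>R (A x0 b - A x b)))"
        using norm_sum by metis
      also have "\<dots> \<le> (\<Sum>b\<in>Basis. norm v * norm (A x b - A x0 b))"
        by (intro sum_mono) (auto simp: norm_minus_commute intro!: mult_right_mono Basis_le_norm)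
      also have "\<dots> = norm v * e x"
        by (simp add: e_def sum_distrib_left)
      finally have "B * norm v \<le> norm v * e x"
        using B(2) order_trans by blast
      then show ?thesis using \<open>e x < B\<close>
        by (smt (verit) mult.commute mult_right_less_imp_less norm_ge_zero norm_eq_zero mult_strict_left_mono)
    qed
    then show ?thesis
      using linear_injective_0[OF assms(3)[OF \<open>x \<in> S\<close>]] by blast
  qed
  ultimately show thesis
    using that[of "S \<inter> e -` {..<B}"] assms(2) B(1) by (auto simp: e_def)
qed

text \<open>The inverse function theorem for a map of a space into itself is applied to
  \<open>h \<circ> f\<close>, where \<open>h\<close> identifies the two types of equal dimension;
  \<open>k\<close> carries the result back. Only the derivative of the inverse is asserted here: its
  smoothness rests on \<open>inverse_family_smooth\<close>, which in turn uses this lemma.\<close>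

lemma inverse_function_euclidean:
  fixes f :: "'a::euclidean_space \<Rightarrow> 'b::euclidean_space"
  assumes dim: "DIM('a) = DIM('b)" and "open S" and f: "smooth_on S f" and "x0 \<in> S" and inj: "inj (D f x0)"
  obtains U V g where "open U" "x0 \<in> U" "U \<subseteq> S" "open V" "homeomorphism U V f g"
    "\<And>x. x \<in> U \<Longrightarrow> bij (D f x)" "\<And>y. y \<in> V \<Longrightarrow> (g has_derivative inv (D f (g y))) (at y)"
proof -
  obtain h :: "'b \<Rightarrow> 'a" and k where hk: "linear h" "linear k" "\<And>x. k (h x) = x" "\<And>y. h (k y) = y"
    using isomorphisms_UNIV_UNIV[OF dim[symmetric]] by metis
  define F' where "F' x = Blinfun (\<lambda>v. h (D f x v))" for x
  have lin: "linear (D f x)" if "x \<in> S" for x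
    using that f D_linear smooth_on_differentiable by blast
  have bl: "bounded_linear (\<lambda>v. h (D f x v))" if "x \<in> S" for x
    using linear_compose[OF lin[OF that] hk(1)] by (simp add: linear_linear o_def)
  have F': "blinfun_apply (F' x) = (\<lambda>v. h (D f x v))" if "x \<in> S" for x
    unfolding F'_def by (rule bounded_linear_Blinfun_apply[OF bl[OF that]])
  have der: "((\<lambda>x. h (f x)) has_derivative F' x) (at x)" if "x \<in> S" for x
    unfolding F'[OF that]
    by (rule bounded_linear.has_derivative) (use hk(1) linear_linear smooth_on_has_derivative[OF f that] in auto)
  have cont: "continuous_on S F'"
  proof (rule continuous_on_blinfun_componentwise)
    fix i :: 'a
    have "continuous_on S (\<lambda>x. h (D f x i))"
      using linear_continuous_on_compose[OF smooth_on_continuous[OF smooth_on_D[OF f]] hk(1)] .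
    then show "continuous_on S (\<lambda>x. blinfun_apply (F' x) i)"
      by (rule continuous_on_eq) (simp add: F')
  qed
  have bij0: "bij (D f x0)"
    by (rule linear_inj_imp_bij) (use assms lin in auto)
  \<comment> \<open>The inverse of \<open>h \<circ> D f x0\<close>, the derivative of
    \<open>h \<circ> f\<close> at \<open>x0\<close>.\<close>
  define L where "L v = inv (D f x0) (k v)" for v
  have "linear L"
    unfolding L_def
    using linear_compose[OF hk(2) linear_inv_bij[OF lin[OF \<open>x0 \<in> S\<close>] bij0]] by (simp add: o_def)
  then have L: "blinfun_apply (Blinfun L) = L"
    by (simp add: bounded_linear_Blinfun_apply linear_linear)
  have "Blinfun L o\<^sub>L F' x0 = id_blinfun"
    by (rule blinfun_eqI) (simp add: L F' \<open>x0 \<in> S\<close> L_def hk bij0 bij_is_inj)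
  from inverse_function_theorem[OF \<open>open S\<close> der cont \<open>x0 \<in> S\<close> this]
  obtain U V g g' where UV: "open U" "U \<subseteq> S" "x0 \<in> U" "open V" "homeomorphism U V (\<lambda>x. h (f x)) g"
    and g: "\<And>y. y \<in> V \<Longrightarrow> (g has_derivative (g' y)) (at y)"
      "\<And>y. y \<in> V \<Longrightarrow> g' y = inv (blinfun_apply (F' (g y)))"
      "\<And>y. y \<in> V \<Longrightarrow> bij (blinfun_apply (F' (g y)))"
    by metis
  have gS: "g y \<in> U" if "y \<in> V" for y
    using that UV(5) homeomorphism_image2 by blast
  have bij: "bij (D f (g y))" if "y \<in> V" for y
  proof -
    have gy: "g y \<in> S" using gS[OF that] UV(2) by blast
    have "D f (g y) = k \<circ> (\<lambda>v. h (D f (g y) v))" by (auto simp: hk)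
    moreover have "bij k" using hk by (metis bijI')
    ultimately show ?thesis using g(3)[OF that] F'[OF gy] by (metis bij_comp)
  qed
  show thesis
  proof (rule that[of U "h -` V" "\<lambda>y. g (h y)"])
    show "open (h -` V)"
      by (rule open_vimage[OF UV(4)]) (simp add: hk(1) linear_continuous_on linear_linear)
    show "homeomorphism U (h -` V) f (\<lambda>y. g (h y))"
    proof (rule homeomorphismI)
      show "continuous_on U f"
        using smooth_on_continuous[OF f] UV(2) continuous_on_subset by blast
      show "continuous_on (h -` V) (\<lambda>y. g (h y))"
        by (rule continuous_on_compose2[OF homeomorphism_cont2[OF UV(5)]])
          (use hk(1) linear_continuous_on[of h] in \<open>auto simp: linear_linear\<close>)
      show "f ` U \<subseteq> h -` V" using homeomorphism_image1[OF UV(5)] by auto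
      show "(\<lambda>y. g (h y)) ` (h -` V) \<subseteq> U" using gS by auto
      show "g (h (f x)) = x" if "x \<in> U" for x using homeomorphism_apply1[OF UV(5) that] .
      show "f (g (h y)) = y" if "y \<in> h -` V" for y
        using homeomorphism_apply2[OF UV(5), of "h y"] that hk(3) by (metis vimageD)
    qed
    show "bij (D f x)" if "x \<in> U" for x
      using bij[of "h (f x)"] homeomorphism_apply1[OF UV(5) that] homeomorphism_image1[OF UV(5)] that by force
    show "((\<lambda>y. g (h y)) has_derivative inv (D f (g (h y)))) (at y)" if "y \<in> h -` V" for y
    proof -
      have y: "h y \<in> V" using that by auto
      have gy: "g (h y) \<in> S" using gS[OF y] UV(2) by blast
      have "(g \<circ> h has_derivative g' (h y) \<circ> h) (at y)"
        by (rule diff_chain_at[OF linear_imp_has_derivative[OF hk(1)]]) (use g(1) y in auto)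
      moreover have "g' (h y) \<circ> h = inv (D f (g (h y)))"
      proof
        fix v
        have b: "bij (\<lambda>v. h (D f (g (h y)) v))" using g(3)[OF y] F'[OF gy] by simp
        have "h (D f (g (h y)) (inv (D f (g (h y))) v)) = h v"
          using bij[OF y] by (simp add: bij_is_surj surj_f_inv_f)
        from inv_f_eq[OF bij_is_inj[OF b] this]
        show "(g' (h y) \<circ> h) v = inv (D f (g (h y))) v"
          by (simp add: g(2)[OF y] F'[OF gy])
      qed
      ultimately show ?thesis by (simp add: o_def)
    qed
  qed (use UV in auto)
qed

text \<open>The map \<open>F (x, u) = (x, A x u)\<close> has a block triangular derivative, which is
  injective because \<open>A x\<close> is. Its local inverse has second component
  \<open>inv (A x) v\<close> at \<open>(x, v)\<close>, whence differentiability. All higher classes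
  follow from the formula for the derivative of an inverse matrix.\<close>

lemma inverse_family_smooth:
  fixes A :: "'a::euclidean_space \<Rightarrow> 'b::euclidean_space \<Rightarrow> 'c::euclidean_space"
  assumes dim: "DIM('b) = DIM('c)" and S: "open S" and lin: "\<And>x. x \<in> S \<Longrightarrow> linear (A x)"
    and inj: "\<And>x. x \<in> S \<Longrightarrow> inj (A x)" and sm: "\<And>v. smooth_on S (\<lambda>x. A x v)"
  shows "smooth_on S (\<lambda>x. inv (A x) v)"
proof -
  have bij: "bij (A x)" if "x \<in> S" for x
    by (rule linear_inj_imp_bij[OF lin[OF that] inj[OF that] dim])
  have linv: "linear (inv (A x))" if "x \<in> S" for x
    by (rule linear_inv_bij[OF lin[OF that] bij[OF that]])
  have Ainv [simp]: "A x (inv (A x) v) = v" "inv (A x) (A x u) = u" if "x \<in> S" for x u v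
    using bij[OF that] by (simp_all add: bij_is_surj surj_f_inv_f bij_is_inj)
  have dA: "(\<lambda>x. A x v) differentiable at x" if "x \<in> S" for x v
    by (rule smooth_on_differentiable[OF sm that])
  have diff: "(\<lambda>x. inv (A x) v) differentiable at x" if x: "x \<in> S" for x v
  proof -
    define F where "F = (\<lambda>p. (fst p, A (fst p) (snd p)))"
    have "smooth_on (S \<times> UNIV) (\<lambda>p. A (fst p) (snd p))"
      by (rule smooth_on_apply_linear, use S in \<open>simp add: open_Times\<close>, use lin in force,
          rule smooth_on_compose[OF _ S _ smooth_on_fst sm], use S in \<open>auto simp: open_Times smooth_on_snd\<close>)
    then have F: "smooth_on (S \<times> UNIV) F"
      unfolding F_def by (intro smooth_on_Pair smooth_on_fst) (simp add: S open_Times)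
    let ?p = "(x, inv (A x) v)"
    have dfst: "(\<lambda>p. A (fst p) v') differentiable at ?p" for v'
      using differentiable_chain_at[of fst ?p "\<lambda>x. A x v'"] dA[OF x]
      by (simp add: o_def bounded_linear_imp_differentiable bounded_linear_fst)
    have "((\<lambda>p. A (fst p) (snd p)) has_derivative (\<lambda>w. D (\<lambda>p. A (fst p) (snd ?p)) ?p w + A (fst ?p) (snd w))) (at ?p)"
      by (rule has_derivative_apply_linear[where S = "S \<times> UNIV"])
       (use x S lin dfst in \<open>auto simp: open_Times intro!: has_derivative_snd has_derivative_ident\<close>)
    then have "(F has_derivative (\<lambda>w. (fst w, D (\<lambda>p. A (fst p) (snd ?p)) ?p w + A (fst ?p) (snd w)))) (at ?p)"
      unfolding F_def by (intro has_derivative_Pair has_derivative_fst has_derivative_ident)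
    note DF0 = D_eqI[OF this]
    have DF: "D F ?p w = (fst w, D (\<lambda>p. A (fst p) (snd ?p)) ?p w + A x (snd w))" for w
      by (simp add: DF0)
    have linF: "linear (D F ?p)"
      by (rule D_linear, rule smooth_on_differentiable[OF F]) (use x in auto)
    have D1: "D (\<lambda>p. A (fst p) (snd ?p)) ?p w = D (\<lambda>y. A y (snd ?p)) x (fst w)" for w
      using D_compose[of fst ?p "\<lambda>y. A y (snd ?p)" w] dA[OF x]
      by (simp add: bounded_linear_imp_differentiable bounded_linear_fst D_linear_map linear_fst)
    have "inj (D F ?p)"
      unfolding linear_injective_0[OF linF]
    proof (intro allI impI)
      fix w assume "D F ?p w = 0"
      then have "fst w = 0" "D (\<lambda>y. A y (snd ?p)) x (fst w) + A x (snd w) = 0"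
        using D1[of w] by (auto simp: DF zero_prod_def)
      moreover have "D (\<lambda>y. A y (snd ?p)) x 0 = 0"
        using D_linear[OF dA[OF x]] linear_0 by blast
      ultimately have "A x (snd w) = 0" by simp
      then have "snd w = 0" using Ainv(2)[OF x, of "snd w"] linear_0[OF linv[OF x]] by simp
      then show "w = 0" using \<open>fst w = 0\<close> by (simp add: prod_eq_iff)
    qed
    moreover have "DIM('a \<times> 'b) = DIM('a \<times> 'c)" "open (S \<times> (UNIV :: 'b set))" "?p \<in> S \<times> UNIV"
      using dim S x by (simp_all add: open_Times)
    ultimately obtain U V g where UV: "open U" "?p \<in> U" "U \<subseteq> S \<times> UNIV" "open V" "homeomorphism U V F g"
      and g: "\<And>y. y \<in> V \<Longrightarrow> (g has_derivative inv (D F (g y))) (at y)"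
      using inverse_function_euclidean[OF _ _ F, of ?p] by metis
    have xv: "(x, v) \<in> V"
      using homeomorphism_image1[OF UV(5)] UV(2) x by (force simp: F_def)
    define T where "T = (\<lambda>y. (y, v)) -` V"
    have T: "open T" "x \<in> T" unfolding T_def
      using xv by (auto intro!: open_vimage UV continuous_intros)
    have "(\<lambda>y. snd (g (y, v))) differentiable at x"
    proof -
      have "((\<lambda>y. (y, v)) has_derivative (\<lambda>w. (w, 0))) (at x)"
        by (intro derivative_intros)
      from has_derivative_snd[OF diff_chain_at[OF this g[OF xv]]]
      show ?thesis by (auto simp: o_def differentiable_def)
    qed
    note dg = this
    have eq: "snd (g (y, v)) = inv (A y) v" if "y \<in> T" for y
    proof -
      have "F (g (y, v)) = (y, v)" "g (y, v) \<in> U"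
        using that homeomorphism_apply2[OF UV(5)] homeomorphism_image2[OF UV(5)] by (auto simp: T_def)
      then have "fst (g (y, v)) = y" "A y (snd (g (y,v))) = v" "y \<in> S"
        using UV(3) by (auto simp: F_def)
      then show ?thesis using Ainv(2) by metis
    qed
    show ?thesis by (rule D_cong_open(1)[OF T eq dg])
  qed
  \<comment> \<open>Obtained by differentiating the constant \<open>A y (inv (A y) v) = v\<close> by
    the product rule.\<close>
  have Dinv: "D (\<lambda>x. inv (A x) v) x w = inv (A x) (- D (\<lambda>y. A y (inv (A x) v)) x w)" if x: "x \<in> S" for x v w
  proof -
    have "((\<lambda>y. inv (A y) v) has_derivative D (\<lambda>x. inv (A x) v) x) (at x)"
      using diff[OF x] frechet_derivative_works by blast
    from has_derivative_apply_linear[OF S x lin dA[OF x] this]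
    have "((\<lambda>y. A y (inv (A y) v)) has_derivative (\<lambda>w. D (\<lambda>y. A y (inv (A x) v)) x w + A x (D (\<lambda>x. inv (A x) v) x w))) (at x)"
      by simp
    note 1 = this
    have 2: "((\<lambda>y. A y (inv (A y) v)) has_derivative (\<lambda>w. 0)) (at x)"
      by (rule has_derivative_transform_within_open[OF has_derivative_const[of v] S x]) simp
    have "D (\<lambda>y. A y (inv (A x) v)) x w + A x (D (\<lambda>x. inv (A x) v) x w) = 0"
      using fun_cong[OF has_derivative_unique[OF 1 2], of w] .
    then have "A x (D (\<lambda>x. inv (A x) v) x w) = - D (\<lambda>y. A y (inv (A x) v)) x w"
      by (simp add: add_eq_0_iff)
    then show ?thesis using Ainv(2)[OF x] by metis
  qed
  \<comment> \<open>Linearity in \<open>c\<close> permits applying this family to the moving vector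
    \<open>inv (A x) v\<close> in the induction on the class.\<close>
  have linD: "linear (\<lambda>c. D (\<lambda>y. A y c) x w)" if x: "x \<in> S" for x w
  proof (rule linearI)
    fix a b and r :: real
    have h: "((\<lambda>y. A y c) has_derivative D (\<lambda>y. A y c) x) (at x)" for c
      using dA[OF x] frechet_derivative_works by blast
    have "((\<lambda>y. A y (a + b)) has_derivative (\<lambda>w. D (\<lambda>y. A y a) x w + D (\<lambda>y. A y b) x w)) (at x)"
      by (rule has_derivative_transform_within_open[OF has_derivative_add[OF h h] S x]) (simp add: lin linear_add)
    then show "D (\<lambda>y. A y (a + b)) x w = D (\<lambda>y. A y a) x w + D (\<lambda>y. A y b) x w"
      using D_eqI by fastforce
    have "((\<lambda>y. A y (r *\<^sub>R a)) has_derivative (\<lambda>w. r *\<^sub>R D (\<lambda>y. A y a) x w)) (at x)"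
      by (rule has_derivative_transform_within_open[OF has_derivative_scaleR_right[OF h] S x]) (simp add: lin linear_cmul)
    then show "D (\<lambda>y. A y (r *\<^sub>R a)) x w = r *\<^sub>R D (\<lambda>y. A y a) x w"
      using D_eqI by fastforce
  qed
  \<comment> \<open>Bootstrapping: \<open>Dinv\<close> expresses the derivative through
    \<open>inv (A x)\<close> and derivatives of \<open>A\<close> alone, so class C^k of the inverse
    for all \<open>v\<close> yields class C^(k+1).\<close>
  have "Ck_on k S (\<lambda>x. inv (A x) v)" for k v
  proof (induction k arbitrary: v)
    case 0
    show ?case using diff by (auto intro!: differentiable_imp_continuous_on differentiable_at_imp_differentiable_on)
  next
    case (Suc k)
    have 1: "Ck_on k S (\<lambda>x. D (\<lambda>y. A y (inv (A x) v)) x w)" for w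
      using smooth_on_D[OF sm] by (intro Ck_on_apply_linear[OF S linD _ Suc]) (auto simp: smooth_on_def)
    have "Ck_on k S (\<lambda>x. - D (\<lambda>y. A y (inv (A x) v)) x w)" for w
      using Ck_on_bilinear[OF bounded_bilinear_scaleR S Ck_on_const[of k S "-1"] 1] by simp
    from Ck_on_apply_linear[OF S linv Suc this]
    have "Ck_on k S (\<lambda>x. inv (A x) (- D (\<lambda>y. A y (inv (A x) v)) x w))" for w .
    from Ck_on_cong_open[OF S Dinv[symmetric] this]
    have "Ck_on k S (\<lambda>x. D (\<lambda>x. inv (A x) v) x w)" for w .
    with diff show ?case by simp
  qed
  then show ?thesis by (simp add: smooth_on_def)
qed

text \<open>Smoothness of \<open>g\<close> by bootstrapping: \<open>D g y\<close> is the inverse of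
  \<open>D f\<close> at \<open>g y\<close>, a smooth family composed with \<open>g\<close>, so
  \<open>g\<close> gains one degree of differentiability at each turn.\<close>

theorem smooth_inverse_function:
  fixes f :: "'a::euclidean_space \<Rightarrow> 'b::euclidean_space"
  assumes dim: "DIM('a) = DIM('b)" and "open S" and f: "smooth_on S f" and "x0 \<in> S" and inj: "inj (D f x0)"
  obtains U V g where "open U" "x0 \<in> U" "U \<subseteq> S" "open V" "homeomorphism U V f g"
    "\<And>x. x \<in> U \<Longrightarrow> bij (D f x)" "smooth_on V g"
proof -
  obtain U V g where UV: "open U" "x0 \<in> U" "U \<subseteq> S" "open V" "homeomorphism U V f g"
    and bij: "\<And>x. x \<in> U \<Longrightarrow> bij (D f x)" and g: "\<And>y. y \<in> V \<Longrightarrow> (g has_derivative inv (D f (g y))) (at y)"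
    using inverse_function_euclidean[OF assms] by metis
  have gU: "g ` V \<subseteq> U" using homeomorphism_image2[OF UV(5)] by simp
  have fU: "smooth_on U f" using f UV(3) smooth_on_subset by blast
  have sm: "smooth_on U (\<lambda>x. inv (D f x) v)" for v
    by (rule inverse_family_smooth[OF dim UV(1)])
      (use bij bij_is_inj fU in \<open>auto intro: smooth_on_D smooth_on_differentiable D_linear\<close>)
  have "Ck_on k V g" for k
  proof (induction k)
    case 0
    show ?case using homeomorphism_cont2[OF UV(5)] by simp
  next
    case (Suc k)
    have "Ck_on k V (\<lambda>y. inv (D f (g y)) v)" for v
      using Ck_on_compose[OF UV(4,1) gU Suc] sm[unfolded smooth_on_def] by blast
    then have "Ck_on k V (\<lambda>y. D g y v)" for v
      by (rule Ck_on_cong_open[OF UV(4), rotated]) (simp add: D_eqI[OF g])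
    then show ?case using g by (auto intro: differentiableI)
  qed
  then show thesis
    using that[OF UV bij] by (simp add: smooth_on_def)
qed

subsection \<open>Symmetry of second derivatives\<close>

lemma has_real_derivative_line:
  fixes F :: "'a::euclidean_space \<Rightarrow> real"
  assumes "F differentiable at (p + t *\<^sub>R w)"
  shows "((\<lambda>s. F (p + s *\<^sub>R w)) has_real_derivative D F (p + t *\<^sub>R w) w) (at t)"
proof -
  have "((\<lambda>s. p + s *\<^sub>R w) has_derivative (\<lambda>s. s *\<^sub>R w)) (at t)"
    by (auto intro!: derivative_eq_intros)
  from diff_chain_at[OF this] assms frechet_derivative_works
  have "((\<lambda>s. F (p + s *\<^sub>R w)) has_derivative (\<lambda>s. D F (p + t *\<^sub>R w) (s *\<^sub>R w))) (at t)"
    by (fastforce simp: o_def)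
  moreover have "D F (p + t *\<^sub>R w) (s *\<^sub>R w) = D F (p + t *\<^sub>R w) w * s" for s
    using linear_cmul[OF D_linear[OF assms], of s w] by simp
  ultimately show ?thesis
    by (simp add: has_field_derivative_def)
qed

text \<open>The mean value theorem is applied along \<open>v\<close> to the increment of
  \<open>F\<close> across \<open>h *\<^sub>R w\<close>, and along \<open>w\<close> to the derivative
  of \<open>F\<close> in the direction \<open>v\<close>. The second difference is symmetric in
  \<open>v\<close> and \<open>w\<close>, so the opposite order yields the other mixed
  derivative.\<close>

lemma second_difference:
  fixes F :: "'a::euclidean_space \<Rightarrow> real"
  assumes F: "smooth_on (ball x r) F" and h: "h > 0" "h * (norm v + norm w) < r"
  shows "\<exists>p. dist x p \<le> h * (norm v + norm w) \<and>
    F (x + h *\<^sub>R v + h *\<^sub>R w) - F (x + h *\<^sub>R v) - F (x + h *\<^sub>R w) + F x = h * h * D (\<lambda>y. D F y v) p w"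
proof -
  have le: "dist x (x + t *\<^sub>R v + s *\<^sub>R w) \<le> h * (norm v + norm w)"
    if "0 \<le> t" "t \<le> h" "0 \<le> s" "s \<le> h" for s t
  proof -
    have "dist x (x + t *\<^sub>R v + s *\<^sub>R w) = norm (t *\<^sub>R v + s *\<^sub>R w)"
      by (metis add.assoc add_diff_cancel_left' dist_commute dist_norm)
    also have "\<dots> \<le> t * norm v + s * norm w"
      using norm_triangle_ineq[of "t *\<^sub>R v" "s *\<^sub>R w"] that by simp
    also have "\<dots> \<le> h * norm v + h * norm w"
      by (intro add_mono mult_right_mono that) auto
    finally show ?thesis by (simp add: distrib_left)
  qed
  have inb: "x + t *\<^sub>R v + s *\<^sub>R w \<in> ball x r" if "0 \<le> t" "t \<le> h" "0 \<le> s" "s \<le> h" for s t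
    using le[OF that] h by simp
  have "((\<lambda>t. F (x + h *\<^sub>R w + t *\<^sub>R v) - F (x + t *\<^sub>R v)) has_real_derivative
      (D F (x + h *\<^sub>R w + t *\<^sub>R v) v - D F (x + t *\<^sub>R v) v)) (at t)" if "0 \<le> t" "t \<le> h" for t
    using inb[OF that, of h] inb[OF that, of 0] h
    by (intro DERIV_diff has_real_derivative_line smooth_on_differentiable[OF F]) (auto simp: algebra_simps)
  from MVT2[OF h(1) this] obtain t where t: "0 < t" "t < h"
    and 1: "(F (x + h *\<^sub>R w + h *\<^sub>R v) - F (x + h *\<^sub>R v)) - (F (x + h *\<^sub>R w + 0 *\<^sub>R v) - F (x + 0 *\<^sub>R v))
      = (h - 0) * (D F (x + h *\<^sub>R w + t *\<^sub>R v) v - D F (x + t *\<^sub>R v) v)"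
    by meson
  have "((\<lambda>s. D F (x + t *\<^sub>R v + s *\<^sub>R w) v) has_real_derivative
      D (\<lambda>y. D F y v) (x + t *\<^sub>R v + s *\<^sub>R w) w) (at s)" if "0 \<le> s" "s \<le> h" for s
    using inb[OF _ _ that, of t] t
    by (intro has_real_derivative_line[of "\<lambda>y. D F y v"] smooth_on_differentiable[OF smooth_on_D[OF F]]) auto
  from MVT2[OF h(1) this] obtain s where s: "0 < s" "s < h"
    and 2: "D F (x + t *\<^sub>R v + h *\<^sub>R w) v - D F (x + t *\<^sub>R v + 0 *\<^sub>R w) v
      = (h - 0) * D (\<lambda>y. D F y v) (x + t *\<^sub>R v + s *\<^sub>R w) w"
    by meson
  have "F (x + h *\<^sub>R v + h *\<^sub>R w) - F (x + h *\<^sub>R v) - F (x + h *\<^sub>R w) + F x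
      = h * (h * D (\<lambda>y. D F y v) (x + t *\<^sub>R v + s *\<^sub>R w) w)"
    using 1 2 by (simp add: algebra_simps)
  then show ?thesis
    using le[of t s] s t by (intro exI[of _ "x + t *\<^sub>R v + s *\<^sub>R w"]) (auto simp: mult.assoc)
qed

lemma second_derivative_symmetric_real:
  fixes F :: "'a::euclidean_space \<Rightarrow> real"
  assumes "open S" "smooth_on S F" "x \<in> S"
  shows "D (\<lambda>y. D F y v) x w = D (\<lambda>y. D F y w) x v"
proof -
  obtain r where r: "r > 0" "ball x r \<subseteq> S"
    using assms openE by blast
  have F: "smooth_on (ball x r) F" using smooth_on_subset assms r by blast
  have cont: "isCont (\<lambda>y. D (\<lambda>y. D F y v) y w) x" for v w
    using smooth_on_continuous[OF smooth_on_D[OF smooth_on_D[OF assms(2)]]] assms(1,3)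
    by (simp add: continuous_on_eq_continuous_at)
  \<comment> \<open>The summand 1 keeps \<open>N\<close> positive when both directions
    vanish.\<close>
  define N where "N = norm v + norm w + 1"
  have N: "N > 0" "norm v + norm w \<le> N" "norm w + norm v \<le> N" unfolding N_def by (auto intro: add_nonneg_pos)
  \<comment> \<open>Two successors make the denominator at least 2, so \<open>h n * N < r\<close>
    holds strictly already for \<open>n = 0\<close>.\<close>
  define h where "h n = r / N / real (Suc (Suc n))" for n
  have h: "h n > 0" "h n * N < r" for n
  proof -
    show "h n > 0" using r N by (simp add: h_def)
    have "h n * N = r / real (Suc (Suc n))" using N by (simp add: h_def)
    also have "\<dots> < r / 1" using r by (intro divide_strict_left_mono) auto
    finally show "h n * N < r" by simp
  qed
  have hlim: "(\<lambda>n. h n * N) \<longlonglongrightarrow> 0"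
  proof -
    have "(\<lambda>n. (r / N * N) * (1 / real (Suc (Suc n)))) \<longlonglongrightarrow> (r / N * N) * 0"
      by (intro tendsto_mult tendsto_const LIMSEQ_Suc[OF LIMSEQ_Suc[OF lim_1_over_n]])
    then show ?thesis using N by (simp add: h_def)
  qed
  have "\<exists>p q. dist x p \<le> h n * N \<and> dist x q \<le> h n * N \<and> D (\<lambda>y. D F y v) p w = D (\<lambda>y. D F y w) q v" for n
  proof -
    have le: "h n * (norm v + norm w) \<le> h n * N" "h n * (norm w + norm v) \<le> h n * N"
      using h(1)[of n] N by auto
    obtain p where p: "dist x p \<le> h n * (norm v + norm w)"
      "F (x + h n *\<^sub>R v + h n *\<^sub>R w) - F (x + h n *\<^sub>R v) - F (x + h n *\<^sub>R w) + F x = h n * h n * D (\<lambda>y. D F y v) p w"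
      using second_difference[OF F h(1)[of n], of v w] le h(2)[of n] by auto
    obtain q where q: "dist x q \<le> h n * (norm w + norm v)"
      "F (x + h n *\<^sub>R w + h n *\<^sub>R v) - F (x + h n *\<^sub>R w) - F (x + h n *\<^sub>R v) + F x = h n * h n * D (\<lambda>y. D F y w) q v"
      using second_difference[OF F h(1)[of n], of w v] le h(2)[of n] by auto
    have "h n * h n * D (\<lambda>y. D F y v) p w = h n * h n * D (\<lambda>y. D F y w) q v"
      using p(2) q(2) by (simp add: algebra_simps)
    then have "D (\<lambda>y. D F y v) p w = D (\<lambda>y. D F y w) q v"
      using h(1)[of n] by simp
    then show ?thesis using order_trans[OF p(1) le(1)] order_trans[OF q(1) le(2)] by blast
  qed
  then obtain p q where pq: "\<And>n. dist x (p n) \<le> h n * N" "\<And>n. dist x (q n) \<le> h n * N"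
    "\<And>n. D (\<lambda>y. D F y v) (p n) w = D (\<lambda>y. D F y w) (q n) v"
    by metis
  have "p \<longlonglongrightarrow> x" "q \<longlonglongrightarrow> x"
    using pq(1,2) tendsto_dist_iff[of _ x] by (auto intro!: tendsto_sandwich[OF _ _ tendsto_const hlim] simp: tendsto_dist_iff[of _ x] dist_commute)
  then have "(\<lambda>n. D (\<lambda>y. D F y v) (p n) w) \<longlonglongrightarrow> D (\<lambda>y. D F y v) x w"
    "(\<lambda>n. D (\<lambda>y. D F y w) (q n) v) \<longlonglongrightarrow> D (\<lambda>y. D F y w) x v"
    using isCont_tendsto_compose[OF cont] by blast+
  with pq(3) show ?thesis using LIMSEQ_unique by fastforce
qed

lemma second_derivative_symmetric:
  fixes f :: "'a::euclidean_space \<Rightarrow> 'b::euclidean_space"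
  assumes "open S" "smooth_on S f" "x \<in> S"
  shows "D (\<lambda>y. D f y v) x w = D (\<lambda>y. D f y w) x v"
proof (rule euclidean_eqI)
  fix b :: 'b
  have *: "smooth_on S g \<Longrightarrow> y \<in> S \<Longrightarrow> D (\<lambda>y. g y \<bullet> b) y u = D g y u \<bullet> b" for g :: "'a \<Rightarrow> 'b" and y u
    using D_eqI[OF has_derivative_inner_left[OF smooth_on_has_derivative]] by metis
  have sm: "smooth_on S (\<lambda>y. f y \<bullet> b)"
    by (rule smooth_on_bilinear[OF bounded_bilinear_inner assms(1,2) smooth_on_const])
  have "D (\<lambda>y. D f y v) x w \<bullet> b = D (\<lambda>y. D (\<lambda>y. f y \<bullet> b) y v) x w" for v w
  proof -
    have d: "(\<lambda>y. D f y v \<bullet> b) differentiable at x"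
      using smooth_on_differentiable[OF smooth_on_D[OF assms(2)] assms(3)] by simp
    have "D (\<lambda>y. D (\<lambda>y. f y \<bullet> b) y v) x = D (\<lambda>y. D f y v \<bullet> b) x"
      by (rule D_cong_open(2)[OF assms(1,3) _ d]) (simp add: *[OF assms(2)])
    then show ?thesis by (simp add: *[OF smooth_on_D[OF assms(2)] assms(3)])
  qed
  with second_derivative_symmetric_real[OF assms(1) sm assms(3)]
  show "D (\<lambda>y. D f y v) x w \<bullet> b = D (\<lambda>y. D f y w) x v \<bullet> b" by simp
qed

text \<open>The direction of the outer derivative comes first: \<open>DD f z w v\<close>
  differentiates \<open>f' v\<close> along \<open>w\<close>. In most uses \<open>w\<close> lies in
  \<open>ker f'\<close> and \<open>v\<close> in \<open>ker g'\<close>.\<close>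

abbreviation DD :: "('e::euclidean_space \<Rightarrow> 'f::euclidean_space) \<Rightarrow> 'e \<Rightarrow> 'e \<Rightarrow> 'e \<Rightarrow> 'f" where
  "DD f z w v \<equiv> D (\<lambda>y. D f y v) z w"

subsection \<open>Complex structures on a real vector space\<close>

definition complex_scale :: "('a::real_vector \<Rightarrow> 'a) \<Rightarrow> complex \<Rightarrow> 'a \<Rightarrow> 'a" where
  "complex_scale I s v = Re s *\<^sub>R v + Im s *\<^sub>R I v"

lemma complex_scale_mult:
  assumes "linear I" "\<And>v. I (I v) = - v"
  shows "complex_scale I s (complex_scale I t v) = complex_scale I (s * t) v"
  by (simp add: complex_scale_def linear_add[OF assms(1)] linear_cmul[OF assms(1)] assms(2)
      scaleR_add_right scaleR_add_left scaleR_diff_left algebra_simps)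

lemma complex_scale_simps [simp]:
  "complex_scale I 0 v = 0" "complex_scale I 1 v = v" "complex_scale I \<i> v = I v"
  by (simp_all add: complex_scale_def)

lemma complex_scale_apply:
  fixes \<alpha> :: "'a::real_vector \<Rightarrow> complex"
  assumes "linear \<alpha>" "\<And>v. \<alpha> (I v) = \<i> * \<alpha> v"
  shows "\<alpha> (complex_scale I s v) = s * \<alpha> v"
  by (simp add: complex_scale_def linear_add[OF assms(1)] linear_cmul[OF assms(1)] assms(2) complex_eq_iff)

text \<open>A complex line has real dimension at most 2, so some \<open>u2\<close> lies outside the
  line of \<open>u\<close>. A relation between \<open>u\<close> and \<open>u2\<close> could be
  divided by a nonzero complex coefficient; hence the two form a complex basis, and
  \<open>\<alpha>\<close>, \<open>\<beta>\<close> are its coordinates.\<close>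

lemma complex_coordinates:
  fixes I :: "real^4 \<Rightarrow> real^4"
  assumes I: "linear I" "\<And>v. I (I v) = - v" and "u \<noteq> 0"
  obtains \<alpha> \<beta> :: "real^4 \<Rightarrow> complex" where "linear \<alpha>" "linear \<beta>"
    "\<And>v. \<alpha> (I v) = \<i> * \<alpha> v" "\<And>v. \<beta> (I v) = \<i> * \<beta> v" "\<alpha> u = 1" "\<beta> u = 0"
    "\<And>v. \<alpha> v = 0 \<Longrightarrow> \<beta> v = 0 \<Longrightarrow> v = 0"
proof -
  have lin: "linear (\<lambda>s. complex_scale I s v)" for v
    by (rule linearI) (simp_all add: complex_scale_def algebra_simps)
  have "dim (range (\<lambda>s. complex_scale I s u)) \<le> 2"
    using dim_image_le[OF lin, of u UNIV] by simp
  then have "range (\<lambda>s. complex_scale I s u) \<noteq> UNIV" by auto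
  then obtain u2 where u2: "\<And>s. u2 \<noteq> complex_scale I s u" by blast
  define P where "P = (\<lambda>p. complex_scale I (fst p) u + complex_scale I (snd p) u2)"
  have linP: "linear P" unfolding P_def
    by (rule linearI) (simp_all add: complex_scale_def algebra_simps)
  have "inj P" unfolding linear_injective_0[OF linP]
  proof (intro allI impI)
    fix p assume "P p = 0"
    obtain s t where p: "p = (s, t)" by force
    have 0: "complex_scale I s u + complex_scale I t u2 = 0" using \<open>P p = 0\<close> by (simp add: P_def p)
    have "t = 0"
    proof (rule ccontr)
      assume "t \<noteq> 0"
      have "complex_scale I t u2 = complex_scale I (- s) u"
        using 0 by (simp add: complex_scale_def eq_neg_iff_add_eq_0 algebra_simps)
      then have "complex_scale I (1 / t) (complex_scale I t u2) = complex_scale I (1 / t) (complex_scale I (- s) u)" by simp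
      then show False using \<open>t \<noteq> 0\<close> u2 by (simp add: complex_scale_mult[OF I])
    qed
    moreover have "s = 0"
    proof (rule ccontr)
      assume "s \<noteq> 0"
      have "complex_scale I (1 / s) (complex_scale I s u) = complex_scale I (1 / s) 0"
        using 0 \<open>t = 0\<close> by simp
      then show False using \<open>s \<noteq> 0\<close> \<open>u \<noteq> 0\<close> linear_0[OF I(1)]
        by (simp add: complex_scale_mult[OF I]) (simp add: complex_scale_def)
    qed
    ultimately show "p = 0" by (simp add: p zero_prod_def)
  qed
  then have bij: "bij P" by (intro linear_inj_imp_bij linP) simp_all
  define Q where "Q = inv P"
  have linQ: "linear Q" unfolding Q_def by (rule linear_inv_bij[OF linP bij])
  have QP: "Q (P p) = p" for p using bij by (simp add: Q_def bij_is_inj)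
  have PQ: "P (Q v) = v" for v using bij by (simp add: Q_def bij_is_surj surj_f_inv_f)
  have QI: "Q (I v) = (\<i> * fst (Q v), \<i> * snd (Q v))" for v
  proof -
    have "P (\<i> * fst (Q v), \<i> * snd (Q v)) = I (P (Q v))"
      by (simp add: P_def complex_scale_mult[OF I, symmetric] linear_add[OF I(1)])
    then show ?thesis by (metis PQ QP)
  qed
  have Qu: "Q u = (1, 0)" using QP[of "(1, 0)"] by (simp add: P_def)
  show thesis
  proof (rule that[of "\<lambda>v. fst (Q v)" "\<lambda>v. snd (Q v)"])
    show "linear (\<lambda>v. fst (Q v))" "linear (\<lambda>v. snd (Q v))"
      using linear_compose[OF linQ linear_fst] linear_compose[OF linQ linear_snd] by (simp_all add: o_def)
    show "v = 0" if "fst (Q v) = 0" "snd (Q v) = 0" for v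
      using that PQ[of v] linear_0[OF linP] by (metis prod.collapse zero_prod_def)
  qed (simp_all add: QI Qu)
qed

subsection \<open>Double fibrations\<close>

text \<open>The double fibration read in charts. That the tangent planes are complex lines is
  expressed by invariance: \<open>J_inv\<close> says that the plane \<open>f' (ker g')\<close> is
  preserved by \<open>J\<close>, with no choice of basis or orientation. The conditions are
  symmetric under exchanging \<open>f\<close>, \<open>J\<close> with \<open>g\<close>,
  \<open>J'\<close>, so each result about \<open>X\<close> also holds for \<open>Y\<close>.\<close>

locale double_prefibration =
  fixes S :: "(real^6) set" and f g :: "real^6 \<Rightarrow> real^4" and J J' :: "real^4 \<Rightarrow> real^4 \<Rightarrow> real^4"
  assumes open_S: "open S"
    and smooth_f: "smooth_on S f" and smooth_g: "smooth_on S g"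
    and surj_f: "z \<in> S \<Longrightarrow> surj (D f z)" and surj_g: "z \<in> S \<Longrightarrow> surj (D g z)"
    and ker_inter: "z \<in> S \<Longrightarrow> D f z w = 0 \<Longrightarrow> D g z w = 0 \<Longrightarrow> w = 0"
    and J_linear: "z \<in> S \<Longrightarrow> linear (J (f z))" and J_sq: "z \<in> S \<Longrightarrow> J (f z) (J (f z) x) = - x"
    and J_diff: "z \<in> S \<Longrightarrow> (\<lambda>p. J p x) differentiable at (f z)"
    and J_inv: "z \<in> S \<Longrightarrow> D g z v = 0 \<Longrightarrow> \<exists>v'. D g z v' = 0 \<and> D f z v' = J (f z) (D f z v)"
    and J'_linear: "z \<in> S \<Longrightarrow> linear (J' (g z))" and J'_sq: "z \<in> S \<Longrightarrow> J' (g z) (J' (g z) x) = - x"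
    and J'_diff: "z \<in> S \<Longrightarrow> (\<lambda>p. J' p x) differentiable at (g z)"
    and J'_inv: "z \<in> S \<Longrightarrow> D f z w = 0 \<Longrightarrow> \<exists>w'. D f z w' = 0 \<and> D g z w' = J' (g z) (D g z w)"
begin

lemma linear_Df: "z \<in> S \<Longrightarrow> linear (D f z)" and linear_Dg: "z \<in> S \<Longrightarrow> linear (D g z)"
  using D_linear smooth_on_differentiable smooth_f smooth_g by blast+

lemma DD_sym:
  assumes "z \<in> S" shows "DD f z w v = DD f z v w" "DD g z w v = DD g z v w"
  using second_derivative_symmetric[OF open_S smooth_f assms] second_derivative_symmetric[OF open_S smooth_g assms]
  by auto

text \<open>Linearity in the inner direction, seen by exchanging the two directions: as the outer
  one it is the linearity of a derivative.\<close>

lemma linear_DDf: "z \<in> S \<Longrightarrow> linear (DD f z w)" and linear_DDg: "z \<in> S \<Longrightarrow> linear (DD g z w)"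
proof -
  assume z: "z \<in> S"
  have "linear (D (\<lambda>y. D f y w) z)" "linear (D (\<lambda>y. D g y w) z)"
    by (auto intro!: D_linear smooth_on_differentiable[OF smooth_on_D _] smooth_f smooth_g z)
  then show "linear (DD f z w)" "linear (DD g z w)"
    by (simp_all add: DD_sym(1)[OF z, of w, abs_def] DD_sym(2)[OF z, of w, abs_def])
qed

lemma ker_g_nontrivial:
  assumes "z \<in> S" obtains v where "D g z v = 0" "v \<noteq> 0"
proof -
  have "\<not> inj (D g z)"
  proof
    assume "inj (D g z)"
    then have "dim (range (D g z)) = DIM(real^6)"
      using dim_image_eq[OF linear_Dg[OF assms], of UNIV] by simp
    moreover have "dim (range (D g z)) \<le> DIM(real^4)" by (rule dim_subset_UNIV)
    ultimately show False by simp
  qed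
  then show thesis using that linear_injective_0[OF linear_Dg[OF assms]] by blast
qed

(* alpha o f' is a complex coordinate on the real plane ker g', so that (g', alpha o f') is an isomorphism. *)
lemma frame_inj:
  fixes \<alpha> :: "real^4 \<Rightarrow> complex"
  assumes z: "z \<in> S" and "linear \<alpha>" "\<And>x. \<alpha> (J (f z) x) = \<i> * \<alpha> x"
    and v: "D g z v = 0" "\<alpha> (D f z v) \<noteq> 0"
  shows "inj (\<lambda>u. (D g z u, \<alpha> (D f z u)))"
proof (rule linear_surjective_imp_injective)
  note lin = linear_Dg[OF z] linear_Df[OF z] assms(2)
  show "linear (\<lambda>u. (D g z u, \<alpha> (D f z u)))"
    by (rule linearI) (simp_all add: lin linear_add linear_cmul)
  obtain v' where v': "D g z v' = 0" "D f z v' = J (f z) (D f z v)" using J_inv[OF z v(1)] by blast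
  have ex: "\<exists>u. (D g z u, \<alpha> (D f z u)) = (y, c)" for y c
  proof -
    obtain r where r: "D g z r = y" using surj_g[OF z] by (metis surjD)
    define d where "d = (c - \<alpha> (D f z r)) / \<alpha> (D f z v)"
    let ?u = "r + Re d *\<^sub>R v + Im d *\<^sub>R v'"
    have "D g z ?u = y" by (simp add: lin linear_add linear_cmul v v' r)
    moreover have "\<alpha> (D f z ?u) = \<alpha> (D f z r) + \<alpha> (complex_scale (J (f z)) d (D f z v))"
      by (simp add: lin linear_add linear_cmul v' complex_scale_def)
    moreover have "\<dots> = c"
      using v(2) by (simp add: complex_scale_apply[OF assms(2,3)] d_def)
    ultimately show ?thesis by auto
  qed
  show "surj (\<lambda>u. (D g z u, \<alpha> (D f z u)))"
    unfolding surj_def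
  proof
    fix p :: "(real^4) \<times> complex"
    show "\<exists>u. p = (D g z u, \<alpha> (D f z u))" using ex[of "fst p" "snd p"] by (metis prod.collapse)
  qed
  show "dim (UNIV :: ((real^4) \<times> complex) set) = dim (UNIV :: (real^6) set)" by simp
qed

text \<open>The map \<open>\<alpha> \<circ> D f y\<close> is a coordinate on \<open>ker g'\<close>
  for all \<open>y\<close> near \<open>z\<close>, this being an open condition; \<open>V y\<close>
  is its inverse, a smooth trivialization of the kernels. The coordinates \<open>\<alpha>\<close>,
  \<open>\<beta>\<close> are adapted to \<open>J\<close> at \<open>f z\<close>, so at other base
  points they and \<open>V y\<close> are in general only real linear.\<close>

lemma frame:
  assumes z: "z \<in> S" and v: "D g z v = 0" "v \<noteq> 0"
  obtains \<alpha> \<beta> :: "real^4 \<Rightarrow> complex" and T V where "linear \<alpha>" "linear \<beta>"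
    "\<And>x. \<alpha> (J (f z) x) = \<i> * \<alpha> x" "\<And>x. \<beta> (J (f z) x) = \<i> * \<beta> x"
    "\<And>x. \<alpha> x = 0 \<Longrightarrow> \<beta> x = 0 \<Longrightarrow> x = 0" "\<alpha> (D f z v) = 1" "\<beta> (D f z v) = 0"
    "open T" "z \<in> T" "T \<subseteq> S" "\<And>c. smooth_on T (\<lambda>y. V y c)" "\<And>y. y \<in> T \<Longrightarrow> linear (V y)"
    "\<And>y c. y \<in> T \<Longrightarrow> D g y (V y c) = 0" "\<And>y c. y \<in> T \<Longrightarrow> \<alpha> (D f y (V y c)) = c"
    "\<And>y u. y \<in> T \<Longrightarrow> D g y u = 0 \<Longrightarrow> V y (\<alpha> (D f y u)) = u"
proof -
  have "D f z v \<noteq> 0" using ker_inter[OF z _ v(1)] v(2) by blast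
  then obtain \<alpha> \<beta> where ab: "linear \<alpha>" "linear \<beta>"
    "\<And>x. \<alpha> (J (f z) x) = \<i> * \<alpha> x" "\<And>x. \<beta> (J (f z) x) = \<i> * \<beta> x"
    "\<alpha> (D f z v) = 1" "\<beta> (D f z v) = 0" "\<And>x. \<alpha> x = 0 \<Longrightarrow> \<beta> x = 0 \<Longrightarrow> x = 0"
    by (rule complex_coordinates[OF J_linear[OF z] J_sq[OF z]]) blast
  define A where "A = (\<lambda>y u. (D g y u, \<alpha> (D f y u)))"
  have linA: "linear (A y)" if "y \<in> S" for y unfolding A_def
    by (rule linearI) (simp_all add: linear_Dg linear_Df ab that linear_add linear_cmul)
  have smA: "smooth_on S (\<lambda>y. A y u)" for u unfolding A_def
    by (intro smooth_on_Pair smooth_on_linear_compose[where L = \<alpha>] open_S ab smooth_on_D smooth_f smooth_g)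
  have "inj (A z)" unfolding A_def by (rule frame_inj[OF z ab(1,3) v(1)]) (simp add: ab)
  from inj_linear_nbhd[OF open_S z linA smooth_on_continuous[OF smA] this]
  obtain T where T: "open T" "z \<in> T" "T \<subseteq> S" "\<And>y. y \<in> T \<Longrightarrow> inj (A y)" by blast
  have bij: "bij (A y)" if "y \<in> T" for y
    by (rule linear_inj_imp_bij) (use that T linA in auto)
  define V where "V y c = inv (A y) (0, c)" for y c
  have AV: "A y (V y c) = (0, c)" if "y \<in> T" for y c
    using bij[OF that] by (simp add: V_def bij_is_surj surj_f_inv_f)
  have linV: "linear (V y)" if "y \<in> T" for y
  proof -
    have "linear (inv (A y))" using linear_inv_bij[OF linA bij[OF that]] T that by blast
    moreover have "linear (\<lambda>c::complex. (0::real^4, c))" by (rule linearI) auto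
    ultimately show ?thesis unfolding V_def using linear_compose[of "\<lambda>c. (0, c)" "inv (A y)"] by (simp add: o_def)
  qed
  have smV: "smooth_on T (\<lambda>y. V y c)" for c
    unfolding V_def
    by (rule inverse_family_smooth[OF _ T(1)]) (use T linA smooth_on_subset[OF smA T(3)] in auto)
  show thesis
  proof (rule that[OF ab(1-4) ab(7) ab(5,6) T(1-3) smV linV])
    fix y c assume y: "y \<in> T"
    show "D g y (V y c) = 0" "\<alpha> (D f y (V y c)) = c" using AV[OF y, of c] by (auto simp: A_def)
    fix u assume "D g y u = 0"
    then have "A y (V y (\<alpha> (D f y u))) = A y u" by (simp add: AV[OF y]) (simp add: A_def)
    then show "V y (\<alpha> (D f y u)) = u" using T(4)[OF y] by (meson injD)
  qed auto
qed

subsection \<open>The bracket of the two kernels\<close>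

text \<open>Since \<open>f'\<close> is onto, it identifies \<open>TZ / (ker f' + ker g')\<close>
  with \<open>TX / f' (ker g')\<close>. The latter is a complex line for \<open>J\<close>, and
  \<open>\<gamma>\<close> is a complex coordinate on it, determined up to a nonzero complex
  factor.\<close>

definition quotient_functional :: "real^6 \<Rightarrow> (real^4 \<Rightarrow> complex) \<Rightarrow> bool" where
  "quotient_functional z \<gamma> \<longleftrightarrow> linear \<gamma> \<and> (\<forall>x. \<gamma> (J (f z) x) = \<i> * \<gamma> x) \<and>
     (\<forall>x. \<gamma> x = 0 \<longleftrightarrow> (\<exists>v. D g z v = 0 \<and> D f z v = x))"

(* The Lie bracket of fields extending w in ker f' and v in ker g', pushed to the quotient by
   f' (ker g'). *)
definition bracket :: "real^6 \<Rightarrow> (real^4 \<Rightarrow> complex) \<Rightarrow> real^6 \<Rightarrow> real^6 \<Rightarrow> complex" where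
  "bracket z \<gamma> w v = \<gamma> (DD f z w v + D f z (SOME u. DD g z w v + D g z u = 0))"

text \<open>The second complex coordinate \<open>\<beta>\<close> of the frame serves. It vanishes
  exactly on the complex line of \<open>D f z v\<close>, and that line is \<open>f' (ker g')\<close>
  because \<open>v\<close> and its \<open>J\<close>-partner \<open>v'\<close> span
  \<open>ker g'\<close>.\<close>

lemma quotient_functional_exists:
  assumes z: "z \<in> S" obtains \<gamma> where "quotient_functional z \<gamma>"
proof -
  obtain v where v: "D g z v = 0" "v \<noteq> 0" using ker_g_nontrivial[OF z] .
  obtain \<alpha> \<beta> :: "real^4 \<Rightarrow> complex" where ab: "linear \<alpha>" "linear \<beta>"
    "\<And>x. \<alpha> (J (f z) x) = \<i> * \<alpha> x" "\<And>x. \<beta> (J (f z) x) = \<i> * \<beta> x"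
    "\<And>x. \<alpha> x = 0 \<Longrightarrow> \<beta> x = 0 \<Longrightarrow> x = 0" "\<alpha> (D f z v) = 1" "\<beta> (D f z v) = 0"
    by (rule frame[OF z v]) blast
  note lin = linear_Dg[OF z] linear_Df[OF z] ab(1,2)
  obtain v' where v': "D g z v' = 0" "D f z v' = J (f z) (D f z v)" using J_inv[OF z v(1)] by blast
  have inj: "inj (\<lambda>u. (D g z u, \<alpha> (D f z u)))" by (rule frame_inj[OF z ab(1,3) v(1)]) (simp add: ab)
  have comb: "D f z (Re c *\<^sub>R v + Im c *\<^sub>R v') = complex_scale (J (f z)) c (D f z v)"
    "D g z (Re c *\<^sub>R v + Im c *\<^sub>R v') = 0" for c
    by (simp_all add: lin linear_add linear_cmul v v' complex_scale_def)
  have "\<beta> x = 0 \<longleftrightarrow> (\<exists>u. D g z u = 0 \<and> D f z u = x)" for x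
  proof
    assume "\<beta> x = 0"
    let ?y = "x - complex_scale (J (f z)) (\<alpha> x) (D f z v)"
    have "\<alpha> ?y = 0" "\<beta> ?y = 0"
      using \<open>\<beta> x = 0\<close> by (simp_all add: linear_diff[OF ab(1)] linear_diff[OF ab(2)]
          complex_scale_apply[OF ab(1,3)] complex_scale_apply[OF ab(2,4)] ab)
    then have "x = complex_scale (J (f z)) (\<alpha> x) (D f z v)" using ab(5) by force
    then show "\<exists>u. D g z u = 0 \<and> D f z u = x" using comb by metis
  next
    assume "\<exists>u. D g z u = 0 \<and> D f z u = x"
    then obtain u where u: "D g z u = 0" "D f z u = x" by blast
    define c where "c = \<alpha> x"
    have "\<alpha> (D f z (Re c *\<^sub>R v + Im c *\<^sub>R v')) = c"
      by (simp add: comb complex_scale_apply[OF ab(1,3)] ab)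
    then have "u = Re c *\<^sub>R v + Im c *\<^sub>R v'"
      using injD[OF inj, of u "Re c *\<^sub>R v + Im c *\<^sub>R v'"] u by (simp add: comb c_def)
    then have "x = complex_scale (J (f z)) c (D f z v)" using u comb by blast
    then show "\<beta> x = 0" by (simp add: complex_scale_apply[OF ab(2,4)] ab)
  qed
  then have "quotient_functional z \<beta>" unfolding quotient_functional_def using ab by blast
  then show thesis using that by blast
qed

text \<open>Two admissible corrections \<open>u\<close> differ by an element of
  \<open>ker g'\<close>, whose image under \<open>f'\<close> is killed by \<open>\<gamma>\<close>;
  so the choice in the definition is immaterial.\<close>

lemma bracket_eq:
  assumes z: "z \<in> S" and \<gamma>: "quotient_functional z \<gamma>" and u: "DD g z w v + D g z u = 0"
  shows "bracket z \<gamma> w v = \<gamma> (DD f z w v + D f z u)"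
proof -
  note lin = linear_Dg[OF z] linear_Df[OF z]
  have lg: "linear \<gamma>" using \<gamma> by (simp add: quotient_functional_def)
  define u' where "u' = (SOME u. DD g z w v + D g z u = 0)"
  have "DD g z w v + D g z u' = 0" unfolding u'_def by (rule someI[of _ u]) (rule u)
  then have "D g z (u' - u) = 0" using u by (simp add: lin linear_diff add_eq_0_iff)
  then have "\<gamma> (D f z (u' - u)) = 0" using \<gamma> unfolding quotient_functional_def by blast
  then show ?thesis unfolding bracket_def u'_def[symmetric]
    by (simp add: linear_add[OF lg] linear_diff[OF lg] lin linear_diff)
qed

lemma bracket_linear:
  assumes z: "z \<in> S" and \<gamma>: "quotient_functional z \<gamma>"
  shows "bracket z \<gamma> w (a *\<^sub>R v + b *\<^sub>R v') = a *\<^sub>R bracket z \<gamma> w v + b *\<^sub>R bracket z \<gamma> w v'"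
proof -
  note lin = linear_Dg[OF z] linear_Df[OF z] linear_DDf[OF z] linear_DDg[OF z]
  have lg: "linear \<gamma>" using \<gamma> by (simp add: quotient_functional_def)
  obtain u u' where "- DD g z w v = D g z u" "- DD g z w v' = D g z u'"
    using surjD[OF surj_g[OF z], of "- DD g z w v"] surjD[OF surj_g[OF z], of "- DD g z w v'"] by blast
  then have u: "DD g z w v + D g z u = 0" "DD g z w v' + D g z u' = 0"
    by (metis add.right_inverse)+
  have "DD g z w (a *\<^sub>R v + b *\<^sub>R v') + D g z (a *\<^sub>R u + b *\<^sub>R u')
    = a *\<^sub>R (DD g z w v + D g z u) + b *\<^sub>R (DD g z w v' + D g z u')"
    by (simp add: lin linear_add linear_cmul linear_add[OF linear_DDg[OF z]] linear_cmul[OF linear_DDg[OF z]] algebra_simps)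
  then have "DD g z w (a *\<^sub>R v + b *\<^sub>R v') + D g z (a *\<^sub>R u + b *\<^sub>R u') = 0" using u by simp
  from bracket_eq[OF z \<gamma> this] show ?thesis
    by (simp add: bracket_eq[OF z \<gamma> u(1)] bracket_eq[OF z \<gamma> u(2)] lin linear_add[OF lg] linear_cmul[OF lg]
        linear_add linear_cmul linear_add[OF linear_DDf[OF z]] linear_cmul[OF linear_DDf[OF z]] algebra_simps)
qed

text \<open>Differentiating \<open>D g y (V y) = 0\<close> shows that \<open>V' w\<close> is an
  admissible correction. The bracket is thus \<open>\<gamma>\<close> of the derivative of
  \<open>f' V\<close> along \<open>w\<close>, for every differentiable field \<open>V\<close> in
  \<open>ker g'\<close> with the given value at \<open>z\<close>.\<close>

lemma bracket_field:
  assumes z: "z \<in> S" and T: "open T" "z \<in> T" "T \<subseteq> S"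
    and V: "(V has_derivative V') (at z)" "\<And>y. y \<in> T \<Longrightarrow> D g y (V y) = 0"
  shows "((\<lambda>y. D f y (V y)) has_derivative (\<lambda>w. DD f z w (V z) + D f z (V' w))) (at z)"
    and "quotient_functional z \<gamma> \<Longrightarrow> bracket z \<gamma> w (V z) = \<gamma> (DD f z w (V z) + D f z (V' w))"
proof -
  have *: "((\<lambda>y. D h y (V y)) has_derivative (\<lambda>w. DD h z w (V z) + D h z (V' w))) (at z)"
    if "smooth_on S h" for h :: "real^6 \<Rightarrow> real^4"
    by (rule has_derivative_apply_linear[OF open_S z _ _ V(1)])
      (use that z in \<open>auto intro: D_linear smooth_on_differentiable smooth_on_D\<close>)
  show "((\<lambda>y. D f y (V y)) has_derivative (\<lambda>w. DD f z w (V z) + D f z (V' w))) (at z)"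
    by (rule *[OF smooth_f])
  assume \<gamma>: "quotient_functional z \<gamma>"
  have "((\<lambda>y. D g y (V y)) has_derivative (\<lambda>w. 0)) (at z)"
    by (rule has_derivative_transform_within_open[OF has_derivative_const[of 0] T(1,2)]) (simp add: V)
  from fun_cong[OF has_derivative_unique[OF *[OF smooth_g] this], of w]
  show "bracket z \<gamma> w (V z) = \<gamma> (DD f z w (V z) + D f z (V' w))"
    by (rule bracket_eq[OF z \<gamma>])
qed

(* Along ker f' the structure J (f z) is constant, so differentiating J f' v = f' v' there gives linearity. *)
lemma bracket_J:
  assumes z: "z \<in> S" and \<gamma>: "quotient_functional z \<gamma>" and w: "D f z w = 0"
    and v: "D g z v = 0" and v': "D g z v' = 0" "D f z v' = J (f z) (D f z v)"
  shows "bracket z \<gamma> w v' = \<i> * bracket z \<gamma> w v"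
proof (cases "v = 0")
  case True
  have lg: "linear \<gamma>" using \<gamma> by (simp add: quotient_functional_def)
  have "D f z v' = 0" using True v' linear_0[OF linear_Df[OF z]] linear_0[OF J_linear[OF z]] by simp
  then have "v' = 0" using ker_inter[OF z _ v'(1)] by blast
  moreover have "bracket z \<gamma> w 0 = 0" using bracket_linear[OF z \<gamma>, of w 0 0 0 0] by simp
  ultimately show ?thesis using True by simp
next
  case False
  obtain \<alpha> \<beta> :: "real^4 \<Rightarrow> complex" and T V where ab: "linear \<alpha>" "\<And>x. \<alpha> (J (f z) x) = \<i> * \<alpha> x"
    and T: "open T" "z \<in> T" "T \<subseteq> S" and V: "\<And>c. smooth_on T (\<lambda>y. V y c)" "\<And>y. y \<in> T \<Longrightarrow> linear (V y)"
    "\<And>y c. y \<in> T \<Longrightarrow> D g y (V y c) = 0" "\<And>y c. y \<in> T \<Longrightarrow> \<alpha> (D f y (V y c)) = c"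
    "\<And>y u. y \<in> T \<Longrightarrow> D g y u = 0 \<Longrightarrow> V y (\<alpha> (D f y u)) = u"
    by (rule frame[OF z v False]) blast
  define V1 where "V1 y = V y (\<alpha> (D f z v))" for y
  define c where "c y = \<alpha> (J (f y) (D f y (V1 y)))" for y
  \<comment> \<open>The field with \<open>f' V2 = J (f' V1)\<close>. \<open>J_inv\<close> yields
    such vectors pointwise; expressing them through the frame makes the field visibly
    differentiable.\<close>
  define V2 where "V2 y = V y (c y)" for y
  have V1: "D g y (V1 y) = 0" if "y \<in> T" for y using V(3)[OF that] by (simp add: V1_def)
  have V2: "D g y (V2 y) = 0" "D f y (V2 y) = J (f y) (D f y (V1 y))" if y: "y \<in> T" for y
  proof -
    show "D g y (V2 y) = 0" using V(3)[OF y] by (simp add: V2_def)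
    obtain u where u: "D g y u = 0" "D f y u = J (f y) (D f y (V1 y))"
      using J_inv[OF _ V1[OF y]] T(3) y by blast
    then have "V2 y = u" using V(5)[OF y u(1)] by (simp add: V2_def c_def)
    with u show "D f y (V2 y) = J (f y) (D f y (V1 y))" by simp
  qed
  have V1z: "V1 z = v" using V(5)[OF T(2) v] by (simp add: V1_def)
  have V2z: "V2 z = v'" using V(5)[OF T(2) v'(1)] v'(2) by (simp add: V2_def c_def V1z)
  obtain V1' where V1': "(V1 has_derivative V1') (at z)"
    using smooth_on_has_derivative[OF V(1) T(2)] unfolding V1_def by blast
  note F1 = bracket_field[OF z T V1' V1]
  have Jf: "(\<lambda>y. J (f y) x) differentiable at z" "D (\<lambda>y. J (f y) x) z w = 0" for x
  proof -
    have df: "f differentiable at z" using smooth_on_differentiable[OF smooth_f z] .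
    show "(\<lambda>y. J (f y) x) differentiable at z"
      using differentiable_chain_at[OF df J_diff[OF z, of x]] by (simp add: o_def)
    show "D (\<lambda>y. J (f y) x) z w = 0"
      using D_compose[OF df J_diff[OF z, of x]] w linear_0[OF D_linear[OF J_diff[OF z, of x]]] by simp
  qed
  have JF: "((\<lambda>y. J (f y) (D f y (V1 y))) has_derivative
      (\<lambda>w. D (\<lambda>y. J (f y) (D f z (V1 z))) z w + J (f z) (DD f z w (V1 z) + D f z (V1' w)))) (at z)"
    by (rule has_derivative_apply_linear[OF open_S z J_linear Jf(1) F1(1)])
  obtain c' where c': "(c has_derivative c') (at z)"
    using bounded_linear.has_derivative[OF _ JF, of \<alpha>] ab(1) unfolding c_def by (auto simp: linear_linear)
  obtain V2' where V2': "(V2 has_derivative V2') (at z)"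
    using has_derivative_apply_linear[OF T(1,2) V(2) smooth_on_differentiable[OF V(1) T(2)] c'] unfolding V2_def by blast
  note F2 = bracket_field[OF z T V2' V2(1)]
  have "((\<lambda>y. J (f y) (D f y (V1 y))) has_derivative (\<lambda>w. DD f z w (V2 z) + D f z (V2' w))) (at z)"
    by (rule has_derivative_transform_within_open[OF F2(1) T(1,2) V2(2)])
  from fun_cong[OF has_derivative_unique[OF this JF], of w]
  have eq: "DD f z w v' + D f z (V2' w) = J (f z) (DD f z w v + D f z (V1' w))"
    by (simp add: Jf(2) V1z V2z)
  show ?thesis
    using F1(2)[OF _ \<gamma>, of w] F2(2)[OF _ \<gamma>, of w] eq \<gamma> by (simp add: V1z V2z quotient_functional_def)
qed

lemma swap: "double_prefibration S g f J' J"
proof (rule double_prefibration.intro, goal_cases)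
  case (6 z w)
  then show ?case using ker_inter by blast
qed (fact open_S smooth_f smooth_g surj_f surj_g J_linear J_sq J_diff J_inv J'_linear J'_sq J'_diff J'_inv)+

section \<open>Exchange of the two fibrations\<close>

abbreviation "dual_quotient_functional \<equiv> double_prefibration.quotient_functional g f J'"
abbreviation "dual_bracket \<equiv> double_prefibration.bracket g f"

lemma ker_g_span:
  assumes z: "z \<in> S" and v: "D g z v = 0" "v \<noteq> 0" and v': "D g z v' = 0" "D f z v' = J (f z) (D f z v)"
    and x: "D g z x = 0"
  obtains c where "x = Re c *\<^sub>R v + Im c *\<^sub>R v'"
proof -
  obtain \<alpha> :: "real^4 \<Rightarrow> complex" where ab: "linear \<alpha>" "\<And>x. \<alpha> (J (f z) x) = \<i> * \<alpha> x" "\<alpha> (D f z v) = 1"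
    by (rule frame[OF z v]) blast
  note lin = linear_Dg[OF z] linear_Df[OF z] ab(1)
  define c where "c = \<alpha> (D f z x)"
  have inj: "inj (\<lambda>u. (D g z u, \<alpha> (D f z u)))" by (rule frame_inj[OF z ab(1,2) v(1)]) (simp add: ab)
  have "D g z (Re c *\<^sub>R v + Im c *\<^sub>R v') = 0" by (simp add: lin linear_add linear_cmul v v')
  moreover have "\<alpha> (D f z (Re c *\<^sub>R v + Im c *\<^sub>R v')) = \<alpha> (complex_scale (J (f z)) c (D f z v))"
    by (simp add: lin linear_add linear_cmul v' complex_scale_def)
  moreover have "\<dots> = c" by (simp add: complex_scale_apply[OF ab(1,2)] ab)
  ultimately have "x = Re c *\<^sub>R v + Im c *\<^sub>R v'"
    using injD[OF inj, of x "Re c *\<^sub>R v + Im c *\<^sub>R v'"] x by (simp add: c_def)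
  then show thesis using that by blast
qed

text \<open>With corrections \<open>u\<close> for \<open>g\<close> and \<open>u'\<close> for
  \<open>f\<close>, the vector \<open>r = u - u'\<close> represents the Lie bracket modulo
  \<open>ker f' + ker g'\<close>. Both models of the quotient see this one vector, through
  \<open>f'\<close> and through \<open>g'\<close>, and the opposite sign reflects the reversed order
  of the arguments.\<close>

lemma dual_bracket_eq:
  assumes z: "z \<in> S" and \<gamma>: "quotient_functional z \<gamma>" and \<gamma>': "dual_quotient_functional z \<gamma>'"
  obtains r where "bracket z \<gamma> w v = \<gamma> (D f z r)" "dual_bracket z \<gamma>' v w = - \<gamma>' (D g z r)"
proof -
  interpret dual: double_prefibration S g f J' J by (rule swap)
  have lg: "linear \<gamma>'" using \<gamma>' by (simp add: dual.quotient_functional_def)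
  obtain u u' where "- DD g z w v = D g z u" "- DD f z w v = D f z u'"
    using surjD[OF surj_g[OF z], of "- DD g z w v"] surjD[OF surj_f[OF z], of "- DD f z w v"] by blast
  then have u: "DD g z w v + D g z u = 0" "DD f z w v + D f z u' = 0" by (metis add.right_inverse)+
  then have "DD f z v w + D f z u' = 0" by (simp add: DD_sym(1)[OF z, of v w])
  from dual.bracket_eq[OF z \<gamma>' this]
  have "dual_bracket z \<gamma>' v w = \<gamma>' (DD g z w v + D g z u')" by (simp add: DD_sym(2)[OF z, of v w])
  moreover have "DD g z w v + D g z u' = - D g z (u - u')"
    using u(1) by (simp add: linear_diff[OF linear_Dg[OF z]] add_eq_0_iff)
  moreover have "DD f z w v + D f z u = D f z (u - u')"
    using u(2) by (simp add: linear_diff[OF linear_Df[OF z]] add_eq_0_iff)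
  ultimately show thesis
    using that[of "u - u'"] bracket_eq[OF z \<gamma> u(1)] by (simp add: linear_neg[OF lg])
qed

end

text \<open>The added condition says that the bracket of \<open>w\<close> with some \<open>v\<close>
  leaves the plane \<open>f' (ker g')\<close>. It is stated through plain vectors, without a chosen
  \<open>\<gamma>\<close>, and demands only one \<open>v\<close> for each \<open>w\<close>, which is
  what the immersivity of \<tau> delivers.\<close>

locale double_fibration = double_prefibration +
  assumes nondegenerate: "z \<in> S \<Longrightarrow> D f z w = 0 \<Longrightarrow> w \<noteq> 0 \<Longrightarrow>
    \<exists>v. D g z v = 0 \<and> (\<forall>u v'. DD g z w v + D g z u = 0 \<longrightarrow> D g z v' = 0 \<longrightarrow> DD f z w v + D f z u \<noteq> D f z v')"
begin

text \<open>By \<open>bracket_J\<close> the bracket is complex linear in its second argument, and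
  \<open>ker g'\<close> is spanned by \<open>v\<close> and its \<open>J\<close>-partner. If the
  bracket vanished at one nonzero \<open>v\<close> it would vanish on all of \<open>ker g'\<close>,
  against nondegeneracy.\<close>

lemma bracket_nonzero:
  assumes z: "z \<in> S" and \<gamma>: "quotient_functional z \<gamma>" and w: "D f z w = 0" "w \<noteq> 0" and v: "D g z v = 0" "v \<noteq> 0"
  shows "bracket z \<gamma> w v \<noteq> 0"
proof
  assume 0: "bracket z \<gamma> w v = 0"
  obtain v0 where v0: "D g z v0 = 0"
    "\<And>u v'. DD g z w v0 + D g z u = 0 \<Longrightarrow> D g z v' = 0 \<Longrightarrow> DD f z w v0 + D f z u \<noteq> D f z v'"
    using nondegenerate[OF z w] by blast
  obtain v' where v': "D g z v' = 0" "D f z v' = J (f z) (D f z v)" using J_inv[OF z v(1)] by blast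
  obtain c where "v0 = Re c *\<^sub>R v + Im c *\<^sub>R v'" using ker_g_span[OF z v v' v0(1)] by blast
  then have b0: "bracket z \<gamma> w v0 = 0"
    by (simp add: bracket_linear[OF z \<gamma>] bracket_J[OF z \<gamma> w(1) v(1) v'] 0)
  obtain u where "- DD g z w v0 = D g z u" using surjD[OF surj_g[OF z]] by blast
  then have u: "DD g z w v0 + D g z u = 0" by (metis add.right_inverse)
  have "\<gamma> (DD f z w v0 + D f z u) = 0" using bracket_eq[OF z \<gamma> u] b0 by simp
  then obtain v1 where "D g z v1 = 0" "D f z v1 = DD f z w v0 + D f z u"
    using \<gamma> unfolding quotient_functional_def by blast
  then show False using v0(2)[OF u] by metis
qed

text \<open>In the form of \<open>bracket_nonzero\<close>, for all nonzero pairs, nondegeneracy no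
  longer distinguishes the two kernels. Symmetry of second derivatives turns a solution of the dual
  equations into a vanishing bracket, with correction \<open>u - v'\<close>.\<close>

lemma dual_fibration: "double_fibration S g f J' J"
proof -
  interpret dual: double_prefibration S g f J' J by (rule swap)
  show ?thesis
  proof
    fix z v assume z: "z \<in> S" and v: "D g z v = 0" "v \<noteq> 0"
    obtain w where w: "D f z w = 0" "w \<noteq> 0" using dual.ker_g_nontrivial[OF z] .
    obtain \<gamma> where \<gamma>: "quotient_functional z \<gamma>" using quotient_functional_exists[OF z] .
    have lg: "linear \<gamma>" using \<gamma> by (simp add: quotient_functional_def)
    have "DD g z v w + D g z u \<noteq> D g z v'" if u: "DD f z v w + D f z u = 0" and v': "D f z v' = 0" for u v'
    proof
      assume "DD g z v w + D g z u = D g z v'"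
      then have "DD g z w v + D g z (u - v') = 0"
        by (simp add: DD_sym(2)[OF z, of w v] linear_diff[OF linear_Dg[OF z]] add_diff_eq)
      from bracket_eq[OF z \<gamma> this] have "bracket z \<gamma> w v = 0"
        using u v' linear_0[OF lg] by (simp add: DD_sym(1)[OF z, of w v] linear_diff[OF linear_Df[OF z]])
      then show False using bracket_nonzero[OF z \<gamma> w v] by simp
    qed
    with w(1) show "\<exists>w. D f z w = 0 \<and> (\<forall>u v'. DD f z v w + D f z u = 0 \<longrightarrow> D f z v' = 0 \<longrightarrow>
        DD g z v w + D g z u \<noteq> D g z v')" by blast
  qed
qed

(* The map M between the two models of TZ / (ker f' + ker g') carries the bracket to minus the dual one.
   As the bracket is complex linear in v and the dual one is so in w, M is linear or antilinear. *)
lemma complex_structures_agree: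
  assumes z: "z \<in> S" and \<gamma>: "quotient_functional z \<gamma>" and \<gamma>': "dual_quotient_functional z \<gamma>'"
  obtains s where "s = \<i> \<or> s = - \<i>"
    "\<And>w w' v. D f z w = 0 \<Longrightarrow> D f z w' = 0 \<Longrightarrow> D g z w' = J' (g z) (D g z w) \<Longrightarrow> D g z v = 0 \<Longrightarrow>
       bracket z \<gamma> w' v = s * bracket z \<gamma> w v"
    "\<And>r r'. \<gamma> (D f z r') = \<i> * \<gamma> (D f z r) \<Longrightarrow> \<gamma>' (D g z r') = s * \<gamma>' (D g z r)"
proof -
  interpret dual: double_prefibration S g f J' J by (rule swap)
  note \<gamma>D = \<gamma>[unfolded quotient_functional_def] \<gamma>'[unfolded dual.quotient_functional_def]
  have ker: "\<gamma> x = 0 \<longleftrightarrow> (\<exists>a. D g z a = 0 \<and> D f z a = x)" "\<gamma>' x = 0 \<longleftrightarrow> (\<exists>a. D f z a = 0 \<and> D g z a = x)" for x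
    using \<gamma>D by auto
  have lg: "linear \<gamma>" "linear \<gamma>'" using \<gamma>D by auto
  note lin = linear_Dg[OF z] linear_Df[OF z] lg
  obtain v where v: "D g z v = 0" "v \<noteq> 0" using ker_g_nontrivial[OF z] .
  obtain w where w: "D f z w = 0" "w \<noteq> 0" using dual.ker_g_nontrivial[OF z] .
  obtain v' where v': "D g z v' = 0" "D f z v' = J (f z) (D f z v)" using J_inv[OF z v(1)] by blast
  obtain w' where w': "D f z w' = 0" "D g z w' = J' (g z) (D g z w)" using J'_inv[OF z w(1)] by blast
  define p where "p = bracket z \<gamma> w v"
  define q where "q = bracket z \<gamma> w' v"
  have "p \<noteq> 0" unfolding p_def by (rule bracket_nonzero[OF z \<gamma> w v])
  obtain x where "\<gamma> x = p" unfolding p_def bracket_def by blast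
  then have "\<gamma> (complex_scale (J (f z)) (1 / p) x) = 1"
    using \<gamma>D \<open>p \<noteq> 0\<close> by (subst complex_scale_apply) auto
  then obtain r1 where r1: "\<gamma> (D f z r1) = 1" using surjD[OF surj_f[OF z]] by metis
  obtain r2 where "D f z r2 = J (f z) (D f z r1)" using surjD[OF surj_f[OF z]] by metis
  then have r2: "\<gamma> (D f z r2) = \<i>" using r1 \<gamma>D by simp
  \<comment> \<open>A real linear right inverse of \<open>\<gamma> \<circ> f'\<close>, built from
    preimages of 1 and \<i>.\<close>
  define R where "R c = Re c *\<^sub>R r1 + Im c *\<^sub>R r2" for c
  have \<gamma>R: "\<gamma> (D f z (R c)) = c" for c
    by (simp add: R_def lin linear_add linear_cmul r1 r2 complex_eq_iff)
  define M where "M c = \<gamma>' (D g z (R c))" for c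
  have linM: "linear M" unfolding M_def R_def
    by (rule linearI) (simp_all add: lin linear_add linear_cmul algebra_simps)
  \<comment> \<open>Independence of the representative: a vector killed by
    \<open>\<gamma> \<circ> f'\<close> lies in \<open>ker f' + ker g'\<close>, and
    \<open>\<gamma>' \<circ> g'\<close> kills that sum as well.\<close>
  have M: "\<gamma>' (D g z r) = M (\<gamma> (D f z r))" for r
  proof -
    let ?d = "r - R (\<gamma> (D f z r))"
    have "\<gamma> (D f z ?d) = 0" by (simp add: lin linear_diff \<gamma>R)
    then obtain a where a: "D g z a = 0" "D f z a = D f z ?d" unfolding ker by blast
    have "D f z (?d - a) = D f z ?d - D f z a" by (rule linear_diff[OF linear_Df[OF z]])
    then have "D f z (?d - a) = 0" by (simp only: a(2) diff_self)
    then have "\<gamma>' (D g z (?d - a)) = 0" unfolding ker by blast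
    then show ?thesis by (simp add: M_def lin linear_diff a)
  qed
  have M0: "c = 0" if "M c = 0" for c
  proof -
    have "\<gamma>' (D g z (R c)) = 0" using that by (simp add: M_def)
    then obtain b where b: "D f z b = 0" "D g z b = D g z (R c)" unfolding ker by blast
    then have "D g z (R c - b) = 0" by (simp add: linear_diff[OF linear_Dg[OF z]])
    then have "\<gamma> (D f z (R c - b)) = 0" unfolding ker by blast
    then show ?thesis using \<gamma>R[of c] by (simp add: lin linear_diff b linear_0)
  qed
  have Minj: "c = d" if "M c = M d" for c d using M0[of "c - d"] that by (simp add: linear_diff[OF linM])
  have db: "dual_bracket z \<gamma>' b a = - M (bracket z \<gamma> a b)" for a b
    using dual_bracket_eq[OF z \<gamma> \<gamma>', of a b] M by metis
  have MJ: "M (bracket z \<gamma> a' b) = \<i> * M (bracket z \<gamma> a b)"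
    if "D f z a = 0" "D f z a' = 0" "D g z a' = J' (g z) (D g z a)" "D g z b = 0" for a a' b
    using dual.bracket_J[OF z \<gamma>' that(4) that(1) that(2,3)] by (simp add: db)
  have Mq: "M q = \<i> * M p" "M (\<i> * q) = \<i> * M (\<i> * p)"
    using MJ[OF w(1) w' v(1)] MJ[OF w(1) w' v'(1)]
      bracket_J[OF z \<gamma> w(1) v(1) v'] bracket_J[OF z \<gamma> w'(1) v(1) v'] by (simp_all add: p_def q_def)
  \<comment> \<open>The factor by which \<open>J'\<close> on \<open>ker f'\<close> acts on the
    bracket in the model of \<open>\<gamma>\<close>. In the other model it acts as \<i>, so
    \<open>M\<close> intertwines the two; using this twice gives \<open>s * s = - 1\<close>.\<close>
  define s where "s = q / p"
  have Mmult: "M (c * d) = Re c *\<^sub>R M d + Im c *\<^sub>R M (\<i> * d)" for c d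
  proof -
    have "c * d = Re c *\<^sub>R d + Im c *\<^sub>R (\<i> * d)" by (simp add: complex_eq_iff)
    then show ?thesis by (simp add: linear_add[OF linM] linear_cmul[OF linM])
  qed
  have Ms: "M (s * c) = \<i> * M c" for c
  proof -
    have "M ((c / p) * q) = \<i> * M ((c / p) * p)"
      by (simp only: Mmult[of "c / p"] Mq) (simp only: distrib_left mult_scaleR_right)
    moreover have "(c / p) * q = s * c" "(c / p) * p = c" using \<open>p \<noteq> 0\<close> by (simp_all add: s_def)
    ultimately show ?thesis by simp
  qed
  have "M (s * s) = M (- 1)"
    using Ms[of s] Ms[of 1] by (simp add: linear_neg[OF linM] mult.assoc[symmetric])
  then have "s * s = - 1" by (rule Minj)
  then have "(s - \<i>) * (s + \<i>) = 0" by (simp add: algebra_simps)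
  then have s: "s = \<i> \<or> s = - \<i>" by (simp add: eq_neg_iff_add_eq_0)
  show thesis
  proof (rule that[OF s])
    fix a a' b assume "D f z a = 0" "D f z a' = 0" "D g z a' = J' (g z) (D g z a)" "D g z b = 0"
    note mj = MJ[OF this]
    show "bracket z \<gamma> a' b = s * bracket z \<gamma> a b"
      by (rule Minj) (simp only: mj Ms)
  next
    fix r r' assume "\<gamma> (D f z r') = \<i> * \<gamma> (D f z r)"
    then have *: "\<gamma>' (D g z r') = M (\<i> * \<gamma> (D f z r))" by (simp add: M)
    show "\<gamma>' (D g z r') = s * \<gamma>' (D g z r)"
    proof (cases "s = \<i>")
      case True
      then show ?thesis using * Ms[of "\<gamma> (D f z r)"] by (simp add: M)
    next
      case False
      then have "s = - \<i>" using s by blast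
      then have "M (- (\<i> * \<gamma> (D f z r))) = \<i> * M (\<gamma> (D f z r))" using Ms[of "\<gamma> (D f z r)"] by simp
      then have "M (\<i> * \<gamma> (D f z r)) = - (\<i> * M (\<gamma> (D f z r)))" by (simp add: linear_neg[OF linM] minus_equation_iff[of "M _"])
      then show ?thesis using * \<open>s = - \<i>\<close> by (simp add: M[of r])
    qed
  qed
qed

subsection \<open>Slopes\<close>

text \<open>Along a fiber of \<open>f\<close> the tangent space of \<open>X\<close> is fixed, and
  with it \<open>J\<close> and the coordinates \<open>\<alpha>\<close>, \<open>\<beta>\<close>.
  There the plane \<open>f' (ker g')\<close> moves as the complex line of slope \<open>k\<close>, so
  \<open>\<beta> - k \<alpha>\<close> is a quotient functional. The derivative of the slope measures
  how the line leaves itself, which is the bracket. Lines of distinct slopes meet only in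
  zero.\<close>

lemma slope:
  assumes z0: "z0 \<in> S"
  obtains T and k :: "real^6 \<Rightarrow> complex" where "open T" "z0 \<in> T" "T \<subseteq> S" "smooth_on T k"
    "\<And>y. y \<in> T \<Longrightarrow> f y = f z0 \<Longrightarrow> \<exists>\<gamma> v. quotient_functional y \<gamma> \<and> D g y v = 0 \<and> v \<noteq> 0 \<and>
       (\<forall>w. D f y w = 0 \<longrightarrow> D k y w = bracket y \<gamma> w v)"
    "\<And>y v v0. y \<in> T \<Longrightarrow> f y = f z0 \<Longrightarrow> k y \<noteq> k z0 \<Longrightarrow> D g y v = 0 \<Longrightarrow> D g z0 v0 = 0 \<Longrightarrow>
       D f y v = D f z0 v0 \<Longrightarrow> D f y v = 0"
proof -
  obtain v where v: "D g z0 v = 0" "v \<noteq> 0" using ker_g_nontrivial[OF z0] .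
  obtain \<alpha> \<beta> :: "real^4 \<Rightarrow> complex" and T V where ab: "linear \<alpha>" "linear \<beta>"
    "\<And>x. \<alpha> (J (f z0) x) = \<i> * \<alpha> x" "\<And>x. \<beta> (J (f z0) x) = \<i> * \<beta> x"
    "\<And>x. \<alpha> x = 0 \<Longrightarrow> \<beta> x = 0 \<Longrightarrow> x = 0"
    and T: "open T" "z0 \<in> T" "T \<subseteq> S" and V: "\<And>c. smooth_on T (\<lambda>y. V y c)" "\<And>y. y \<in> T \<Longrightarrow> linear (V y)"
    "\<And>y c. y \<in> T \<Longrightarrow> D g y (V y c) = 0" "\<And>y c. y \<in> T \<Longrightarrow> \<alpha> (D f y (V y c)) = c"
    "\<And>y u. y \<in> T \<Longrightarrow> D g y u = 0 \<Longrightarrow> V y (\<alpha> (D f y u)) = u"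
    by (rule frame[OF z0 v]) blast
  have bl: "bounded_linear \<alpha>" "bounded_linear \<beta>" using ab(1,2) by (simp_all add: linear_linear)
  define k where "k y = \<beta> (D f y (V y 1))" for y
  define \<gamma> where "\<gamma> y x = \<beta> x - k y * \<alpha> x" for y x
  have "smooth_on T (\<lambda>y. D f y (V y 1))"
    by (rule smooth_on_apply_linear[OF T(1) _ _ V(1)])
      (use T linear_Df smooth_on_D[OF smooth_on_subset[OF smooth_f T(3)]] in auto)
  then have smk: "smooth_on T k" unfolding k_def by (rule smooth_on_linear_compose[OF T(1) ab(2)])
  have qf: "quotient_functional y (\<gamma> y)" if y: "y \<in> T" "f y = f z0" for y
  proof -
    have yS: "y \<in> S" using y T by blast
    note lin = linear_Dg[OF yS] linear_Df[OF yS] ab(1,2)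
    let ?l = "D f y (V y 1)"
    obtain v' where v': "D g y v' = 0" "D f y v' = J (f y) ?l"
      using J_inv[OF yS V(3)[OF y(1)]] by blast
    define X where "X c = Re c *\<^sub>R V y 1 + Im c *\<^sub>R v'" for c
    have X: "D g y (X c) = 0" "D f y (X c) = complex_scale (J (f z0)) c ?l" for c
      unfolding X_def by (simp_all add: lin linear_add linear_cmul v' V(3)[OF y(1)] complex_scale_def y(2))
    have aX: "\<alpha> (D f y (X c)) = c" "\<beta> (D f y (X c)) = c * k y" for c
      unfolding X by (simp_all add: complex_scale_apply[OF ab(1,3)] complex_scale_apply[OF ab(2,4)] V(4)[OF y(1)] k_def)
    have "\<gamma> y x = 0 \<longleftrightarrow> (\<exists>u. D g y u = 0 \<and> D f y u = x)" for x
    proof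
      assume "\<gamma> y x = 0"
      then have "\<alpha> (x - D f y (X (\<alpha> x))) = 0" "\<beta> (x - D f y (X (\<alpha> x))) = 0"
        by (simp_all add: lin linear_diff aX \<gamma>_def)
      then have "x = D f y (X (\<alpha> x))" using ab(5) by force
      then show "\<exists>u. D g y u = 0 \<and> D f y u = x" using X(1) by metis
    next
      assume "\<exists>u. D g y u = 0 \<and> D f y u = x"
      then obtain u where u: "D g y u = 0" "D f y u = x" by blast
      have "X (\<alpha> x) = u" using V(5)[OF y(1) X(1), of "\<alpha> x"] V(5)[OF y(1) u(1)] by (simp add: aX u(2))
      then show "\<gamma> y x = 0" using aX(2)[of "\<alpha> x"] by (simp add: \<gamma>_def u(2))
    qed
    moreover have "linear (\<gamma> y)" unfolding \<gamma>_def
      by (rule linearI) (simp_all add: lin linear_add linear_cmul algebra_simps)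
    ultimately show ?thesis unfolding quotient_functional_def
      using ab(3,4) y(2) by (auto simp: \<gamma>_def algebra_simps)
  qed
  have "\<exists>\<gamma> v. quotient_functional y \<gamma> \<and> D g y v = 0 \<and> v \<noteq> 0 \<and> (\<forall>w. D f y w = 0 \<longrightarrow> D k y w = bracket y \<gamma> w v)"
    if y: "y \<in> T" "f y = f z0" for y
  proof (intro exI conjI allI impI)
    have yS: "y \<in> S" using y T by blast
    show q: "quotient_functional y (\<gamma> y)" by (rule qf[OF y])
    show "D g y (V y 1) = 0" by (rule V(3)[OF y(1)])
    show "V y 1 \<noteq> 0" using V(4)[OF y(1), of 1] linear_0[OF linear_Df[OF yS]] linear_0[OF ab(1)] by auto
    fix w assume "D f y w = 0"
    have V1: "((\<lambda>y. V y 1) has_derivative D (\<lambda>y. V y 1) y) (at y)"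
      by (rule smooth_on_has_derivative[OF V(1) y(1)])
    define F' where "F' w = DD f y w (V y 1) + D f y (D (\<lambda>y. V y 1) y w)" for w
    note F = bracket_field[OF yS T(1) y(1) T(3) V1 V(3), folded F'_def]
    have "((\<lambda>y. \<alpha> (D f y (V y 1))) has_derivative (\<lambda>w. \<alpha> (F' w))) (at y)"
      by (rule bounded_linear.has_derivative[OF _ F(1)]) (simp_all add: bl)
    note aF = this
    \<comment> \<open>The field is normalized to first coordinate 1, so \<open>\<alpha>\<close>
      kills its derivative, and on that derivative \<open>\<gamma> y\<close> agrees with
      \<open>\<beta>\<close>.\<close>
    have "((\<lambda>y. \<alpha> (D f y (V y 1))) has_derivative (\<lambda>w. 0)) (at y)"
      by (rule has_derivative_transform_within_open[OF has_derivative_const[of 1] T(1) y(1)]) (simp add: V(4))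
    from fun_cong[OF has_derivative_unique[OF aF this], of w] have "\<alpha> (F' w) = 0" .
    have "(k has_derivative (\<lambda>w. \<beta> (F' w))) (at y)" unfolding k_def
      by (rule bounded_linear.has_derivative[OF _ F(1)]) (simp_all add: bl)
    then have "D k y w = \<beta> (F' w)" by (simp add: D_eqI)
    then show "D k y w = bracket y (\<gamma> y) w (V y 1)"
      using F(2)[OF _ q, of w] \<open>\<alpha> (F' w) = 0\<close> by (simp add: \<gamma>_def)
  qed
  moreover have "D f y v = 0" if y: "y \<in> T" "f y = f z0" "k y \<noteq> k z0" "D g y v = 0" "D g z0 v0 = 0" "D f y v = D f z0 v0" for y v v0
  proof -
    have "\<gamma> y (D f y v) = 0" using qf[OF y(1,2)] y(4) unfolding quotient_functional_def by blast
    moreover have "\<gamma> z0 (D f y v) = 0"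
      using qf[OF T(2) refl] y(5,6) unfolding quotient_functional_def by metis
    ultimately have "(k y - k z0) * \<alpha> (D f y v) = 0" "\<beta> (D f y v) = k y * \<alpha> (D f y v)"
      by (simp_all add: \<gamma>_def algebra_simps)
    then show ?thesis using y(3) ab(5)[of "D f y v"] by simp
  qed
  ultimately show thesis using that[OF T smk] by blast
qed

text \<open>Nondegeneracy makes the slope a local coordinate on the fiber of \<open>f\<close>, so
  \<open>(f, k)\<close> is a local diffeomorphism. A nearby point of the same fiber whose slope
  differs by \<open>e / 2\<close> has a plane that meets the plane of \<open>z0\<close> only in
  zero.\<close>

lemma transversal_point:
  assumes z0: "z0 \<in> S"
  obtains z1 where "z1 \<in> S" "f z1 = f z0"
    "\<And>v v0. D g z1 v = 0 \<Longrightarrow> D g z0 v0 = 0 \<Longrightarrow> D f z1 v = D f z0 v0 \<Longrightarrow> D f z1 v = 0"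
proof -
  obtain T and k :: "real^6 \<Rightarrow> complex" where T: "open T" "z0 \<in> T" "T \<subseteq> S" and smk: "smooth_on T k"
    and k: "\<And>y. y \<in> T \<Longrightarrow> f y = f z0 \<Longrightarrow> \<exists>\<gamma> v. quotient_functional y \<gamma> \<and> D g y v = 0 \<and> v \<noteq> 0 \<and>
       (\<forall>w. D f y w = 0 \<longrightarrow> D k y w = bracket y \<gamma> w v)"
    "\<And>y v v0. y \<in> T \<Longrightarrow> f y = f z0 \<Longrightarrow> k y \<noteq> k z0 \<Longrightarrow> D g y v = 0 \<Longrightarrow> D g z0 v0 = 0 \<Longrightarrow>
       D f y v = D f z0 v0 \<Longrightarrow> D f y v = 0"
    using slope[OF z0] by metis
  define G where "G y = (f y, k y)" for y
  have smG: "smooth_on T G" unfolding G_def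
    by (intro smooth_on_Pair T smooth_on_subset[OF smooth_f T(3)] smk)
  obtain \<gamma> v where gv: "quotient_functional z0 \<gamma>" "D g z0 v = 0" "v \<noteq> 0"
    "\<And>w. D f z0 w = 0 \<Longrightarrow> D k z0 w = bracket z0 \<gamma> w v" using k(1)[OF T(2) refl] by blast
  have DG: "D G z0 w = (D f z0 w, D k z0 w)" for w unfolding G_def
    by (rule D_Pair) (use smooth_on_differentiable smooth_f smk z0 T(2) in blast)+
  have "w = 0" if "D G z0 w = 0" for w
    using that bracket_nonzero[OF z0 gv(1) _ _ gv(2,3), of w] gv(4)[of w] by (auto simp: DG zero_prod_def)
  then have "inj (D G z0)"
    using linear_injective_0[OF D_linear[OF smooth_on_differentiable[OF smG T(2)]]] by blast
  moreover have "DIM(real^6) = DIM((real^4) \<times> complex)" by simp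
  ultimately obtain U W H where U: "z0 \<in> U" "U \<subseteq> T" and W: "open W" "homeomorphism U W G H"
    using smooth_inverse_function[OF _ T(1) smG T(2)] by metis
  have "G z0 \<in> W" using homeomorphism_image1[OF W(2)] U(1) by blast
  then obtain e where e: "e > 0" "ball (G z0) e \<subseteq> W" using W(1) openE by blast
  define p where "p = (f z0, k z0 + complex_of_real (e / 2))"
  have "dist (G z0) p < e" using e(1) by (simp add: p_def G_def dist_Pair_Pair dist_norm norm_divide)
  then have pW: "p \<in> W" using e(2) by auto
  define z1 where "z1 = H p"
  have "z1 \<in> U" "G z1 = p" using homeomorphism_image2[OF W(2)] homeomorphism_apply2[OF W(2)] pW by (auto simp: z1_def)
  then have z1: "z1 \<in> T" "f z1 = f z0" "k z1 \<noteq> k z0" using U(2) e(1) by (auto simp: G_def p_def)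
  show thesis by (rule that[OF _ z1(2) k(2)[OF z1]]) (use z1 T(3) in auto)
qed

subsection \<open>Holomorphic functions from slopes\<close>

(* x near f z0 is joined to a fixed point p of the curve of z0; c x is the resulting point over p,
   a x the one over x, and h x = k (c x) is the slope at p of the joining curve. *)
lemma holomorphic_function_up_to_sign:
  assumes z0: "z0 \<in> S"
  obtains B and h :: "real^4 \<Rightarrow> complex" where "open B" "f z0 \<in> B" "B \<subseteq> f ` S" "smooth_on B h"
    "\<And>x. x \<in> B \<Longrightarrow> (\<forall>\<xi>. D h x (J x \<xi>) = \<i> * D h x \<xi>) \<or> (\<forall>\<xi>. D h x (J x \<xi>) = - \<i> * D h x \<xi>)"
    "\<And>\<xi>. D h (f z0) \<xi> = 0 \<longleftrightarrow> (\<exists>v. D g z0 v = 0 \<and> D f z0 v = \<xi>)"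
proof -
  interpret dual: double_fibration S g f J' J by (rule dual_fibration)
  \<comment> \<open>The transversal point of the dual fibration: it lies on the curve of
    \<open>z0\<close>, and the planes \<open>g' (ker f')\<close> at \<open>z0\<close> and at
    \<open>zp\<close> meet only in zero. The fixed point of the curve is
    \<open>f zp\<close>.\<close>
  obtain zp where zp: "zp \<in> S" "g zp = g z0"
    and trans: "\<And>v v0. D f zp v = 0 \<Longrightarrow> D f z0 v0 = 0 \<Longrightarrow> D g zp v = D g z0 v0 \<Longrightarrow> D g zp v = 0"
    using dual.transversal_point[OF z0] by metis
  obtain T and k :: "real^6 \<Rightarrow> complex" where T: "open T" "zp \<in> T" "T \<subseteq> S" and smk: "smooth_on T k"
    and k: "\<And>y. y \<in> T \<Longrightarrow> f y = f zp \<Longrightarrow> \<exists>\<gamma> v. quotient_functional y \<gamma> \<and> D g y v = 0 \<and> v \<noteq> 0 \<and>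
       (\<forall>w. D f y w = 0 \<longrightarrow> D k y w = bracket y \<gamma> w v)"
    by (rule slope[OF zp(1)]) blast
  define ST where "ST = S \<times> T"
  have ST: "open ST" unfolding ST_def by (intro open_Times open_S T)
  \<comment> \<open>A curve joining \<open>x\<close> to \<open>f zp\<close> corresponds to a
    solution of \<open>\<Phi> (a, c) = (x, f zp, 0)\<close>: twelve equations in twelve unknowns,
    whose derivative is invertible by transversality.\<close>
  define \<Phi> where "\<Phi> p = (f (fst p), f (snd p), g (fst p) - g (snd p))" for p
  have sm: "smooth_on ST (\<lambda>p. h (fst p))" "smooth_on ST (\<lambda>p. h (snd p))"
    if "smooth_on S h" for h :: "real^6 \<Rightarrow> real^4"
    using T(3) smooth_on_compose[OF ST open_S _ smooth_on_fst that] smooth_on_compose[OF ST open_S _ smooth_on_snd that]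
    by (force simp: ST_def)+
  have sm\<Phi>: "smooth_on ST \<Phi>" unfolding \<Phi>_def
    by (intro smooth_on_Pair smooth_on_diff ST sm smooth_f smooth_g)
  have D\<Phi>: "D \<Phi> (y, y') (w, w') = (D f y w, D f y' w', D g y w - D g y' w')" if y: "(y, y') \<in> ST" for y y' w w'
  proof -
    have yS: "y \<in> S" "y' \<in> S" using y T(3) by (auto simp: ST_def)
    have h: "((\<lambda>p. h (fst p)) has_derivative (\<lambda>w. D h y (fst w))) (at (y, y'))"
      "((\<lambda>p. h (snd p)) has_derivative (\<lambda>w. D h y' (snd w))) (at (y, y'))"
      if "smooth_on S h" for h :: "real^6 \<Rightarrow> real^4"
      using diff_chain_at[OF has_derivative_fst[OF has_derivative_ident[of "at (y, y')"]], of h "D h y"]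
        diff_chain_at[OF has_derivative_snd[OF has_derivative_ident[of "at (y, y')"]], of h "D h y'"]
        smooth_on_has_derivative[OF that yS(1)] smooth_on_has_derivative[OF that yS(2)] by (simp_all add: o_def)
    have "(\<Phi> has_derivative (\<lambda>w. (D f y (fst w), D f y' (snd w), D g y (fst w) - D g y' (snd w)))) (at (y, y'))"
      unfolding \<Phi>_def by (intro has_derivative_Pair has_derivative_diff h smooth_f smooth_g)
    from D_eqI[OF this] show ?thesis by simp
  qed
  let ?p0 = "(z0, zp)"
  have p0: "?p0 \<in> ST" using z0 T by (simp add: ST_def)
  have "q = 0" if "D \<Phi> ?p0 q = 0" for q
  proof -
    obtain w w' where q: "q = (w, w')" by force
    have 1: "D f z0 w = 0" "D f zp w' = 0" "D g z0 w = D g zp w'" using that D\<Phi>[OF p0] by (auto simp: q zero_prod_def)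
    then have "D g zp w' = 0" using trans by metis
    then show ?thesis using 1 ker_inter[OF z0] ker_inter[OF zp(1)] by (simp add: q zero_prod_def)
  qed
  then have "inj (D \<Phi> ?p0)"
    using linear_injective_0[OF D_linear[OF smooth_on_differentiable[OF sm\<Phi> p0]]] by blast
  moreover have "DIM((real^6) \<times> (real^6)) = DIM((real^4) \<times> (real^4) \<times> (real^4))" by simp
  ultimately obtain U W \<Psi> where U: "?p0 \<in> U" "U \<subseteq> ST" and W: "open W" "homeomorphism U W \<Phi> \<Psi>" "smooth_on W \<Psi>"
    and bij: "\<And>p. p \<in> U \<Longrightarrow> bij (D \<Phi> p)"
    using smooth_inverse_function[OF _ ST sm\<Phi> p0] by metis
  define e where "e x = (x, f zp, 0 :: real^4)" for x :: "real^4"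
  define B where "B = e -` W"
  have cont_e: "continuous_on UNIV e" unfolding e_def by (intro continuous_intros)
  have B: "open B" unfolding B_def by (rule open_vimage[OF W(1) cont_e])
  have sme: "smooth_on B e" unfolding e_def
    by (intro smooth_on_Pair B smooth_on_const smooth_on_linear[OF linear_id, unfolded id_def])
  define a where "a x = fst (\<Psi> (e x))" for x
  define c where "c x = snd (\<Psi> (e x))" for x
  have sm\<Psi>: "smooth_on B (\<lambda>x. \<Psi> (e x))"
    by (rule smooth_on_compose[OF B W(1) _ sme W(3)]) (auto simp: B_def)
  have sma: "smooth_on B a" unfolding a_def by (rule smooth_on_linear_compose[OF B linear_fst sm\<Psi>])
  have smc: "smooth_on B c" unfolding c_def by (rule smooth_on_linear_compose[OF B linear_snd sm\<Psi>])
  have acU: "(a x, c x) \<in> U" if "x \<in> B" for x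
    using that homeomorphism_image2[OF W(2)] by (auto simp: a_def c_def B_def)
  have ac: "f (a x) = x" "f (c x) = f zp" "g (a x) = g (c x)" "a x \<in> S" "c x \<in> T" "c x \<in> S" if "x \<in> B" for x
  proof -
    have "\<Phi> (a x, c x) = e x" using that homeomorphism_apply2[OF W(2)] by (auto simp: a_def c_def B_def)
    then show "f (a x) = x" "f (c x) = f zp" "g (a x) = g (c x)" by (auto simp: \<Phi>_def e_def)
    show "a x \<in> S" "c x \<in> T" "c x \<in> S" using acU[OF that] U(2) T(3) by (auto simp: ST_def)
  qed
  have "e (f z0) = \<Phi> ?p0" by (simp add: e_def \<Phi>_def zp(2))
  then have x0: "f z0 \<in> B" "a (f z0) = z0"
    using homeomorphism_image1[OF W(2)] homeomorphism_apply1[OF W(2) U(1)] U(1) by (auto simp: B_def a_def)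
  have a': "(a has_derivative D a x) (at x)" and c': "(c has_derivative D c x) (at x)" if "x \<in> B" for x
    using smooth_on_has_derivative[OF sma that] smooth_on_has_derivative[OF smc that] by auto
  have Dac: "D f (a x) (D a x \<xi>) = \<xi>" "D f (c x) (D c x \<xi>) = 0" "D g (a x) (D a x \<xi>) = D g (c x) (D c x \<xi>)"
    if x: "x \<in> B" for x \<xi>
  proof -
    have fa: "((\<lambda>x. f (a x)) has_derivative (\<lambda>\<xi>. D f (a x) (D a x \<xi>))) (at x)"
      and fc: "((\<lambda>x. f (c x)) has_derivative (\<lambda>\<xi>. D f (c x) (D c x \<xi>))) (at x)"
      and ga: "((\<lambda>x. g (a x)) has_derivative (\<lambda>\<xi>. D g (a x) (D a x \<xi>))) (at x)"
      and gc: "((\<lambda>x. g (c x)) has_derivative (\<lambda>\<xi>. D g (c x) (D c x \<xi>))) (at x)"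
      using diff_chain_at[OF a'[OF x] smooth_on_has_derivative[OF smooth_f ac(4)[OF x]]]
        diff_chain_at[OF c'[OF x] smooth_on_has_derivative[OF smooth_f ac(6)[OF x]]]
        diff_chain_at[OF a'[OF x] smooth_on_has_derivative[OF smooth_g ac(4)[OF x]]]
        diff_chain_at[OF c'[OF x] smooth_on_has_derivative[OF smooth_g ac(6)[OF x]]] by (simp_all add: o_def)
    have "((\<lambda>x. f (a x)) has_derivative (\<lambda>\<xi>. \<xi>)) (at x)"
      by (rule has_derivative_transform_within_open[OF has_derivative_ident B x]) (simp add: ac)
    from fun_cong[OF has_derivative_unique[OF fa this]] show "D f (a x) (D a x \<xi>) = \<xi>" .
    have "((\<lambda>x. f (c x)) has_derivative (\<lambda>\<xi>. 0)) (at x)"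
      by (rule has_derivative_transform_within_open[OF has_derivative_const[of "f zp"] B x]) (simp add: ac)
    from fun_cong[OF has_derivative_unique[OF fc this]] show "D f (c x) (D c x \<xi>) = 0" .
    have "((\<lambda>x. g (a x)) has_derivative (\<lambda>\<xi>. D g (c x) (D c x \<xi>))) (at x)"
      by (rule has_derivative_transform_within_open[OF gc B x]) (simp add: ac)
    from fun_cong[OF has_derivative_unique[OF ga this]]
    show "D g (a x) (D a x \<xi>) = D g (c x) (D c x \<xi>)" .
  qed
  \<comment> \<open>Invertibility of \<open>D \<Phi>\<close> on the whole of \<open>U\<close> keeps
    the planes \<open>g' (ker f')\<close> at \<open>a x\<close> and at \<open>c x\<close>
    transversal for every \<open>x\<close> in \<open>B\<close>.\<close>
  have transx: "w = 0 \<and> w' = 0" if x: "x \<in> B" and w: "D f (a x) w = 0" "D f (c x) w' = 0" "D g (a x) w = D g (c x) w'" for x w w'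
  proof -
    have st: "(a x, c x) \<in> ST" using acU[OF x] U(2) by blast
    have "D \<Phi> (a x, c x) (w, w') = 0" using w by (simp add: D\<Phi>[OF st] zero_prod_def)
    moreover have "D \<Phi> (a x, c x) 0 = 0"
      by (rule linear_0[OF D_linear[OF smooth_on_differentiable[OF sm\<Phi> st]]])
    ultimately have "(w, w') = 0" using bij_is_inj[OF bij[OF acU[OF x]]] by (metis injD)
    then show ?thesis by (simp add: zero_prod_def)
  qed
  define h where "h x = k (c x)" for x
  have smh: "smooth_on B h" unfolding h_def
    by (rule smooth_on_compose[OF B T(1) _ smc smk]) (use ac in auto)
  have Dh: "D h x \<xi> = D k (c x) (D c x \<xi>)" if x: "x \<in> B" for x \<xi>
    unfolding h_def by (rule D_compose[OF smooth_on_differentiable[OF smc x] smooth_on_differentiable[OF smk ac(5)[OF x]]])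
  have "(\<forall>\<xi>. D h x (J x \<xi>) = \<i> * D h x \<xi>) \<or> (\<forall>\<xi>. D h x (J x \<xi>) = - \<i> * D h x \<xi>)" if x: "x \<in> B" for x
  proof -
    note aS = ac(4)[OF x] and cS = ac(6)[OF x]
    obtain \<gamma> v where gv: "quotient_functional (c x) \<gamma>" "D g (c x) v = 0"
      and Dk: "\<And>w. D f (c x) w = 0 \<Longrightarrow> D k (c x) w = bracket (c x) \<gamma> w v"
      using k[OF ac(5,2)[OF x]] by blast
    obtain \<gamma>' where \<gamma>': "dual_quotient_functional (c x) \<gamma>'" using dual.quotient_functional_exists[OF cS] by blast
    obtain s where s: "s = \<i> \<or> s = - \<i>" "\<And>w w'. D f (c x) w = 0 \<Longrightarrow> D f (c x) w' = 0 \<Longrightarrow>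
        D g (c x) w' = J' (g (c x)) (D g (c x) w) \<Longrightarrow> bracket (c x) \<gamma> w' v = s * bracket (c x) \<gamma> w v"
      using complex_structures_agree[OF cS gv(1) \<gamma>'] gv(2) by metis
    obtain \<delta> where \<delta>: "quotient_functional (a x) \<delta>" using quotient_functional_exists[OF aS] by blast
    obtain \<delta>' where \<delta>': "dual_quotient_functional (a x) \<delta>'" using dual.quotient_functional_exists[OF aS] by blast
    obtain t where t: "t = \<i> \<or> t = - \<i>" "\<And>r r'. \<delta> (D f (a x) r') = \<i> * \<delta> (D f (a x) r) \<Longrightarrow>
        \<delta>' (D g (a x) r') = t * \<delta>' (D g (a x) r)"
      using complex_structures_agree[OF aS \<delta> \<delta>'] by metis
    \<comment> \<open>Two signs occur: \<open>\<epsilon>\<close> compares the structures at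
      \<open>a x\<close>, the end over \<open>x\<close>, and \<open>s\<close> at \<open>c x\<close>,
      the end over the fixed point.\<close>
    obtain \<epsilon> :: real where \<epsilon>: "t = \<epsilon> *\<^sub>R \<i>" "\<epsilon> = 1 \<or> \<epsilon> = - 1" using t(1) by (metis scaleR_minus1_left scaleR_one)
    have "D h x (J x \<xi>) = \<epsilon> *\<^sub>R (s * D h x \<xi>)" for \<xi>
    proof -
      define r where "r = D a x \<xi>"
      define r' where "r' = D a x (J x \<xi>)"
      define w where "w = D c x \<xi>"
      define w' where "w' = D c x (J x \<xi>)"
      have fr: "D f (a x) r = \<xi>" "D f (a x) r' = J (f (a x)) \<xi>" and fw: "D f (c x) w = 0" "D f (c x) w' = 0"
        and gr: "D g (a x) r = D g (c x) w" "D g (a x) r' = D g (c x) w'"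
        by (simp_all add: Dac[OF x] r_def r'_def w_def w'_def ac(1)[OF x])
      note \<delta>D = \<delta>[unfolded quotient_functional_def] \<delta>'[unfolded dual.quotient_functional_def]
      have ld: "linear \<delta>'" using \<delta>D by blast
      have "\<delta>' (D g (a x) r') = t * \<delta>' (D g (a x) r)" by (rule t(2)) (use fr \<delta>D in simp)
      also have "\<dots> = \<delta>' (\<epsilon> *\<^sub>R J' (g (a x)) (D g (a x) r))" using \<delta>D by (simp add: \<epsilon>(1) linear_cmul[OF ld])
      finally have "\<delta>' (D g (a x) r' - \<epsilon> *\<^sub>R J' (g (a x)) (D g (a x) r)) = 0" by (simp add: linear_diff[OF ld])
      then obtain u where u: "D f (a x) u = 0" "D g (a x) u = D g (a x) r' - \<epsilon> *\<^sub>R J' (g (a x)) (D g (a x) r)"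
        using \<delta>D by metis
      obtain w2 where w2: "D f (c x) w2 = 0" "D g (c x) w2 = J' (g (c x)) (D g (c x) w)"
        using J'_inv[OF cS fw(1)] by blast
      \<comment> \<open>This vector lies in the planes \<open>g' (ker f')\<close> of both
        \<open>a x\<close> and \<open>c x\<close>, so it vanishes by transversality. Hence
        \<open>D c x\<close> carries \<open>J\<close> into \<open>\<epsilon>\<close> times the
        structure that \<open>J'\<close> induces on \<open>ker f'\<close>.\<close>
      have "D g (a x) u = D g (c x) (w' - \<epsilon> *\<^sub>R w2)"
        by (simp add: u(2) gr w2 ac(3)[OF x] linear_diff[OF linear_Dg[OF cS]] linear_cmul[OF linear_Dg[OF cS]])
      moreover have "D f (c x) (w' - \<epsilon> *\<^sub>R w2) = 0"
        by (simp add: fw w2 linear_diff[OF linear_Df[OF cS]] linear_cmul[OF linear_Df[OF cS]])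
      ultimately have "w' = \<epsilon> *\<^sub>R w2" using transx[OF x u(1)] by (metis eq_iff_diff_eq_0)
      then have "D h x (J x \<xi>) = \<epsilon> *\<^sub>R D k (c x) w2"
        using linear_cmul[OF D_linear[OF smooth_on_differentiable[OF smk ac(5)[OF x]]]] by (simp add: Dh[OF x] w'_def[symmetric])
      also have "D k (c x) w2 = s * D k (c x) w"
        using s(2)[OF fw(1) w2] Dk[OF w2(1)] Dk[OF fw(1)] by simp
      finally show ?thesis by (simp add: Dh[OF x] w_def)
    qed
    then show ?thesis using s(1) \<epsilon>(2) by auto
  qed
  moreover have "D h (f z0) \<xi> = 0 \<longleftrightarrow> (\<exists>v. D g z0 v = 0 \<and> D f z0 v = \<xi>)" for \<xi>
  proof -
    note x = x0(1)
    note aS = ac(4)[OF x] and cS = ac(6)[OF x]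
    obtain \<gamma> v where gv: "quotient_functional (c (f z0)) \<gamma>" "D g (c (f z0)) v = 0" "v \<noteq> 0"
      and Dk: "\<And>w. D f (c (f z0)) w = 0 \<Longrightarrow> D k (c (f z0)) w = bracket (c (f z0)) \<gamma> w v"
      using k[OF ac(5,2)[OF x]] by blast
    let ?w = "D c (f z0) \<xi>" and ?r = "D a (f z0) \<xi>"
    have w: "D f (c (f z0)) ?w = 0" and r: "D f z0 ?r = \<xi>" and gr: "D g z0 ?r = D g (c (f z0)) ?w"
      using Dac[OF x, of \<xi>] by (simp_all add: x0(2))
    have "D h (f z0) \<xi> = 0 \<longleftrightarrow> ?w = 0"
    proof
      show "?w = 0" if "D h (f z0) \<xi> = 0"
        using bracket_nonzero[OF cS gv(1) w _ gv(2,3)] Dk[OF w] Dh[OF x, of \<xi>] that by auto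
      show "D h (f z0) \<xi> = 0" if "?w = 0"
        using linear_0[OF D_linear[OF smooth_on_differentiable[OF smk ac(5)[OF x]]]] Dh[OF x, of \<xi>] that by simp
    qed
    \<comment> \<open>To first order, the slope is stationary exactly when the joining curve is, and
      this means that \<open>x\<close> moves along the curve itself.\<close>
    also have "\<dots> \<longleftrightarrow> (\<exists>v. D g z0 v = 0 \<and> D f z0 v = \<xi>)"
    proof
      assume "?w = 0"
      then have "D g z0 ?r = 0" using gr linear_0[OF linear_Dg[OF cS]] by simp
      then show "\<exists>v. D g z0 v = 0 \<and> D f z0 v = \<xi>" using r by blast
    next
      assume "\<exists>v. D g z0 v = 0 \<and> D f z0 v = \<xi>"
      then obtain u where u: "D g z0 u = 0" "D f z0 u = \<xi>" by blast
      have "D f z0 (?r - u) = 0" "D g z0 (?r - u) = D g (c (f z0)) ?w"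
        using u r gr by (simp_all add: linear_diff[OF linear_Df[OF z0]] linear_diff[OF linear_Dg[OF z0]])
      then show "?w = 0" using transx[OF x _ w, of "?r - u"] by (simp add: x0(2))
    qed
    finally show ?thesis .
  qed
  moreover have "B \<subseteq> f ` S" using ac(1,4) by force
  ultimately show thesis using that[OF B x0(1) _ smh] by blast
qed

lemma J_continuous:
  assumes "B \<subseteq> f ` S" shows "continuous_on B (\<lambda>x. J x \<xi>)"
proof (rule continuous_at_imp_continuous_on, rule ballI)
  fix x assume "x \<in> B"
  then obtain z where "z \<in> S" "x = f z" using assms by blast
  then show "isCont (\<lambda>x. J x \<xi>) x" using differentiable_imp_continuous_within[OF J_diff] by simp
qed

text \<open>So far the alternative between \<i> and -\<i> is undecided at each point separately. The
  quotient \<open>\<sigma>\<close> takes only the values 1 and -1 and is continuous where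
  \<open>D h x \<xi>\<close> does not vanish, so the sign is constant near \<open>f z0\<close>; if
  it is negative, \<open>cnj \<circ> h\<close> serves.\<close>

lemma holomorphic_function:
  assumes z0: "z0 \<in> S"
  obtains B and h :: "real^4 \<Rightarrow> complex" where "open B" "f z0 \<in> B" "smooth_on B h"
    "\<And>x \<xi>. x \<in> B \<Longrightarrow> D h x (J x \<xi>) = \<i> * D h x \<xi>"
    "\<And>\<xi>. D h (f z0) \<xi> = 0 \<longleftrightarrow> (\<exists>v. D g z0 v = 0 \<and> D f z0 v = \<xi>)"
proof -
  obtain B and h :: "real^4 \<Rightarrow> complex" where B: "open B" "f z0 \<in> B" "B \<subseteq> f ` S" and smh: "smooth_on B h"
    and J: "\<And>x. x \<in> B \<Longrightarrow> (\<forall>\<xi>. D h x (J x \<xi>) = \<i> * D h x \<xi>) \<or> (\<forall>\<xi>. D h x (J x \<xi>) = - \<i> * D h x \<xi>)"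
    and ker: "\<And>\<xi>. D h (f z0) \<xi> = 0 \<longleftrightarrow> (\<exists>v. D g z0 v = 0 \<and> D f z0 v = \<xi>)"
    by (rule holomorphic_function_up_to_sign[OF z0]) blast
  obtain \<gamma> where \<gamma>: "quotient_functional z0 \<gamma>" using quotient_functional_exists[OF z0] by blast
  interpret dual: double_fibration S g f J' J by (rule dual_fibration)
  obtain v where v: "D g z0 v = 0" "v \<noteq> 0" using ker_g_nontrivial[OF z0] by blast
  obtain w where w: "D f z0 w = 0" "w \<noteq> 0" using dual.ker_g_nontrivial[OF z0] by blast
  have "bracket z0 \<gamma> w v \<noteq> 0" by (rule bracket_nonzero[OF z0 \<gamma> w v])
  \<comment> \<open>The bracket is a value of \<open>\<gamma>\<close>, so \<open>\<gamma>\<close> is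
    nonzero somewhere, and there \<open>D h (f z0)\<close> is nonzero because the two have the same
    kernel.\<close>
  then obtain \<xi> where "\<gamma> \<xi> \<noteq> 0" unfolding bracket_def by blast
  then have \<xi>: "D h (f z0) \<xi> \<noteq> 0" using ker \<gamma> unfolding quotient_functional_def by blast
  have linh: "linear (D h x)" if "x \<in> B" for x
    by (rule D_linear[OF smooth_on_differentiable[OF smh that]])
  have c1: "continuous_on B (\<lambda>x. D h x \<xi>)" by (rule smooth_on_continuous[OF smooth_on_D[OF smh]])
  have c2: "continuous_on B (\<lambda>x. D h x (J x \<xi>))"
    using Ck_on_apply_linear[of B "D h" 0 "\<lambda>x. J x \<xi>", OF B(1) linh]
      smooth_on_continuous[OF smooth_on_D[OF smh]] J_continuous[OF B(3)] by simp
  define B1 where "B1 = B \<inter> (\<lambda>x. D h x \<xi>) -` (- {0})"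
  have B1: "open B1" unfolding B1_def
    by (rule continuous_open_preimage[OF c1 B(1)]) (simp add: open_Compl)
  define \<sigma> where "\<sigma> x = D h x (J x \<xi>) / (\<i> * D h x \<xi>)" for x
  have cs: "continuous_on B1 \<sigma>" unfolding \<sigma>_def
    by (intro continuous_intros continuous_on_subset[OF c1] continuous_on_subset[OF c2]) (auto simp: B1_def)
  \<comment> \<open>Radius 1 separates the two possible values, whose distance is 2.\<close>
  define B2 where "B2 = B1 \<inter> \<sigma> -` (ball (\<sigma> (f z0)) 1)"
  have B2: "open B2" unfolding B2_def by (rule continuous_open_preimage[OF cs B1 open_ball])
  have x0: "f z0 \<in> B2" using B(2) \<xi> by (simp add: B2_def B1_def)
  have sub: "B2 \<subseteq> B" by (auto simp: B2_def B1_def)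
  have alt: "(\<sigma> x = 1 \<and> (\<forall>\<xi>. D h x (J x \<xi>) = \<i> * D h x \<xi>)) \<or> (\<sigma> x = -1 \<and> (\<forall>\<xi>. D h x (J x \<xi>) = - \<i> * D h x \<xi>))"
    if "x \<in> B1" for x
    using J[of x] that by (auto simp: B1_def \<sigma>_def)
  have near: "dist (\<sigma> (f z0)) (\<sigma> x) < 1" if "x \<in> B2" for x using that by (simp add: B2_def)
  have x01: "f z0 \<in> B1" using x0 by (simp add: B2_def)
  show thesis
  proof (cases "\<sigma> (f z0) = 1")
    case True
    show ?thesis
    proof (rule that[OF B2 x0 smooth_on_subset[OF smh sub] _ ker])
      fix x \<eta> assume x: "x \<in> B2"
      have "\<sigma> x \<noteq> -1" using near[OF x] by (auto simp: True dist_norm)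
      then show "D h x (J x \<eta>) = \<i> * D h x \<eta>" using alt[of x] x by (auto simp: B2_def)
    qed
  next
    case False
    then have m: "\<sigma> (f z0) = -1" using alt[OF x01] by blast
    have Dc: "D (\<lambda>x. cnj (h x)) x \<eta> = cnj (D h x \<eta>)" if "x \<in> B" for x \<eta>
      using D_eqI[OF bounded_linear.has_derivative[OF bounded_linear_cnj smooth_on_has_derivative[OF smh that]]] by simp
    show ?thesis
    proof (rule that[OF B2 x0, of "\<lambda>x. cnj (h x)"])
      show "smooth_on B2 (\<lambda>x. cnj (h x))"
        by (rule smooth_on_linear_compose[OF B2 _ smooth_on_subset[OF smh sub]])
          (rule bounded_linear.linear[OF bounded_linear_cnj])
      show "D (\<lambda>x. cnj (h x)) (f z0) \<eta> = 0 \<longleftrightarrow> (\<exists>v. D g z0 v = 0 \<and> D f z0 v = \<eta>)" for \<eta>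
        by (simp add: Dc B(2) ker)
      fix x \<eta> assume x: "x \<in> B2"
      have "\<sigma> x \<noteq> 1" using near[OF x] by (auto simp: m dist_norm)
      then have "D h x (J x \<eta>) = - \<i> * D h x \<eta>" using alt[of x] x by (auto simp: B2_def)
      then show "D (\<lambda>x. cnj (h x)) x (J x \<eta>) = \<i> * D (\<lambda>x. cnj (h x)) x \<eta>"
        using x sub by (simp add: Dc subset_iff)
    qed
  qed
qed

text \<open>The kernels of \<open>D h1\<close> and \<open>D h2\<close> at \<open>f z0\<close> are
  the tangent planes of the curves of \<open>z0\<close> and \<open>z1\<close>. By
  \<open>transversal_point\<close> these meet only in zero, so the pair of functions has injective
  derivative there. \<open>L\<close> packs the pair into \<open>complex^2\<close>.\<close>

theorem holomorphic_coordinates: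
  assumes z0: "z0 \<in> S" and G: "open G" "f z0 \<in> G"
  obtains B V and \<psi> :: "real^4 \<Rightarrow> complex^2" and \<phi> where "open B" "f z0 \<in> B" "B \<subseteq> G" "open V"
    "homeomorphism B V \<psi> \<phi>" "smooth_on B \<psi>" "smooth_on V \<phi>"
    "\<And>x \<xi>. x \<in> B \<Longrightarrow> D \<psi> x (J x \<xi>) = \<i> *s D \<psi> x \<xi>"
proof -
  obtain z1 where z1: "z1 \<in> S" "f z1 = f z0"
    and trans: "\<And>v v0. D g z1 v = 0 \<Longrightarrow> D g z0 v0 = 0 \<Longrightarrow> D f z1 v = D f z0 v0 \<Longrightarrow> D f z1 v = 0"
    using transversal_point[OF z0] by metis
  obtain B1 and h1 :: "real^4 \<Rightarrow> complex" where h1: "open B1" "f z0 \<in> B1" "smooth_on B1 h1"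
    "\<And>x \<xi>. x \<in> B1 \<Longrightarrow> D h1 x (J x \<xi>) = \<i> * D h1 x \<xi>"
    "\<And>\<xi>. D h1 (f z0) \<xi> = 0 \<longleftrightarrow> (\<exists>v. D g z0 v = 0 \<and> D f z0 v = \<xi>)"
    by (rule holomorphic_function[OF z0]) blast
  obtain B2 and h2 :: "real^4 \<Rightarrow> complex" where h2: "open B2" "f z1 \<in> B2" "smooth_on B2 h2"
    "\<And>x \<xi>. x \<in> B2 \<Longrightarrow> D h2 x (J x \<xi>) = \<i> * D h2 x \<xi>"
    "\<And>\<xi>. D h2 (f z1) \<xi> = 0 \<longleftrightarrow> (\<exists>v. D g z1 v = 0 \<and> D f z1 v = \<xi>)"
    by (rule holomorphic_function[OF z1(1)]) blast
  define B where "B = B1 \<inter> B2 \<inter> G"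
  have B: "open B" "f z0 \<in> B" using h1 h2 G z1 by (auto simp: B_def)
  define L :: "complex \<times> complex \<Rightarrow> complex^2" where "L p = (\<chi> i. if i = 1 then fst p else snd p)" for p
  have linL: "linear L" unfolding L_def by (rule linearI) (auto simp: vec_eq_iff)
  have L0: "L p = 0 \<longleftrightarrow> p = 0" for p
    unfolding L_def by (auto simp: vec_eq_iff prod_eq_iff forall_2)
  define \<psi> where "\<psi> x = L (h1 x, h2 x)" for x
  have sm12: "smooth_on B (\<lambda>x. (h1 x, h2 x))"
    by (intro smooth_on_Pair B) (auto intro: smooth_on_subset[OF h1(3)] smooth_on_subset[OF h2(3)] simp: B_def)
  have sm: "smooth_on B \<psi>" unfolding \<psi>_def by (rule smooth_on_linear_compose[OF B(1) linL sm12])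
  have D\<psi>: "D \<psi> x \<xi> = L (D h1 x \<xi>, D h2 x \<xi>)" if x: "x \<in> B" for x \<xi>
  proof -
    have "((\<lambda>x. (h1 x, h2 x)) has_derivative (\<lambda>\<xi>. (D h1 x \<xi>, D h2 x \<xi>))) (at x)"
      by (intro has_derivative_Pair smooth_on_has_derivative[OF h1(3)] smooth_on_has_derivative[OF h2(3)])
        (use x in \<open>auto simp: B_def\<close>)
    from bounded_linear.has_derivative[OF _ this, of L] linL show ?thesis
      unfolding \<psi>_def by (simp add: D_eqI linear_linear)
  qed
  have "\<xi> = 0" if "D \<psi> (f z0) \<xi> = 0" for \<xi>
  proof -
    have "D h1 (f z0) \<xi> = 0" "D h2 (f z1) \<xi> = 0"
      using that by (simp_all add: D\<psi>[OF B(2)] L0 zero_prod_def z1(2))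
    then obtain v v1 where "D g z0 v = 0" "D f z0 v = \<xi>" "D g z1 v1 = 0" "D f z1 v1 = \<xi>"
      using h1(5) h2(5) by blast
    then show ?thesis using trans by metis
  qed
  then have "inj (D \<psi> (f z0))"
    using linear_injective_0[OF D_linear[OF smooth_on_differentiable[OF sm B(2)]]] by blast
  moreover have "DIM(real^4) = DIM(complex^2)" by simp
  ultimately obtain U V \<phi> where U: "open U" "f z0 \<in> U" "U \<subseteq> B" "open V" "homeomorphism U V \<psi> \<phi>" "smooth_on V \<phi>"
    using smooth_inverse_function[OF _ B(1) sm B(2)] by metis
  show thesis
  proof (rule that[OF U(1,2) _ U(4,5) _ U(6)])
    show "U \<subseteq> G" "smooth_on U \<psi>" using U(3) smooth_on_subset[OF sm] by (auto simp: B_def)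
    fix x \<xi> assume "x \<in> U"
    then have x: "x \<in> B" using U(3) by blast
    then have "x \<in> B1" "x \<in> B2" by (auto simp: B_def)
    then show "D \<psi> x (J x \<xi>) = \<i> *s D \<psi> x \<xi>"
      by (simp add: D\<psi>[OF x] h1(4) h2(4) L_def vec_eq_iff)
  qed
qed

end

subsection \<open>Atlases\<close>

lemma topspace_mtop: "topspace (mtop A) = mcarrier A"
proof -
  have "\<Union> {U \<inter> \<phi> -` G | U \<phi> G. (U, \<phi>) \<in> A \<and> open G} = \<Union> (fst ` A)"
  proof
    show "\<Union> (fst ` A) \<subseteq> \<Union> {U \<inter> \<phi> -` G | U \<phi> G. (U, \<phi>) \<in> A \<and> open G}"
    proof
      fix x assume "x \<in> \<Union> (fst ` A)"
      then obtain U \<phi> where "(U, \<phi>) \<in> A" "x \<in> U \<inter> \<phi> -` UNIV" by force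
      then show "x \<in> \<Union> {U \<inter> \<phi> -` G | U \<phi> G. (U, \<phi>) \<in> A \<and> open G}" using open_UNIV by blast
    qed
  qed force
  then show ?thesis by (simp add: mtop_def mcarrier_def)
qed

lemma chart_preimage_openin: "(U, \<phi>) \<in> A \<Longrightarrow> open G \<Longrightarrow> openin (mtop A) (U \<inter> \<phi> -` G)"
  unfolding mtop_def by (rule topology_generated_by_Basis) blast

lemma chart_domain_openin: "(U, \<phi>) \<in> A \<Longrightarrow> openin (mtop A) U"
  using chart_preimage_openin[of U \<phi> A UNIV] by simp

lemma manifold_chart_inj: "smooth_manifold A \<Longrightarrow> (U, \<phi>) \<in> A \<Longrightarrow> inj_on \<phi> U"
  unfolding smooth_manifold_def is_chart_def by force

lemma transition_smooth:
  assumes "smooth_manifold A" "(U, \<phi>) \<in> A" "(V, \<psi>) \<in> A"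
  shows "open (\<phi> ` (U \<inter> V))" "smooth_on (\<phi> ` (U \<inter> V)) (\<psi> \<circ> inv_into U \<phi>)"
  using assms unfolding smooth_manifold_def smoothly_compatible_def by fastforce+

text \<open>Induction on the generation of the open set: injectivity of the chart makes images
  commute with intersections, and the image of a subbasic set is a preimage under a transition map,
  which is continuous on an open domain.\<close>

lemma chart_image_open:
  assumes A: "smooth_manifold A" "(U, \<phi>) \<in> A" and "openin (mtop A) W"
  shows "open (\<phi> ` (U \<inter> W))"
proof -
  have inj: "inj_on \<phi> U" by (rule manifold_chart_inj[OF A])
  have "generate_topology_on {U \<inter> \<phi> -` G | U \<phi> G. (U, \<phi>) \<in> A \<and> open G} W"
    using assms(3) unfolding mtop_def openin_topology_generated_by_iff .
  then show ?thesis
  proof induction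
    case (Int a b)
    have "\<phi> ` (U \<inter> (a \<inter> b)) = \<phi> ` (U \<inter> a) \<inter> \<phi> ` (U \<inter> b)"
      using inj by (auto simp: inj_on_def)
    then show ?case using Int by auto
  next
    case (UN K)
    have "\<phi> ` (U \<inter> \<Union> K) = (\<Union>k\<in>K. \<phi> ` (U \<inter> k))" by blast
    then show ?case using UN by auto
  next
    case (Basis s)
    then obtain V \<psi> G where s: "s = V \<inter> \<psi> -` G" "(V, \<psi>) \<in> A" "open G" by blast
    note t = transition_smooth[OF A s(2)]
    have "open (\<phi> ` (U \<inter> V) \<inter> (\<psi> \<circ> inv_into U \<phi>) -` G)"
      by (rule continuous_open_preimage[OF smooth_on_continuous[OF t(2)] t(1) s(3)])
    also have "\<phi> ` (U \<inter> V) \<inter> (\<psi> \<circ> inv_into U \<phi>) -` G = \<phi> ` (U \<inter> s)"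
      using inj by (auto simp: s inv_into_f_f)
    finally show ?case .
  qed simp
qed

lemma openin_restrict_atlas:
  assumes "openin (mtop A) W" "openin (mtop (restrict_atlas A W)) W1"
  shows "openin (mtop A) W1"
proof -
  have "generate_topology_on {U \<inter> \<phi> -` G | U \<phi> G. (U, \<phi>) \<in> restrict_atlas A W \<and> open G} W1"
    using assms(2) unfolding mtop_def openin_topology_generated_by_iff .
  then show ?thesis
  proof induction
    case (Basis s)
    then obtain U \<phi> G where s: "s = (U \<inter> W) \<inter> \<phi> -` G" "(U, \<phi>) \<in> A" "open G"
      unfolding restrict_atlas_def by blast
    have "s = (U \<inter> \<phi> -` G) \<inter> W" using s(1) by blast
    then show ?case using openin_Int[OF chart_preimage_openin[OF s(2,3)] assms(1)] by simp
  qed auto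
qed

lemma smooth_map_charts:
  "smooth_map A B f \<Longrightarrow> (U, \<phi>) \<in> A \<Longrightarrow> (V, \<psi>) \<in> B \<Longrightarrow> smooth_on (\<phi> ` (U \<inter> f -` V)) (\<psi> \<circ> f \<circ> inv_into U \<phi>)"
  unfolding smooth_map_def by fast

lemma smooth_map_preimage_openin:
  "smooth_map A B f \<Longrightarrow> openin (mtop B) V \<Longrightarrow> openin (mtop A) (mcarrier A \<inter> f -` V)"
  using openin_continuous_map_preimage[of "mtop A" "mtop B" f V]
  by (simp add: smooth_map_def topspace_mtop Int_def vimage_def)

lemma smooth_map_in_carrier: "smooth_map A B f \<Longrightarrow> x \<in> mcarrier A \<Longrightarrow> f x \<in> mcarrier B"
  using continuous_map_image_subset_topspace[of "mtop A" "mtop B" f]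
  by (auto simp: smooth_map_def topspace_mtop)

section \<open>Tangent vectors and differentials in charts\<close>

lemma chart_at_cases:
  assumes "x \<in> mcarrier A"
  obtains U where "chart_at A x = (U, coords_at A x)" "(U, coords_at A x) \<in> A" "x \<in> U"
proof -
  have "\<exists>c. c \<in> A \<and> x \<in> fst c" using assms by (auto simp: mcarrier_def)
  then have "chart_at A x \<in> A \<and> x \<in> fst (chart_at A x)" unfolding chart_at_def by (rule someI_ex)
  moreover have "chart_at A x = (fst (chart_at A x), coords_at A x)" by (simp add: coords_at_def)
  ultimately show thesis using that by metis
qed

lemma D_change_chart:
  fixes h :: "'a \<Rightarrow> 'f::euclidean_space"
  assumes A: "smooth_manifold A" "(U, \<phi>) \<in> A" "(V, \<psi>) \<in> A" "x \<in> U" "x \<in> V"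
    and h: "(h \<circ> inv_into V \<psi>) differentiable at (\<psi> x)"
  shows "(h \<circ> inv_into U \<phi>) differentiable at (\<phi> x)"
    and "D (h \<circ> inv_into U \<phi>) (\<phi> x) v = D (h \<circ> inv_into V \<psi>) (\<psi> x) (D (\<psi> \<circ> inv_into U \<phi>) (\<phi> x) v)"
proof -
  note t = transition_smooth[OF A(1-3)]
  note inj = manifold_chart_inj[OF A(1,2)] manifold_chart_inj[OF A(1,3)]
  have x: "\<phi> x \<in> \<phi> ` (U \<inter> V)" using A by blast
  note d = smooth_on_differentiable[OF t(2) x]
  have e: "(\<psi> \<circ> inv_into U \<phi>) (\<phi> x) = \<psi> x" using inj A by (simp add: inv_into_f_f)
  let ?c = "\<lambda>q. (h \<circ> inv_into V \<psi>) ((\<psi> \<circ> inv_into U \<phi>) q)"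
  have dc: "?c differentiable at (\<phi> x)"
    using differentiable_chain_at[OF d, of "h \<circ> inv_into V \<psi>"] h e by (simp add: o_def)
  have eq: "?c q = (h \<circ> inv_into U \<phi>) q" if "q \<in> \<phi> ` (U \<inter> V)" for q
    using that inj by (auto simp: inv_into_f_f)
  from D_cong_open[OF t(1) x eq dc]
  show "(h \<circ> inv_into U \<phi>) differentiable at (\<phi> x)"
    "D (h \<circ> inv_into U \<phi>) (\<phi> x) v = D (h \<circ> inv_into V \<psi>) (\<psi> x) (D (\<psi> \<circ> inv_into U \<phi>) (\<phi> x) v)"
    using D_compose[OF d, of "h \<circ> inv_into V \<psi>" v] h e by (simp_all add: o_def)
qed

lemma D_chart_self:
  assumes A: "smooth_manifold A" "(U, \<phi>) \<in> A" "x \<in> U"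
  shows "(\<phi> \<circ> inv_into U \<phi>) differentiable at (\<phi> x)" "D (\<phi> \<circ> inv_into U \<phi>) (\<phi> x) v = v"
proof -
  have o: "open (\<phi> ` U)" using transition_smooth(1)[OF A(1,2,2)] by simp
  have eq: "q = (\<phi> \<circ> inv_into U \<phi>) q" if "q \<in> \<phi> ` U" for q
    using that by (simp add: f_inv_into_f)
  have x: "\<phi> x \<in> \<phi> ` U" using A by blast
  from D_cong_open[OF o x, of "\<lambda>q. q", OF eq]
  show "(\<phi> \<circ> inv_into U \<phi>) differentiable at (\<phi> x)" "D (\<phi> \<circ> inv_into U \<phi>) (\<phi> x) v = v"
    using D_linear_map[OF linear_id[unfolded id_def], of "\<phi> x"] by (auto simp: o_def)
qed

text \<open>With respect to the chart singled out by \<open>chart_at\<close>, this is the derivative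
  of a transition map; the transition map in the opposite direction supplies the inverse.\<close>

lemma differential_chart:
  fixes A :: "('a, 'e::euclidean_space) atlas"
  assumes A: "smooth_manifold A" "(U, \<phi>) \<in> A" "x \<in> U"
  shows "linear (differential A \<phi> x)" "bij (differential A \<phi> x)"
proof -
  have "x \<in> mcarrier A" using A by (force simp: mcarrier_def)
  then obtain V where V: "chart_at A x = (V, coords_at A x)" "(V, coords_at A x) \<in> A" "x \<in> V"
    by (rule chart_at_cases)
  let ?\<psi> = "coords_at A x"
  have d: "differential A \<phi> x = D (\<phi> \<circ> inv_into V ?\<psi>) (?\<psi> x)"
    by (simp add: differential_def V)
  note s = D_chart_self[OF A] D_chart_self[OF A(1) V(2,3)]
  have "(\<phi> \<circ> inv_into V ?\<psi>) differentiable at (?\<psi> x)"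
    by (rule D_change_chart(1)[OF A(1) V(2) A(2) V(3) A(3) s(1)])
  then show "linear (differential A \<phi> x)" unfolding d by (rule D_linear)
  have d2: "(?\<psi> \<circ> inv_into U \<phi>) differentiable at (\<phi> x)"
    by (rule D_change_chart(1)[OF A(1,2) V(2) A(3) V(3) s(3)])
  have "D (?\<psi> \<circ> inv_into U \<phi>) (\<phi> x) (differential A \<phi> x v) = v" for v
    unfolding d using D_change_chart(2)[OF A(1) V(2) A(2) V(3) A(3) d2, of v] s(4) by simp
  moreover have "differential A \<phi> x (D (?\<psi> \<circ> inv_into U \<phi>) (\<phi> x) v) = v" for v
    unfolding d using D_change_chart(2)[OF A(1,2) V(2) A(3) V(3), of \<phi> v] s(2)
      \<open>(\<phi> \<circ> inv_into V ?\<psi>) differentiable at (?\<psi> x)\<close> by simp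
  ultimately show "bij (differential A \<phi> x)" by (metis bijI')
qed

lemma differential_chain:
  fixes h :: "'a \<Rightarrow> 'f::euclidean_space"
  assumes A: "smooth_manifold A" "(U, \<phi>) \<in> A" "x \<in> U" and h: "(h \<circ> inv_into U \<phi>) differentiable at (\<phi> x)"
  shows "differential A h x v = D (h \<circ> inv_into U \<phi>) (\<phi> x) (differential A \<phi> x v)"
proof -
  have "x \<in> mcarrier A" using A by (force simp: mcarrier_def)
  then obtain V where V: "chart_at A x = (V, coords_at A x)" "(V, coords_at A x) \<in> A" "x \<in> V"
    by (rule chart_at_cases)
  show ?thesis using D_change_chart(2)[OF A(1) V(2) A(2) V(3) A(3) h] by (simp add: differential_def V)
qed

lemma smooth_map_differentiable:
  assumes "smooth_map A B f" "(U, \<phi>) \<in> A" "(V, \<psi>) \<in> B" "x \<in> U" "f x \<in> V"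
  shows "(\<psi> \<circ> f \<circ> inv_into U \<phi>) differentiable at (\<phi> x)"
  by (rule smooth_on_differentiable[OF smooth_map_charts[OF assms(1-3)]]) (use assms in blast)

lemma mderiv_eq:
  assumes "chart_at A x = (U, coords_at A x)"
  shows "mderiv A B f x = D (coords_at B (f x) \<circ> f \<circ> inv_into U (coords_at A x)) (coords_at A x x)"
  by (simp add: mderiv_def differential_def assms)

lemma linear_mderiv:
  assumes f: "smooth_map A B f" and x: "x \<in> mcarrier A"
  shows "linear (mderiv A B f x)"
proof -
  obtain U where U: "chart_at A x = (U, coords_at A x)" "(U, coords_at A x) \<in> A" "x \<in> U"
    using chart_at_cases[OF x] by metis
  obtain V where V: "(V, coords_at B (f x)) \<in> B" "f x \<in> V"
    using chart_at_cases[OF smooth_map_in_carrier[OF f x]] by metis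
  show ?thesis
    unfolding mderiv_eq[OF U(1)] by (rule D_linear[OF smooth_map_differentiable[OF f U(2) V(1) U(3) V(2)]])
qed

lemma mderiv_compose:
  assumes A: "smooth_manifold A" and f: "smooth_map A B f" and g: "smooth_map B C g"
    and inj: "\<And>V \<psi>. (V, \<psi>) \<in> B \<Longrightarrow> inj_on \<psi> V" and x: "x \<in> mcarrier A"
  shows "mderiv A C (\<lambda>x. g (f x)) x v = mderiv B C g (f x) (mderiv A B f x v)"
proof -
  note fx = smooth_map_in_carrier[OF f x]
  note gx = smooth_map_in_carrier[OF g fx]
  let ?a = "coords_at A x" and ?b = "coords_at B (f x)" and ?c = "coords_at C (g (f x))"
  obtain U where U: "chart_at A x = (U, ?a)" "(U, ?a) \<in> A" "x \<in> U" using chart_at_cases[OF x] by metis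
  obtain V where V: "chart_at B (f x) = (V, ?b)" "(V, ?b) \<in> B" "f x \<in> V" using chart_at_cases[OF fx] by metis
  obtain W where W: "(W, ?c) \<in> C" "g (f x) \<in> W" using chart_at_cases[OF gx] by metis
  define N where "N = ?a ` (U \<inter> (mcarrier A \<inter> f -` V))"
  have N: "open N" unfolding N_def
    by (rule chart_image_open[OF A U(2) smooth_map_preimage_openin[OF f chart_domain_openin[OF V(2)]]])
  have xN: "?a x \<in> N" using x U V by (auto simp: N_def)
  have injU: "inj_on ?a U" by (rule manifold_chart_inj[OF A U(2)])
  define F where "F = ?b \<circ> f \<circ> inv_into U ?a"
  define G where "G = ?c \<circ> g \<circ> inv_into V ?b"
  have dF: "F differentiable at (?a x)" unfolding F_def by (rule smooth_map_differentiable[OF f U(2) V(2) U(3) V(3)])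
  have Fx: "F (?a x) = ?b (f x)" using injU U by (simp add: F_def inv_into_f_f)
  have dG: "G differentiable at (F (?a x))" unfolding G_def Fx by (rule smooth_map_differentiable[OF g V(2) W(1) V(3) W(2)])
  have eq: "G (F q) = (?c \<circ> (\<lambda>x. g (f x)) \<circ> inv_into U ?a) q" if "q \<in> N" for q
    using that injU inj[OF V(2)] by (auto simp: N_def F_def G_def inv_into_f_f)
  have "(\<lambda>q. G (F q)) differentiable at (?a x)" using differentiable_chain_at[OF dF dG] by (simp add: o_def)
  from D_cong_open(2)[OF N xN eq this]
  have "D (?c \<circ> (\<lambda>x. g (f x)) \<circ> inv_into U ?a) (?a x) v = D G (?b (f x)) (D F (?a x) v)"
    using D_compose[OF dF dG, of v] Fx by (simp add: o_def)
  then show ?thesis by (simp add: mderiv_eq[OF U(1)] mderiv_eq[OF V(1)] F_def G_def)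
qed

text \<open>\<open>mderiv\<close> refers to charts chosen separately at each point, which may jump,
  so it is not suited to further differentiation. Here it is rewritten in fixed charts, with
  \<open>differential\<close> converting the components on both sides; second derivatives are taken
  in this form.\<close>

lemma mderiv_charts:
  assumes A: "smooth_manifold A" and B: "smooth_manifold B" and f: "smooth_map A B f"
    and U: "(U, \<phi>) \<in> A" "x \<in> U" and V: "(V, \<psi>) \<in> B" "f x \<in> V"
  shows "D (\<psi> \<circ> f \<circ> inv_into U \<phi>) (\<phi> x) (differential A \<phi> x w) = differential B \<psi> (f x) (mderiv A B f x w)"
proof -
  have fx: "f x \<in> mcarrier B" and x: "x \<in> mcarrier A" using U V by (force simp: mcarrier_def)+
  let ?b = "coords_at B (f x)"
  obtain V' where V': "chart_at B (f x) = (V', ?b)" "(V', ?b) \<in> B" "f x \<in> V'" using chart_at_cases[OF fx] by metis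
  have injU: "inj_on \<phi> U" by (rule manifold_chart_inj[OF A U(1)])
  have injV': "inj_on ?b V'" by (rule manifold_chart_inj[OF B V'(2)])
  define F where "F = ?b \<circ> f \<circ> inv_into U \<phi>"
  define G where "G = \<psi> \<circ> inv_into V' ?b"
  have dF: "F differentiable at (\<phi> x)" unfolding F_def by (rule smooth_map_differentiable[OF f U(1) V'(2) U(2) V'(3)])
  have Fx: "F (\<phi> x) = ?b (f x)" using injU U by (simp add: F_def inv_into_f_f)
  have dG: "G differentiable at (F (\<phi> x))" unfolding G_def Fx
    by (rule D_change_chart(1)[OF B V'(2) V(1) V'(3) V(2) D_chart_self(1)[OF B V]])
  define N where "N = \<phi> ` (U \<inter> (mcarrier A \<inter> f -` V'))"
  have N: "open N" unfolding N_def
    by (rule chart_image_open[OF A U(1) smooth_map_preimage_openin[OF f chart_domain_openin[OF V'(2)]]])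
  have xN: "\<phi> x \<in> N" using x U V' by (auto simp: N_def)
  have eq: "G (F q) = (\<psi> \<circ> f \<circ> inv_into U \<phi>) q" if "q \<in> N" for q
    using that injU injV' by (auto simp: N_def F_def G_def inv_into_f_f)
  have "(\<lambda>q. G (F q)) differentiable at (\<phi> x)" using differentiable_chain_at[OF dF dG] by (simp add: o_def)
  from D_cong_open(2)[OF N xN eq this]
  have "D (\<psi> \<circ> f \<circ> inv_into U \<phi>) (\<phi> x) (differential A \<phi> x w) = D G (?b (f x)) (D F (\<phi> x) (differential A \<phi> x w))"
    using D_compose[OF dF dG] Fx by (simp add: o_def)
  also have "D F (\<phi> x) (differential A \<phi> x w) = mderiv A B f x w"
    using differential_chain[OF A U, of "?b \<circ> f" w] dF by (simp add: mderiv_def F_def)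
  finally show ?thesis by (simp add: differential_def V' G_def o_def)
qed

subsection \<open>Oriented planes\<close>

lemma span_pair: "span {u, v} = {a *\<^sub>R u + b *\<^sub>R v | a b. True}"
  unfolding span_insert span_singleton by (force simp: algebra_simps)

lemma plane_oplane: "plane (oplane u v) = span {u, v}"
proof
  have "fst ` oplane u v \<subseteq> span {u, v}"
    by (auto simp: oplane_def span_pair) blast
  then show "plane (oplane u v) \<subseteq> span {u, v}" unfolding plane_def by (rule span_minimal) simp
  have "(1 *\<^sub>R u + 0 *\<^sub>R v, 0 *\<^sub>R u + 1 *\<^sub>R v) \<in> oplane u v"
    unfolding oplane_def by (intro CollectI exI conjI, rule refl) simp
  then have u: "u \<in> fst ` oplane u v" by force
  have "(0 *\<^sub>R u + 1 *\<^sub>R v, (-1) *\<^sub>R u + 0 *\<^sub>R v) \<in> oplane u v"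
    unfolding oplane_def by (intro CollectI exI conjI, rule refl) simp
  then have v: "v \<in> fst ` oplane u v" by force
  show "span {u, v} \<subseteq> plane (oplane u v)" unfolding plane_def
    by (rule span_mono) (use u v in auto)
qed

lemma map_prod_oplane:
  assumes "linear L" shows "map_prod L L ` oplane u v = oplane (L u) (L v)"
proof -
  have "map_prod L L (a *\<^sub>R u + b *\<^sub>R v, c *\<^sub>R u + d *\<^sub>R v) = (a *\<^sub>R L u + b *\<^sub>R L v, c *\<^sub>R L u + d *\<^sub>R L v)" for a b c d
    using assms by (simp add: linear_add linear_cmul)
  then show ?thesis unfolding oplane_def by (force simp: image_def)
qed

lemma plane_map_prod:
  assumes "linear L" shows "plane (map_prod L L ` oplane u v) = L ` plane (oplane u v)"
  using linear_span_image[OF assms, of "{u, v}"] by (simp add: map_prod_oplane[OF assms] plane_oplane)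

lemma span_image_basis2:
  fixes L :: "real^2 \<Rightarrow> 'a::real_vector"
  assumes "linear L" shows "span {L (axis 1 1), L (axis 2 1)} = range L"
proof -
  have L: "L (a *\<^sub>R axis 1 1 + b *\<^sub>R axis 2 1) = a *\<^sub>R L (axis 1 1) + b *\<^sub>R L (axis 2 1)" for a b
    by (simp add: linear_add[OF assms] linear_cmul[OF assms])
  have "\<exists>a b. x = a *\<^sub>R axis 1 1 + b *\<^sub>R axis 2 1" for x :: "real^2"
    by (rule exI[of _ "x $ 1"], rule exI[of _ "x $ 2"]) (simp add: vec_eq_iff forall_2 axis_def)
  then have "\<exists>a b. L x = a *\<^sub>R L (axis 1 1) + b *\<^sub>R L (axis 2 1)" for x by (metis L)
  moreover have "a *\<^sub>R L (axis 1 1) + b *\<^sub>R L (axis 2 1) \<in> range L" for a b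
    unfolding L[symmetric] by simp
  ultimately show ?thesis unfolding span_pair by auto
qed

lemma plane_gr_graph:
  assumes "linear g" shows "plane (gr_graph g a) = range (\<lambda>e. g (e, a *v e))"
proof -
  have "linear (\<lambda>e. g (e, a *v e))"
    by (rule linearI) (simp_all add: linear_add[OF assms, symmetric] linear_cmul[OF assms, symmetric] matrix_vector_right_distrib matrix_vector_mult_scaleR)
  from span_image_basis2[OF this] show ?thesis by (simp add: gr_graph_def plane_oplane)
qed

text \<open>Together with a right inverse \<open>r\<close> of \<open>f\<close>, the map
  \<open>j\<close> gives an injective, hence bijective, map from the product. When \<open>w\<close>
  is written as a sum from \<open>range j\<close> and \<open>range r\<close>, the condition
  \<open>f w = 0\<close> removes the second summand. This identifies the 2-dimensional kernels of
  maps from \<open>real^6\<close> onto \<open>real^4\<close>.\<close>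

lemma exact_by_dimension:
  fixes f :: "'b::euclidean_space \<Rightarrow> 'c::euclidean_space" and j :: "'a::euclidean_space \<Rightarrow> 'b"
  assumes f: "linear f" "surj f" and j: "linear j" "inj j" and fj: "\<And>x. f (j x) = 0"
    and dim: "DIM('a) + DIM('c) = DIM('b)" and w: "f w = 0"
  shows "w \<in> range j"
proof -
  obtain r where r: "linear r" "\<And>y. f (r y) = y"
    using linear_surjective_right_inverse[OF f] by (metis comp_def id_apply)
  define P where "P p = j (fst p) + r (snd p)" for p
  have linP: "linear P" unfolding P_def
    by (rule linearI) (simp_all add: linear_add[OF j(1)] linear_add[OF r(1)] linear_cmul[OF j(1)] linear_cmul[OF r(1)] algebra_simps)
  have fP: "f (P p) = snd p" for p by (simp add: P_def linear_add[OF f(1)] fj r)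
  have "p = 0" if "P p = 0" for p
  proof -
    have "snd p = 0" using fP[of p] that linear_0[OF f(1)] by simp
    moreover from this that have "j (fst p) = 0" by (simp add: P_def linear_0[OF r(1)])
    then have "fst p = 0" using j linear_injective_0 by blast
    ultimately show ?thesis by (simp add: prod_eq_iff)
  qed
  then have "inj P" using linear_injective_0[OF linP] by blast
  then have "bij P" by (rule linear_inj_imp_bij[OF linP]) (simp add: dim)
  then obtain p where p: "w = P p" by (metis bij_pointE)
  then have "snd p = 0" using fP[of p] w by simp
  then show ?thesis using p by (simp add: P_def linear_0[OF r(1)])
qed

text \<open>Two further vectors are adjoined, each outside the span reached so far. The result
  defines a chart of the Grassmannian in which the plane \<open>range l\<close> is the graph of
  zero.\<close>

lemma extend_to_isomorphism:
  fixes l :: "real^2 \<Rightarrow> real^4"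
  assumes l: "linear l" "inj l"
  obtains g :: "(real^2) \<times> (real^2) \<Rightarrow> real^4" where "linear g" "bij g" "\<And>e. g (e, 0) = l e"
proof -
  have "dim (range l) \<le> 2" using dim_image_le[OF l(1), of UNIV] by simp
  then have "range l \<noteq> UNIV" by auto
  then obtain c where c: "\<And>e. c \<noteq> l e" by blast
  define m where "m p = l (fst p) + snd p *\<^sub>R c" for p :: "(real^2) \<times> real"
  have linm: "linear m" unfolding m_def
    by (rule linearI) (simp_all add: linear_add[OF l(1)] linear_cmul[OF l(1)] algebra_simps)
  have "dim (range m) \<le> 3" using dim_image_le[OF linm, of UNIV] by simp
  then have "range m \<noteq> UNIV" by auto
  then obtain d where d: "\<And>p. d \<noteq> m p" by blast
  define g where "g p = l (fst p) + (snd p $ 1) *\<^sub>R c + (snd p $ 2) *\<^sub>R d" for p :: "(real^2) \<times> (real^2)"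
  have ling: "linear g" unfolding g_def
    by (rule linearI) (simp_all add: linear_add[OF l(1)] linear_cmul[OF l(1)] algebra_simps)
  have "p = 0" if p: "g p = 0" for p
  proof -
    have 2: "snd p $ 2 = 0"
    proof (rule ccontr)
      assume n: "snd p $ 2 \<noteq> 0"
      have "m (fst p, snd p $ 1) = - ((snd p $ 2) *\<^sub>R d)" using p by (simp add: g_def m_def add_eq_0_iff2)
      then have "m (- (1 / (snd p $ 2)) *\<^sub>R (fst p, snd p $ 1)) = d"
        using n by (simp only: linear_cmul[OF linm]) simp
      then show False using d by metis
    qed
    have 1: "snd p $ 1 = 0"
    proof (rule ccontr)
      assume n: "snd p $ 1 \<noteq> 0"
      have "l (fst p) = - ((snd p $ 1) *\<^sub>R c)" using p 2 by (simp add: g_def add_eq_0_iff2)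
      then have "l (- (1 / (snd p $ 1)) *\<^sub>R fst p) = c"
        using n by (simp only: linear_cmul[OF l(1)]) simp
      then show False using c by metis
    qed
    have "l (fst p) = 0" using p 1 2 by (simp add: g_def)
    then have "fst p = 0" using l linear_injective_0 by blast
    then show ?thesis using 1 2 by (simp add: prod_eq_iff vec_eq_iff forall_2)
  qed
  then have "inj g" using linear_injective_0[OF ling] by blast
  then have "bij g" by (rule linear_inj_imp_bij[OF ling]) simp
  then show thesis using that[OF ling] by (simp add: g_def)
qed

subsection \<open>The incidence manifold\<close>

(* In the charts of the Grassmannian the planes f' (ker g') are graphs, so this turns the immersivity of
   tau into nondegeneracy of the bracket. *)
lemma (in double_prefibration) nondegenerate_from_graph:
  fixes p :: "(real^2) \<times> (real^2) \<Rightarrow> real^4" and a :: "real^6 \<Rightarrow> real^2^2"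
  assumes z: "z \<in> S" and N: "open N" "z \<in> N" "N \<subseteq> S" and p: "linear p" "bij p"
    and graph: "\<And>y. y \<in> N \<Longrightarrow> D f y ` {v. D g y v = 0} = range (\<lambda>e. p (e, a y *v e))"
    and a: "a differentiable at z" and w: "D a z w \<noteq> 0"
  shows "\<exists>v. D g z v = 0 \<and> (\<forall>u v'. DD g z w v + D g z u = 0 \<longrightarrow> D g z v' = 0 \<longrightarrow> DD f z w v + D f z u \<noteq> D f z v')"
proof -
  have "\<exists>e. D a z w *v e \<noteq> 0"
    using w matrix_eq[of "D a z w" 0] by (auto simp: matrix_vector_mult_0)
  then obtain e where e: "D a z w *v e \<noteq> 0" by blast
  define q where "q x = fst (inv p x)" for x
  have linq: "linear q" unfolding q_def
    using linear_compose[OF linear_inv_bij[OF p] linear_fst] by (simp add: o_def)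
  have qp: "q (p x) = fst x" for x using p(2) by (simp add: q_def bij_is_inj)
  define A where "A y u = (D g y u, q (D f y u))" for y u
  have linA: "linear (A y)" if "y \<in> S" for y unfolding A_def
    by (rule linearI) (simp_all add: linear_add[OF linear_Dg[OF that]] linear_add[OF linear_Df[OF that]] linear_add[OF linq]
      linear_cmul[OF linear_Dg[OF that]] linear_cmul[OF linear_Df[OF that]] linear_cmul[OF linq])
  have smA: "smooth_on S (\<lambda>y. A y u)" for u unfolding A_def
    by (intro smooth_on_Pair smooth_on_linear_compose[where L = q] open_S linq smooth_on_D smooth_f smooth_g)
  have injA: "inj (A y)" if y: "y \<in> N" for y
  proof -
    have yS: "y \<in> S" using y N by blast
    have "u = 0" if "A y u = 0" for u
    proof -
      have u: "D g y u = 0" "q (D f y u) = 0" using that by (auto simp: A_def zero_prod_def)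
      then obtain e' where e': "D f y u = p (e', a y *v e')" using graph[OF y] by blast
      then have "e' = 0" using u(2) qp by simp
      then have "D f y u = 0" using e' linear_0[OF p(1)] by (simp add: zero_prod_def[symmetric])
      then show ?thesis using ker_inter[OF yS _ u(1)] by blast
    qed
    then show ?thesis using linear_injective_0[OF linA[OF yS]] by blast
  qed
  have bijA: "bij (A y)" if "y \<in> N" for y
    by (rule linear_inj_imp_bij) (use that N linA injA in auto)
  \<comment> \<open>The field in \<open>ker g'\<close> whose image under \<open>f'\<close> has
    constant first component \<open>e\<close> with respect to \<open>p\<close>; the second component
    is then read off from the moving matrix \<open>a y\<close>.\<close>
  define V where "V y = inv (A y) (0, e)" for y
  have AV: "A y (V y) = (0, e)" if "y \<in> N" for y
    using bijA[OF that] by (simp add: V_def bij_is_surj surj_f_inv_f)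
  have smV: "smooth_on N V" unfolding V_def
    by (rule inverse_family_smooth[OF _ N(1)]) (use N linA injA smooth_on_subset[OF smA N(3)] in auto)
  have V0: "D g y (V y) = 0" if "y \<in> N" for y using AV[OF that] by (simp add: A_def)
  have fV: "D f y (V y) = p (e, a y *v e)" if y: "y \<in> N" for y
  proof -
    obtain e' where e': "D f y (V y) = p (e', a y *v e')" using graph[OF y] V0[OF y] by blast
    then have "e' = e" using AV[OF y] qp by (simp add: A_def)
    then show ?thesis using e' by simp
  qed
  have V': "(V has_derivative D V z) (at z)" by (rule smooth_on_has_derivative[OF smV N(2)])
  have 1: "((\<lambda>y. D f y (V y)) has_derivative (\<lambda>w. DD f z w (V z) + D f z (D V z w))) (at z)"
    by (rule bracket_field(1)[OF z N V' V0])
  have 2: "((\<lambda>y. D g y (V y)) has_derivative (\<lambda>w. DD g z w (V z) + D g z (D V z w))) (at z)"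
    by (rule has_derivative_apply_linear[OF open_S z linear_Dg _ V'])
      (auto intro: smooth_on_differentiable smooth_on_D smooth_g z)
  have "((\<lambda>y. D g y (V y)) has_derivative (\<lambda>w. 0)) (at z)"
    by (rule has_derivative_transform_within_open[OF has_derivative_const[of 0] N(1,2)]) (simp add: V0)
  from fun_cong[OF has_derivative_unique[OF 2 this], of w]
  have g0: "DD g z w (V z) + D g z (D V z w) = 0" .
  have "linear (\<lambda>m :: real^2^2. p (0, m *v e))"
    by (rule linearI) (simp_all add: linear_add[OF p(1), symmetric] linear_cmul[OF p(1), symmetric]
        matrix_vector_mult_add_rdistrib scaleR_matrix_vector_assoc)
  then have bl: "bounded_linear (\<lambda>m :: real^2^2. p (0, m *v e))" by (simp add: linear_linear)
  have "((\<lambda>y. p (e, 0) + p (0, a y *v e)) has_derivative (\<lambda>w. 0 + p (0, D a z w *v e))) (at z)"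
    by (intro has_derivative_add has_derivative_const bounded_linear.has_derivative[OF bl])
      (use a frechet_derivative_works in blast)
  moreover have "p (e, 0) + p (0, a y *v e) = D f y (V y)" if "y \<in> N" for y
    using fV[OF that] by (simp add: linear_add[OF p(1), symmetric])
  ultimately have "((\<lambda>y. D f y (V y)) has_derivative (\<lambda>w. 0 + p (0, D a z w *v e))) (at z)"
    by (rule has_derivative_transform_within_open[OF _ N(1,2)])
  from fun_cong[OF has_derivative_unique[OF 1 this], of w]
  have f0: "DD f z w (V z) + D f z (D V z w) = p (0, D a z w *v e)" by simp
  show ?thesis
  proof (intro exI[of _ "V z"] conjI allI impI notI)
    show "D g z (V z) = 0" by (rule V0[OF N(2)])
    fix u v' assume u: "DD g z w (V z) + D g z u = 0" "D g z v' = 0" "DD f z w (V z) + D f z u = D f z v'"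
    note lin = linear_diff[OF linear_Dg[OF z]] linear_diff[OF linear_Df[OF z]]
    \<comment> \<open>If the bracket were in \<open>f' (ker g')\<close>, subtraction would show that
      the plane at \<open>z\<close> contains a nonzero vector with first component zero. That plane
      is a graph over the first factor, so this is impossible.\<close>
    let ?x = "v' - (u - D V z w)"
    have "D g z u = D g z (D V z w)" using u(1) g0 by (metis add_left_imp_eq)
    then have "D g z ?x = 0" by (simp add: lin u(2))
    moreover have "D f z ?x = p (0, D a z w *v e)"
      by (simp add: lin u(3)[symmetric] f0[symmetric])
    ultimately have "p (0, D a z w *v e) \<in> range (\<lambda>e. p (e, a z *v e))"
      using graph[OF N(2)] by (metis (mono_tags, lifting) image_eqI mem_Collect_eq)
    then obtain e' where "p (0, D a z w *v e) = p (e', a z *v e')" by blast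
    then have "(0, D a z w *v e) = (e', a z *v e')" using p(2) by (metis bij_is_inj injD)
    then show False using e by auto
  qed
qed

section \<open>Kernels of the two projections and the tangent plane map\<close>

lemma E_curve_immersion:
  assumes C: "smooth_manifold Z" "smooth_curve_family X E Y C Z" and z: "(x, y) \<in> mcarrier Z"
  shows "smooth_manifold (C y)" "x \<in> mcarrier (C y)" "y \<in> mcarrier Y" "smooth_map (C y) X (\<lambda>x. x)"
    "linear (mderiv (C y) X (\<lambda>x. x) x)" "inj (mderiv (C y) X (\<lambda>x. x) x)"
    "plane (tangent_plane X (C y) x) = range (mderiv (C y) X (\<lambda>x. x) x)"
proof -
  have yx: "y \<in> mcarrier Y" "x \<in> mcarrier (C y)" using C z by (auto simp: smooth_curve_family_def)
  then show "x \<in> mcarrier (C y)" "y \<in> mcarrier Y" by auto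
  have "oriented_surface X (C y)" using C yx by (auto simp: smooth_curve_family_def E_curve_def)
  then show m: "smooth_manifold (C y)" "smooth_map (C y) X (\<lambda>x. x)" "inj (mderiv (C y) X (\<lambda>x. x) x)"
    using yx by (auto simp: oriented_surface_def immersion_def)
  show "linear (mderiv (C y) X (\<lambda>x. x) x)" by (rule linear_mderiv[OF m(2) yx(2)])
  then show "plane (tangent_plane X (C y) x) = range (mderiv (C y) X (\<lambda>x. x) x)"
    by (simp add: tangent_plane_def plane_oplane span_image_basis2)
qed

text \<open>The inclusion \<open>\<lambda>x. (x, y)\<close> of a curve into \<open>Z\<close> maps
  into a fiber of \<open>snd\<close>, and followed by \<open>fst\<close> it is the immersion of the
  curve into \<open>X\<close>. Its derivative is therefore injective, and by dimension it fills the
  kernel of the derivative of \<open>snd\<close>.\<close>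

lemma incidence_kernel:
  assumes Z: "smooth_manifold Z" and C: "smooth_curve_family X E Y C Z" and z: "z \<in> mcarrier Z"
  shows "mderiv Z X fst z ` {w. mderiv Z Y snd z w = 0} = plane (snd (tau X C z))"
    and "mderiv Z X fst z w = 0 \<Longrightarrow> mderiv Z Y snd z w = 0 \<Longrightarrow> w = 0"
proof -
  obtain x y where xy: "z = (x, y)" by force
  note c = E_curve_immersion[OF Z C z[unfolded xy]]
  have j: "smooth_map (C y) Z (\<lambda>x. (x, y))" and f: "smooth_map Z X fst" and g: "smooth_map Z Y snd" "surj (mderiv Z Y snd z)"
    using C c(3) z by (auto simp: smooth_curve_family_def submersion_def)
  let ?j = "mderiv (C y) Z (\<lambda>x. (x, y)) x"
  note comp = mderiv_compose[OF c(1) j _ manifold_chart_inj[OF Z] c(2)]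
  have fj: "mderiv Z X fst z (?j v) = mderiv (C y) X (\<lambda>x. x) x v" for v
    using comp[OF f, of v] by (simp add: xy)
  have gj: "mderiv Z Y snd z (?j v) = 0" for v
  proof -
    have "mderiv (C y) Y (\<lambda>x. y) x v = 0"
      by (simp add: mderiv_def differential_def o_def)
    then show ?thesis using comp[OF g(1), of v] by (simp add: xy)
  qed
  have linj: "linear ?j" by (rule linear_mderiv[OF j c(2)])
  have linf: "linear (mderiv Z X fst z)" and ling: "linear (mderiv Z Y snd z)"
    using linear_mderiv[OF f z] linear_mderiv[OF g(1) z] by auto
  have injj: "inj ?j" by (rule injI) (metis fj c(6) injD)
  have ker: "{w. mderiv Z Y snd z w = 0} = range ?j"
    using exact_by_dimension[OF ling g(2) linj injj gj] gj by auto
  have "plane (snd (tau X C z)) = range (mderiv (C y) X (\<lambda>x. x) x)" using c(7) by (simp add: tau_def xy)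
  then show "mderiv Z X fst z ` {w. mderiv Z Y snd z w = 0} = plane (snd (tau X C z))"
    unfolding ker image_image fj by simp
  assume w: "mderiv Z X fst z w = 0" "mderiv Z Y snd z w = 0"
  then obtain v where v: "w = ?j v" using ker by blast
  then have "mderiv (C y) X (\<lambda>x. x) x v = 0" using w(1) fj by simp
  then have "v = 0" using c(5,6) linear_injective_0 by blast
  then show "w = 0" using v linear_0[OF linj] by simp
qed

lemma submanifold_atlas_chart:
  fixes A :: "('a, 'e::euclidean_space) atlas" and \<psi> :: "'a \<Rightarrow> 'd::euclidean_space"
  assumes "(V, \<psi>) \<in> submanifold_atlas A S"
  obtains U \<phi> and i :: "'d \<Rightarrow> 'e" where "V = U \<inter> S" "manifold_chart A (U, \<phi>)" "linear i" "inj i"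
    "\<And>p. p \<in> U \<inter> S \<Longrightarrow> i (\<psi> p) = \<phi> p"
  using assms unfolding submanifold_atlas_def
  by (elim CollectE exE conjE Pair_inject) (rule that, assumption+, simp)

text \<open>In charts \<tau> becomes \<open>R = (\<xi> \<circ> fst, a)\<close>, where
  \<open>a\<close> is the Grassmann coordinate of the tangent plane. It is composed of a local
  diffeomorphism into a slice chart of \<open>E\<close>, the linear inclusion \<open>i\<close> of
  the slice and a transition map \<open>H\<close>, all with injective derivatives, so no nonzero
  vector is killed by both components. Surjectivity holds because \<open>fst\<close> on
  \<open>Z\<close> is \<tau> followed by the submersion of \<open>E\<close> to
  \<open>X\<close>.\<close>

lemma tau_local:
  fixes X :: "('x, real^4) atlas" and Z :: "('x \<times> 'y, real^6) atlas"
  assumes X: "smooth_manifold X" and E: "pseudocomplex_structure X E" and Z: "smooth_manifold Z"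
    and C: "smooth_curve_family X E Y C Z"
    and \<tau>: "local_diffeo Z (submanifold6_atlas X E) (tau X C)"
    and z: "(Uz, \<zeta>) \<in> Z" "z \<in> Uz" and \<xi>: "(Ux, \<xi>) \<in> X" "fst z \<in> Ux"
  obtains N g a where "open N" "\<zeta> z \<in> N" "N \<subseteq> \<zeta> ` Uz" "linear g" "bij g" "a differentiable at (\<zeta> z)"
    "\<And>q. q \<in> N \<Longrightarrow> fst (inv_into Uz \<zeta> q) \<in> Ux \<and>
       map_prod (differential X \<xi> (fst (inv_into Uz \<zeta> q))) (differential X \<xi> (fst (inv_into Uz \<zeta> q))) `
         snd (tau X C (inv_into Uz \<zeta> q)) = gr_graph g (a q)"
    "\<And>w. D (\<xi> \<circ> fst \<circ> inv_into Uz \<zeta>) (\<zeta> z) w = 0 \<Longrightarrow> D a (\<zeta> z) w = 0 \<Longrightarrow> w = 0"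
    "surj (mderiv Z X fst z)"
proof -
  let ?E = "submanifold6_atlas X E" and ?\<tau> = "tau X C"
  obtain x y where xy: "z = (x, y)" by force
  have zZ: "z \<in> mcarrier Z" using z by (force simp: mcarrier_def)
  have f: "smooth_map Z X fst" using C by (simp add: smooth_curve_family_def)
  have injz: "inj_on \<zeta> Uz" by (rule manifold_chart_inj[OF Z z(1)])
  have fst_tau: "fst (?\<tau> z') = fst z'" for z' by (simp add: tau_def split: prod.split)
  define p where "p = ?\<tau> z"
  obtain W W' where W: "openin (mtop Z) W" "z \<in> W" "openin (mtop ?E) W'" "bij_betw ?\<tau> W W'"
    and t: "smooth_map (restrict_atlas Z W) (restrict_atlas ?E W') ?\<tau>"
    and t': "smooth_map (restrict_atlas ?E W') (restrict_atlas Z W) (inv_into W ?\<tau>)"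
    using \<tau> zZ unfolding local_diffeo_def by blast
  have injW: "inj_on ?\<tau> W" using W(4) by (simp add: bij_betw_def)
  have pW': "p \<in> W'" using W by (auto simp: p_def bij_betw_def)
  then have pE: "p \<in> mcarrier ?E" using openin_subset[OF W(3)] unfolding topspace_mtop by (rule rev_subsetD)
  have sub: "submersion ?E X fst" using E by (simp add: pseudocomplex_structure_def)
  obtain Uc where c: "chart_at ?E p = (Uc, coords_at ?E p)" "(Uc, coords_at ?E p) \<in> ?E" "p \<in> Uc"
    using chart_at_cases[OF pE] by metis
  define \<psi> where "\<psi> = coords_at ?E p"
  obtain U and \<phi> :: "'x \<times> oplane \<Rightarrow> V \<times> (real^2^2)" and i where U: "Uc = U \<inter> E" "manifold_chart (gr_bundle X) (U, \<phi>)"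
    and i: "linear i" "inj i" "\<And>p. p \<in> U \<inter> E \<Longrightarrow> i (\<psi> p) = \<phi> p"
    by (rule submanifold_atlas_chart[OF c(2)[folded \<psi>_def]]) blast
  have inj\<phi>: "inj_on \<phi> U" using U(2) by (simp add: manifold_chart_def is_chart_def)
  have inj\<psi>: "inj_on \<psi> Uc" using inj\<phi> i(3) unfolding U(1) inj_on_def by (metis IntD1)
  have rz: "(Uz \<inter> W, \<zeta>) \<in> restrict_atlas Z W" and rc: "(Uc \<inter> W', \<psi>) \<in> restrict_atlas ?E W'"
    using z(1) c(2) by (auto simp: restrict_atlas_def \<psi>_def)
  define Q where "Q = mcarrier (restrict_atlas Z W) \<inter> ?\<tau> -` (Uc \<inter> W')"
  have "openin (mtop (restrict_atlas Z W)) Q"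
    unfolding Q_def by (rule smooth_map_preimage_openin[OF t chart_domain_openin[OF rc]])
  then have Qo: "openin (mtop Z) Q" by (rule openin_restrict_atlas[OF W(1)])
  have "mcarrier (restrict_atlas Z W) \<subseteq> W" by (auto simp: mcarrier_def restrict_atlas_def)
  then have QW: "Q \<subseteq> W" by (auto simp: Q_def)
  have zQ: "z \<in> Q" using rz z W(2) c(3) pW' by (force simp: Q_def mcarrier_def p_def)
  define N1 where "N1 = \<zeta> ` (Uz \<inter> Q)"
  have N1: "open N1" "\<zeta> z \<in> N1" "N1 \<subseteq> \<zeta> ` Uz"
    using chart_image_open[OF Z z(1) Qo] zQ z(2) by (auto simp: N1_def)
  have N1z: "inv_into Uz \<zeta> q \<in> Uz \<inter> Q" "\<zeta> (inv_into Uz \<zeta> q) = q" if "q \<in> N1" for q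
    using that injz by (auto simp: N1_def inv_into_f_f)
  have iz: "inv_into Uz \<zeta> (\<zeta> z) = z" using injz z by (simp add: inv_into_f_f)
  \<comment> \<open>\<tau> in the slice chart \<open>\<psi>\<close> of \<open>E\<close>. The map
    \<open>t2\<close> below is its local inverse, so the derivative of \<open>t1\<close> is
    injective, and bijective as both sides have dimension 6.\<close>
  define t1 where "t1 q = \<psi> (?\<tau> (inv_into Uz \<zeta> q))" for q
  have t1z: "t1 (\<zeta> z) = \<psi> p" by (simp add: t1_def iz p_def)
  have "smooth_on (\<zeta> ` (Uz \<inter> W \<inter> ?\<tau> -` (Uc \<inter> W'))) (\<psi> \<circ> ?\<tau> \<circ> inv_into (Uz \<inter> W) \<zeta>)"
    by (rule smooth_map_charts[OF t rz rc])
  then have "smooth_on N1 (\<psi> \<circ> ?\<tau> \<circ> inv_into (Uz \<inter> W) \<zeta>)"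
    by (rule smooth_on_subset) (use QW in \<open>auto simp: N1_def Q_def\<close>)
  moreover have "(\<psi> \<circ> ?\<tau> \<circ> inv_into (Uz \<inter> W) \<zeta>) q = t1 q" if "q \<in> N1" for q
  proof -
    obtain m where m: "q = \<zeta> m" "m \<in> Uz" "m \<in> Q" using \<open>q \<in> N1\<close> by (auto simp: N1_def)
    have "inv_into (Uz \<inter> W) \<zeta> q = inv_into Uz \<zeta> q"
      unfolding m(1) using m(2) subsetD[OF QW m(3)]
      by (simp add: inv_into_f_f[OF injz] inv_into_f_f[OF inj_on_subset[OF injz Int_lower1]])
    then show ?thesis by (simp add: t1_def)
  qed
  ultimately have smt1: "smooth_on N1 t1" using smooth_on_cong_open[OF N1(1)] by blast
  note dt1 = smooth_on_differentiable[OF smt1 N1(2)]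
  define t2 where "t2 = \<zeta> \<circ> inv_into W ?\<tau> \<circ> inv_into (Uc \<inter> W') \<psi>"
  have inv\<psi>: "inv_into (Uc \<inter> W') \<psi> (\<psi> p') = p'" "inv_into Uc \<psi> (\<psi> p') = p'" if "p' \<in> Uc" "p' \<in> W'" for p'
    using that inj\<psi> by (auto intro!: inv_into_f_f inj_on_subset[OF inj\<psi>])
  have dt2: "t2 differentiable at (\<psi> p)" unfolding t2_def
    by (rule smooth_map_differentiable[OF t' rc rz])
      (use c(3) pW' z(2) W(2) in \<open>simp_all add: p_def inv_into_f_f[OF injW]\<close>)
  have t21: "q = t2 (t1 q)" if "q \<in> N1" for q
    using N1z[OF that] QW inv\<psi> by (auto simp: t2_def t1_def Q_def inv_into_f_f[OF injW])
  have dt21: "D t2 (\<psi> p) (D t1 (\<zeta> z) v) = v" for v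
  proof -
    have "D (\<lambda>q. t2 (t1 q)) (\<zeta> z) = D (\<lambda>q. q) (\<zeta> z)"
      by (rule D_cong_open(2)[OF N1(1,2) t21]) simp_all
    then show ?thesis using D_compose[OF dt1, of t2 v] dt2 t1z by simp
  qed
  have lint1: "linear (D t1 (\<zeta> z))" by (rule D_linear[OF dt1])
  have "inj (D t1 (\<zeta> z))" using dt21 by (metis injI)
  then have bijt1: "bij (D t1 (\<zeta> z))" by (rule linear_inj_imp_bij[OF lint1]) simp
  have surj: "surj (mderiv Z X fst z)"
  proof -
    have xX: "fst z \<in> mcarrier X" using \<xi> by (force simp: mcarrier_def)
    obtain V where V: "(V, coords_at X (fst z)) \<in> X" "fst z \<in> V" using chart_at_cases[OF xX] by metis
    let ?k = "coords_at X (fst z)"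
    define F where "F = ?k \<circ> fst \<circ> inv_into Uc \<psi>"
    have fsm: "smooth_map ?E X fst" using sub by (simp add: submersion_def)
    have fp: "fst p = fst z" by (simp add: p_def fst_tau)
    have dF: "F differentiable at (\<psi> p)" unfolding F_def \<psi>_def
      by (rule smooth_map_differentiable[OF fsm c(2) V(1) c(3)]) (simp add: fp V)
    have "surj (mderiv ?E X fst p)" using sub pE by (simp add: submersion_def)
    then have sF: "surj (D F (\<psi> p))"
      unfolding mderiv_eq[OF c(1)] by (simp add: F_def \<psi>_def fp)
    have eq: "F (t1 q) = (?k \<circ> fst \<circ> inv_into Uz \<zeta>) q" if "q \<in> N1" for q
      using N1z[OF that] inv\<psi>(2) by (auto simp: F_def t1_def Q_def fst_tau)
    have "(\<lambda>q. F (t1 q)) differentiable at (\<zeta> z)"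
      using differentiable_chain_at[OF dt1, of F] dF t1z by (simp add: o_def)
    note D' = D_cong_open[OF N1(1,2) eq this]
    have "mderiv Z X fst z w = D F (\<psi> p) (D t1 (\<zeta> z) (differential Z \<zeta> z w))" for w
      using differential_chain[OF Z z, of "?k \<circ> fst" w] D' D_compose[OF dt1, of F] dF t1z
      by (simp add: mderiv_def)
    then have "mderiv Z X fst z = D F (\<psi> p) \<circ> D t1 (\<zeta> z) \<circ> differential Z \<zeta> z" by auto
    moreover have "surj (D F (\<psi> p) \<circ> D t1 (\<zeta> z) \<circ> differential Z \<zeta> z)"
      by (intro comp_surj sF bij_is_surj[OF bijt1] bij_is_surj[OF differential_chart(2)[OF Z z]])
    ultimately show ?thesis by (simp only:)
  qed
  define L where "L x' = differential X \<xi> x'" for x'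
  have L: "linear (L x')" "bij (L x')" if "x' \<in> Ux" for x'
    using differential_chart[OF X \<xi>(1) that] by (auto simp: L_def)
  have Lx: "linear (L x)" "inj (L x)" using L[of x] \<xi>(2) by (auto simp: xy bij_is_inj)
  note cu = E_curve_immersion[OF Z C zZ[unfolded xy]]
  let ?\<iota> = "mderiv (C y) X (\<lambda>x. x) x"
  have "linear (\<lambda>e. L x (?\<iota> e))" "inj (\<lambda>e. L x (?\<iota> e))"
    using linear_compose[OF cu(5) Lx(1)] inj_compose[OF Lx(2) cu(6)] by (simp_all add: o_def)
  \<comment> \<open>The Grassmann chart is centred at the tangent plane at \<open>z\<close>, whose
    coordinate is the zero matrix; this puts \<open>p\<close> into its domain.\<close>
  from extend_to_isomorphism[OF this]
  obtain g :: "(real^2) \<times> (real^2) \<Rightarrow> V" where g: "linear g" "bij g" "\<And>e. g (e, 0) = L x (?\<iota> e)" by blast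
  define Dom where "Dom = {(x', P). x' \<in> Ux \<and> map_prod (L x') (L x') ` P \<in> range (gr_graph g)}"
  define \<Phi> where "\<Phi> = (\<lambda>(x', P). (\<xi> x', inv (gr_graph g) (map_prod (L x') (L x') ` P)))"
  have \<Phi>: "(Dom, \<Phi>) \<in> gr_bundle X"
    unfolding gr_bundle_def Dom_def \<Phi>_def L_def using \<xi>(1) g(1,2) by blast
  have "map_prod (L x) (L x) ` snd p = gr_graph g 0"
    by (simp add: p_def xy tau_def tangent_plane_def map_prod_oplane[OF Lx(1)] gr_graph_def g(3))
  then have pDom: "p \<in> Dom" using \<xi>(2) by (simp add: Dom_def p_def xy tau_def)
  have inj\<Phi>: "inj_on \<Phi> Dom"
  proof (rule inj_onI)
    fix r s assume r: "r \<in> Dom" and s: "s \<in> Dom" and eq: "\<Phi> r = \<Phi> s"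
    obtain x1 P1 x2 P2 where rs: "r = (x1, P1)" "s = (x2, P2)" by force
    have "\<xi> x1 = \<xi> x2" using eq by (simp add: rs \<Phi>_def)
    then have x: "x1 = x2" using manifold_chart_inj[OF X \<xi>(1)] r s by (auto simp: rs Dom_def inj_on_def)
    have "map_prod (L x1) (L x1) ` P1 = map_prod (L x1) (L x1) ` P2"
    proof (rule inv_into_injective)
      show "inv (gr_graph g) (map_prod (L x1) (L x1) ` P1) = inv (gr_graph g) (map_prod (L x1) (L x1) ` P2)"
        using eq by (simp add: rs \<Phi>_def x)
    qed (use r s in \<open>simp_all add: rs Dom_def x\<close>)
    moreover have "inj (map_prod (L x1) (L x1))"
      using L(2)[of x1] r by (simp add: rs Dom_def bij_is_inj prod.inj_map)
    ultimately show "r = s" using x by (simp add: rs inj_image_eq_iff)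
  qed
  \<comment> \<open>Being a \<open>manifold_chart\<close>, the slice chart \<open>\<phi>\<close> has
    smooth transitions in both directions to the bundle chart \<open>\<Phi>\<close>; the reverse
    one, \<open>H'\<close>, shows that the derivative of \<open>H\<close> is injective.\<close>
  have comp: "smoothly_compatible (U, \<phi>) (Dom, \<Phi>)" using U(2) \<Phi> by (simp add: manifold_chart_def)
  define O1 where "O1 = \<phi> ` (U \<inter> Dom)"
  have O1: "open O1" and smH: "smooth_on O1 (\<Phi> \<circ> inv_into U \<phi>)"
    and smH': "smooth_on (\<Phi> ` (U \<inter> Dom)) (\<phi> \<circ> inv_into Dom \<Phi>)"
    using comp by (auto simp: smoothly_compatible_def O1_def)
  define H where "H = \<Phi> \<circ> inv_into U \<phi>"
  define H' where "H' = \<phi> \<circ> inv_into Dom \<Phi>"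
  have pU: "p \<in> U" using c(3) U(1) by blast
  have p1: "\<phi> p \<in> O1" using pU pDom by (simp add: O1_def)
  have Hp: "H (\<phi> p) = \<Phi> p" using pU inj\<phi> by (simp add: H_def inv_into_f_f)
  have dH: "H differentiable at (\<phi> p)" unfolding H_def by (rule smooth_on_differentiable[OF smH p1])
  have dH': "H' differentiable at (H (\<phi> p))" unfolding H'_def Hp
    by (rule smooth_on_differentiable[OF smH']) (use pU pDom in blast)
  have HH: "q = H' (H q)" if "q \<in> O1" for q
    using that inj\<phi> inj\<Phi> by (auto simp: O1_def H_def H'_def inv_into_f_f)
  have dHH: "D H' (H (\<phi> p)) (D H (\<phi> p) v) = v" for v
  proof -
    have "D (\<lambda>q. H' (H q)) (\<phi> p) = D (\<lambda>q. q) (\<phi> p)"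
      by (rule D_cong_open(2)[OF O1 p1 HH]) simp_all
    then show ?thesis using D_compose[OF dH dH', of v] by simp
  qed
  have it: "i (t1 q) = \<phi> (?\<tau> (inv_into Uz \<zeta> q))" "?\<tau> (inv_into Uz \<zeta> q) \<in> U" if "q \<in> N1" for q
    using N1z[OF that] U(1) i(3) by (auto simp: t1_def Q_def)
  define N where "N = N1 \<inter> (\<lambda>q. i (t1 q)) -` O1"
  have smit: "smooth_on N1 (\<lambda>q. i (t1 q))" by (rule smooth_on_linear_compose[OF N1(1) i(1) smt1])
  have N: "open N" unfolding N_def
    by (rule continuous_open_preimage[OF smooth_on_continuous[OF smit] N1(1) O1])
  have it0: "i (t1 (\<zeta> z)) = \<phi> p" using it(1)[OF N1(2)] by (simp add: iz p_def)
  have zN: "\<zeta> z \<in> N" using N1(2) it0 p1 by (simp add: N_def)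
  have NDom: "?\<tau> (inv_into Uz \<zeta> q) \<in> Dom" if "q \<in> N" for q
  proof -
    have "\<phi> (?\<tau> (inv_into Uz \<zeta> q)) \<in> \<phi> ` (U \<inter> Dom)" "?\<tau> (inv_into Uz \<zeta> q) \<in> U"
      using that it[of q] by (auto simp: N_def O1_def)
    then show ?thesis using inj\<phi> by (auto simp: inj_on_def)
  qed
  define R where "R q = \<Phi> (?\<tau> (inv_into Uz \<zeta> q))" for q
  define a where "a q = snd (R q)" for q
  have eqR: "H (i (t1 q)) = R q" if "q \<in> N" for q
    using that it[of q] inj\<phi> by (auto simp: N_def H_def R_def inv_into_f_f)
  have dit: "(\<lambda>q. i (t1 q)) differentiable at (\<zeta> z)" by (rule smooth_on_differentiable[OF smit N1(2)])
  have "(\<lambda>q. H (i (t1 q))) differentiable at (\<zeta> z)"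
    using differentiable_chain_at[OF dit, of H] dH it0 by (simp add: o_def)
  note R' = D_cong_open[OF N zN eqR this]
  have DR: "D R (\<zeta> z) w = D H (\<phi> p) (i (D t1 (\<zeta> z) w))" for w
  proof -
    have "D (\<lambda>q. i (t1 q)) (\<zeta> z) w = i (D t1 (\<zeta> z) w)"
      using D_compose[OF dt1, of i w] linear_imp_differentiable[OF i(1)] by (simp add: D_linear_map[OF i(1)])
    then show ?thesis using R'(2) D_compose[OF dit, of H w] dH it0 by simp
  qed
  have DR0: "w = 0" if "D R (\<zeta> z) w = 0" for w
  proof -
    have "i (D t1 (\<zeta> z) w) = 0"
      using that DR[of w] dHH[of "i (D t1 (\<zeta> z) w)"] linear_0[OF D_linear[OF dH']] by simp
    then have "D t1 (\<zeta> z) w = 0" using i linear_injective_0 by blast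
    then show "w = 0" using dt21[of w] linear_0[OF D_linear[OF dt2]] by simp
  qed
  have da: "a differentiable at (\<zeta> z)" and dF: "(\<lambda>q. fst (R q)) differentiable at (\<zeta> z)"
    using R'(1) unfolding a_def differentiable_def by (blast intro: has_derivative_snd has_derivative_fst)+
  have Fst: "fst (R q) = (\<xi> \<circ> fst \<circ> inv_into Uz \<zeta>) q" if "q \<in> N" for q
    by (simp add: R_def \<Phi>_def fst_tau split: prod.split) (metis fst_tau fst_conv)
  have DF: "D (\<xi> \<circ> fst \<circ> inv_into Uz \<zeta>) (\<zeta> z) = D (\<lambda>q. fst (R q)) (\<zeta> z)"
    by (rule D_cong_open(2)[OF N zN Fst dF])
  have DRp: "D R (\<zeta> z) w = (D (\<lambda>q. fst (R q)) (\<zeta> z) w, D a (\<zeta> z) w)" for w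
    using D_Pair[OF dF da, of w] by (simp add: a_def)
  show thesis
  proof (rule that[OF N zN _ g(1,2) da _ _ surj])
    show "N \<subseteq> \<zeta> ` Uz" using N1(3) by (auto simp: N_def)
    show "w = 0" if "D (\<xi> \<circ> fst \<circ> inv_into Uz \<zeta>) (\<zeta> z) w = 0" "D a (\<zeta> z) w = 0" for w
      by (rule DR0) (use that in \<open>simp add: DRp DF zero_prod_def\<close>)
    fix q assume q: "q \<in> N"
    obtain x' P where t: "?\<tau> (inv_into Uz \<zeta> q) = (x', P)" by force
    then have x': "fst (inv_into Uz \<zeta> q) = x'" using fst_tau by (metis fst_conv)
    have "x' \<in> Ux" "map_prod (L x') (L x') ` P \<in> range (gr_graph g)" using NDom[OF q] by (auto simp: t Dom_def)
    then show "fst (inv_into Uz \<zeta> q) \<in> Ux \<and>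
       map_prod (differential X \<xi> (fst (inv_into Uz \<zeta> q))) (differential X \<xi> (fst (inv_into Uz \<zeta> q))) `
         snd (?\<tau> (inv_into Uz \<zeta> q)) = gr_graph g (a q)"
      by (simp add: x' t a_def R_def \<Phi>_def L_def f_inv_into_f)
  qed
qed

subsection \<open>Almost complex structures in charts\<close>

text \<open>The push-forward of \<open>J\<close> to coordinates, shaped so that its smoothness is
  literally the last clause of \<open>almost_complex_on\<close>.\<close>

definition in_chart :: "('a, V) atlas \<Rightarrow> ('a, V) chart \<Rightarrow> ('a \<Rightarrow> V \<Rightarrow> V) \<Rightarrow> V \<Rightarrow> V \<Rightarrow> V" where
  "in_chart M c J q v = (let x = inv_into (fst c) (snd c) q; L = differential M (snd c) x in L (J x (inv L v)))"

lemma in_chart_apply: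
  assumes M: "smooth_manifold M" "(U, \<xi>) \<in> M" "p \<in> U"
  shows "in_chart M (U, \<xi>) J (\<xi> p) (differential M \<xi> p v) = differential M \<xi> p (J p v)"
  using manifold_chart_inj[OF M(1,2)] M(3) differential_chart(2)[OF M]
  by (simp add: in_chart_def Let_def inv_into_f_f bij_is_inj)

lemma in_chart_almost_complex:
  assumes M: "smooth_manifold M" "(Ux, \<xi>) \<in> M" and J: "almost_complex_on M U J" and p: "p \<in> Ux" "p \<in> U"
  shows "linear (in_chart M (Ux, \<xi>) J (\<xi> p))"
    and "in_chart M (Ux, \<xi>) J (\<xi> p) (in_chart M (Ux, \<xi>) J (\<xi> p) v) = - v"
    and "(\<lambda>q. in_chart M (Ux, \<xi>) J q v) differentiable at (\<xi> p)"
proof -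
  let ?L = "differential M \<xi> p"
  note L = differential_chart[OF M p(1)]
  have ip: "inv_into Ux \<xi> (\<xi> p) = p" using manifold_chart_inj[OF M] p by (simp add: inv_into_f_f)
  have Jp: "linear (J p)" "J p (J p v) = - v" for v using J p by (auto simp: almost_complex_on_def)
  have e: "in_chart M (Ux, \<xi>) J (\<xi> p) = ?L \<circ> (J p \<circ> inv ?L)" by (rule ext) (simp add: in_chart_def Let_def ip)
  show "linear (in_chart M (Ux, \<xi>) J (\<xi> p))"
    unfolding e by (intro linear_compose linear_inv_bij L Jp)
  show "in_chart M (Ux, \<xi>) J (\<xi> p) (in_chart M (Ux, \<xi>) J (\<xi> p) v) = - v"
    using L by (simp add: e Jp bij_is_inj linear_neg bij_is_surj surj_f_inv_f)
  have "smooth_on (\<xi> ` (U \<inter> Ux)) (\<lambda>q. in_chart M (Ux, \<xi>) J q v)"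
    using J M(2) unfolding almost_complex_on_def in_chart_def by (auto simp: Let_def)
  then show "(\<lambda>q. in_chart M (Ux, \<xi>) J q v) differentiable at (\<xi> p)"
    by (rule smooth_on_differentiable) (use p in blast)
qed

text \<open>The new chart is \<open>\<kappa> = \<psi> \<circ> \<xi>\<close>. Its transition maps to
  the charts of \<open>M\<close> factor through \<open>\<xi>\<close>, with \<open>\<phi>\<close> in
  one direction and \<open>\<psi>\<close> in the other, and the chain rule turns holomorphy of
  \<open>\<psi>\<close> for the transported structure into the required condition for
  \<open>J\<close>.\<close>

lemma integrable_near:
  fixes M :: "('a, V) atlas" and \<psi> :: "V \<Rightarrow> complex^2"
  assumes M: "smooth_manifold M" and J: "almost_complex_on M U J" and c: "(Ux, \<xi>) \<in> M"
    and B: "open B" "B \<subseteq> \<xi> ` (Ux \<inter> U)" and V: "open V" and hom: "homeomorphism B V \<psi> \<phi>"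
    and sm: "smooth_on B \<psi>" "smooth_on V \<phi>"
    and hol: "\<And>x v. x \<in> B \<Longrightarrow> D \<psi> x (in_chart M (Ux, \<xi>) J x v) = \<i> *s D \<psi> x v"
  defines "W \<equiv> Ux \<inter> \<xi> -` B"
  shows "openin (mtop M) W" "W \<subseteq> U" "almost_complex_on M W J" "integrable_on_set M W J"
proof -
  have inj\<xi>: "inj_on \<xi> Ux" by (rule manifold_chart_inj[OF M c])
  show W: "openin (mtop M) W" unfolding W_def by (rule chart_preimage_openin[OF c B(1)])
  show WU: "W \<subseteq> U"
  proof
    fix p assume "p \<in> W"
    then have "p \<in> Ux" "\<xi> p \<in> \<xi> ` (Ux \<inter> U)" using B(2) by (auto simp: W_def)
    then show "p \<in> U" using inj\<xi> by (auto simp: inj_on_def)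
  qed
  show "almost_complex_on M W J" unfolding almost_complex_on_def
  proof (intro conjI ballI W)
    show "linear (J x)" "\<forall>v. J x (J x v) = - v" if "x \<in> W" for x
      using J WU that by (auto simp: almost_complex_on_def)
    fix c' assume c': "c' \<in> M"
    obtain W' \<phi>' where cc: "c' = (W', \<phi>')" by force
    show "case c' of (W', \<phi>) \<Rightarrow> \<forall>v. smooth_on (\<phi> ` (W \<inter> W'))
        (\<lambda>q. let x = inv_into W' \<phi> q; D = differential M \<phi> x in D (J x (inv D v)))"
      unfolding cc prod.case
    proof
      fix v
      have "smooth_on (\<phi>' ` (U \<inter> W')) (\<lambda>q. let x = inv_into W' \<phi>' q; D = differential M \<phi>' x in D (J x (inv D v)))"
        using J c' unfolding almost_complex_on_def cc by blast
      then show "smooth_on (\<phi>' ` (W \<inter> W')) (\<lambda>q. let x = inv_into W' \<phi>' q; D = differential M \<phi>' x in D (J x (inv D v)))"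
        by (rule smooth_on_subset) (use WU in blast)
    qed
  qed
  define \<kappa> where "\<kappa> p = \<psi> (\<xi> p)" for p
  have \<xi>W: "\<xi> ` W = B" using B(2) by (auto simp: W_def)
  have inj\<psi>: "inj_on \<psi> B" using homeomorphism_apply1[OF hom] by (metis inj_onI)
  have inj\<kappa>: "inj_on \<kappa> W" using inj\<xi> inj\<psi> by (auto simp: inj_on_def \<kappa>_def W_def)
  have \<kappa>W: "\<kappa> ` W = V" using homeomorphism_image1[OF hom] by (auto simp: \<kappa>_def \<xi>W[symmetric] image_image)
  have \<psi>open: "open (\<psi> ` G)" if "open G" "G \<subseteq> B" for G
  proof -
    have "\<psi> ` G = V \<inter> \<phi> -` G"
      using that(2) homeomorphism_image1[OF hom] homeomorphism_apply1[OF hom] homeomorphism_apply2[OF hom] by force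
    then show ?thesis using continuous_open_preimage[OF smooth_on_continuous[OF sm(2)] V that(1)] by simp
  qed
  have "smoothly_compatible (W, \<kappa>) d" if d: "d \<in> M" for d
  proof -
    obtain U2 \<theta> where d2: "d = (U2, \<theta>)" "(U2, \<theta>) \<in> M" using d by (metis prod.collapse)
    have inj\<theta>: "inj_on \<theta> U2" by (rule manifold_chart_inj[OF M d2(2)])
    note t = transition_smooth[OF M c d2(2)] and t' = transition_smooth[OF M d2(2) c]
    define G where "G = \<xi> ` (Ux \<inter> (W \<inter> U2))"
    have G: "open G" "G \<subseteq> B" "G \<subseteq> \<xi> ` (Ux \<inter> U2)" "\<xi> ` (W \<inter> U2) = G"
      using chart_image_open[OF M c openin_Int[OF W chart_domain_openin[OF d2(2)]]] by (auto simp: G_def W_def)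
    have \<kappa>G: "\<kappa> ` (W \<inter> U2) = \<psi> ` G" by (simp add: \<kappa>_def[abs_def] image_image G(4)[symmetric])
    have o1: "open (\<kappa> ` (W \<inter> U2))" unfolding \<kappa>G by (rule \<psi>open[OF G(1,2)])
    have o2: "open (\<theta> ` (W \<inter> U2))"
      using chart_image_open[OF M d2(2) W] by (simp add: Int_commute)
    have s1: "smooth_on (\<kappa> ` (W \<inter> U2)) (\<theta> \<circ> inv_into W \<kappa>)"
    proof (rule smooth_on_cong_open[OF o1])
      show "smooth_on (\<kappa> ` (W \<inter> U2)) (\<lambda>q. (\<theta> \<circ> inv_into Ux \<xi>) (\<phi> q))"
      proof (rule smooth_on_compose[OF o1 G(1), where f = \<phi> and g = "\<theta> \<circ> inv_into Ux \<xi>"])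
        show "\<phi> ` \<kappa> ` (W \<inter> U2) \<subseteq> G" unfolding \<kappa>G using G(2) homeomorphism_apply1[OF hom] by force
        show "smooth_on (\<kappa> ` (W \<inter> U2)) \<phi>" by (rule smooth_on_subset[OF sm(2)]) (use \<kappa>W in blast)
        show "smooth_on G (\<theta> \<circ> inv_into Ux \<xi>)" by (rule smooth_on_subset[OF t(2) G(3)])
      qed
      fix q assume "q \<in> \<kappa> ` (W \<inter> U2)"
      then obtain p where p: "p \<in> W" "q = \<kappa> p" by blast
      then show "(\<theta> \<circ> inv_into Ux \<xi>) (\<phi> q) = (\<theta> \<circ> inv_into W \<kappa>) q"
        using inv_into_f_f[OF inj\<kappa> p(1)] homeomorphism_apply1[OF hom, of "\<xi> p"] inv_into_f_f[OF inj\<xi>, of p]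
        by (simp add: W_def \<kappa>_def)
    qed
    have s2: "smooth_on (\<theta> ` (W \<inter> U2)) (\<kappa> \<circ> inv_into U2 \<theta>)"
    proof (rule smooth_on_cong_open[OF o2])
      show "smooth_on (\<theta> ` (W \<inter> U2)) (\<lambda>q. \<psi> ((\<xi> \<circ> inv_into U2 \<theta>) q))"
      proof (rule smooth_on_compose[OF o2 B(1), where f = "\<xi> \<circ> inv_into U2 \<theta>" and g = \<psi>])
        show "(\<xi> \<circ> inv_into U2 \<theta>) ` \<theta> ` (W \<inter> U2) \<subseteq> B"
          using inv_into_f_f[OF inj\<theta>] by (auto simp: W_def)
        show "smooth_on (\<theta> ` (W \<inter> U2)) (\<xi> \<circ> inv_into U2 \<theta>)"
          by (rule smooth_on_subset[OF t'(2)]) (auto simp: W_def)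
      qed (rule sm)
    qed (simp add: \<kappa>_def)
    show ?thesis
      using o1 o2 s1 s2 by (simp add: d2 smoothly_compatible_def Int_commute)
  qed
  moreover have "W \<subseteq> mcarrier M" using openin_subset[OF W] by (simp add: topspace_mtop)
  ultimately have chart: "manifold_chart M (W, \<kappa>)"
    using inj\<kappa> \<kappa>W V by (simp add: manifold_chart_def is_chart_def)
  have "differential M \<kappa> p (J p v) = \<i> *s differential M \<kappa> p v" if p: "p \<in> W" for p v
  proof -
    have pU: "p \<in> Ux" "\<xi> p \<in> B" using p by (auto simp: W_def)
    have eq: "\<psi> q = (\<kappa> \<circ> inv_into Ux \<xi>) q" if "q \<in> B" for q
      using that B(2) inj\<xi> by (auto simp: \<kappa>_def inv_into_f_f)
    note D' = D_cong_open[OF B(1) pU(2) eq smooth_on_differentiable[OF sm(1) pU(2)]]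
    have "differential M \<kappa> p u = D \<psi> (\<xi> p) (differential M \<xi> p u)" for u
      using differential_chain[OF M c pU(1) D'(1)] D'(2) by simp
    then show ?thesis using hol[OF pU(2)] in_chart_apply[OF M c pU(1), of J v] by metis
  qed
  then show "integrable_on_set M W J" unfolding integrable_on_set_def using chart by blast
qed

text \<open>Passing to \<open>U'\<close> keeps the lines whose base point lies in \<open>U'\<close>,
  both in the image of \<open>F\<close> and among all complex lines, so the same ambient open set
  \<open>T\<close> witnesses relative openness.\<close>

lemma open_set_of_complex_lines_restrict:
  assumes F: "open_set_of_complex_lines M U J (F ` W)" and \<pi>: "\<And>z. fst (F z) = \<pi> z" and "U' \<subseteq> U"
  shows "open_set_of_complex_lines M U' J (F ` (W \<inter> \<pi> -` U'))"
proof -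
  obtain T where T: "openin (mtop (gr_bundle M)) T" "F ` W = T \<inter> complex_lines U J"
    using F unfolding open_set_of_complex_lines_def openin_subtopology by blast
  have "F ` (W \<inter> \<pi> -` U') = F ` W \<inter> {p. fst p \<in> U'}" using \<pi> by force
  also have "\<dots> = T \<inter> complex_lines U' J"
    using \<open>U' \<subseteq> U\<close> unfolding T(2) complex_lines_def by auto
  finally show ?thesis unfolding open_set_of_complex_lines_def openin_subtopology using T(1) by blast
qed

text \<open>One half of the conditions of \<open>double_prefibration\<close>, formulated for
  arbitrary maps \<open>f\<close>, \<open>g\<close> so that it applies twice, with the roles of the
  two target manifolds exchanged.\<close>

lemma half_fibration_in_charts:
  assumes Z: "smooth_manifold Z" and M: "smooth_manifold M" and N: "smooth_manifold N"
    and f: "smooth_map Z M f" and g: "smooth_map Z N g"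
    and z: "(Uz, \<zeta>) \<in> Z" "p \<in> Uz" and x: "(Ux, \<xi>) \<in> M" "f p \<in> Ux" and y: "(Uy, \<eta>) \<in> N" "g p \<in> Uy"
    and J: "almost_complex_on M U J" "f p \<in> U" and surj: "surj (mderiv Z M f p)"
    and inv: "\<And>v. mderiv Z N g p v = 0 \<Longrightarrow>
       \<exists>v'. mderiv Z N g p v' = 0 \<and> mderiv Z M f p v' = J (f p) (mderiv Z M f p v)"
  defines "F \<equiv> \<xi> \<circ> f \<circ> inv_into Uz \<zeta>" and "G \<equiv> \<eta> \<circ> g \<circ> inv_into Uz \<zeta>" and "K \<equiv> in_chart M (Ux, \<xi>) J"
  shows "surj (D F (\<zeta> p))" "linear (K (F (\<zeta> p)))" "K (F (\<zeta> p)) (K (F (\<zeta> p)) u) = - u"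
    "(\<lambda>q. K q u) differentiable at (F (\<zeta> p))"
    "D G (\<zeta> p) v = 0 \<Longrightarrow> \<exists>v'. D G (\<zeta> p) v' = 0 \<and> D F (\<zeta> p) v' = K (F (\<zeta> p)) (D F (\<zeta> p) v)"
proof -
  have Fq: "F (\<zeta> p) = \<xi> (f p)"
    using manifold_chart_inj[OF Z z(1)] z(2) by (simp add: F_def inv_into_f_f)
  note F' = mderiv_charts[OF Z M f z x, folded F_def] and G' = mderiv_charts[OF Z N g z y, folded G_def]
  note dx = differential_chart[OF M x] and dy = differential_chart[OF N y] and dz = differential_chart(2)[OF Z z]
  show "surj (D F (\<zeta> p))"
  proof (rule surjI)
    fix v
    show "D F (\<zeta> p) (differential Z \<zeta> p (Hilbert_Choice.inv (mderiv Z M f p) (Hilbert_Choice.inv (differential M \<xi> (f p)) v))) = v"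
      unfolding F' using surj dx(2) by (simp add: bij_is_surj surj_f_inv_f)
  qed
  show "linear (K (F (\<zeta> p)))" "K (F (\<zeta> p)) (K (F (\<zeta> p)) u) = - u" "(\<lambda>q. K q u) differentiable at (F (\<zeta> p))"
    unfolding Fq K_def using in_chart_almost_complex[OF M x(1) J(1) x(2) J(2)] by auto
  assume "D G (\<zeta> p) v = 0"
  moreover obtain w where v: "v = differential Z \<zeta> p w" using dz by (metis bij_is_surj surjD)
  ultimately have "mderiv Z N g p w = 0" using G' dy by (metis bij_is_inj linear_injective_0)
  then obtain w' where w': "mderiv Z N g p w' = 0" "mderiv Z M f p w' = J (f p) (mderiv Z M f p w)"
    using inv by blast
  show "\<exists>v'. D G (\<zeta> p) v' = 0 \<and> D F (\<zeta> p) v' = K (F (\<zeta> p)) (D F (\<zeta> p) v)"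
  proof (intro exI conjI)
    show "D G (\<zeta> p) (differential Z \<zeta> p w') = 0" by (simp only: G' w'(1) linear_0[OF dy(1)])
    show "D F (\<zeta> p) (differential Z \<zeta> p w') = K (F (\<zeta> p)) (D F (\<zeta> p) v)"
      by (simp only: v F' Fq w'(2) K_def in_chart_apply[OF M x])
  qed
qed

lemma double_prefibration_in_charts:
  assumes Z: "smooth_manifold Z" and X: "smooth_manifold X" and Y: "smooth_manifold Y"
    and f: "smooth_map Z X f" and g: "smooth_map Z Y g"
    and z: "(Uz, \<zeta>) \<in> Z" and x: "(Ux, \<xi>) \<in> X" and y: "(Uy, \<eta>) \<in> Y"
    and JX: "almost_complex_on X UX J" and JY: "almost_complex_on Y UY J'"
    and \<Omega>: "openin (mtop Z) \<Omega>" "\<Omega> \<subseteq> Uz" "f ` \<Omega> \<subseteq> Ux \<inter> UX" "g ` \<Omega> \<subseteq> Uy \<inter> UY"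
    and surj: "\<And>z. z \<in> \<Omega> \<Longrightarrow> surj (mderiv Z X f z)" "\<And>z. z \<in> \<Omega> \<Longrightarrow> surj (mderiv Z Y g z)"
    and ker: "\<And>z w. z \<in> \<Omega> \<Longrightarrow> mderiv Z X f z w = 0 \<Longrightarrow> mderiv Z Y g z w = 0 \<Longrightarrow> w = 0"
    and inv: "\<And>z v. z \<in> \<Omega> \<Longrightarrow> mderiv Z Y g z v = 0 \<Longrightarrow>
       \<exists>v'. mderiv Z Y g z v' = 0 \<and> mderiv Z X f z v' = J (f z) (mderiv Z X f z v)"
      "\<And>z v. z \<in> \<Omega> \<Longrightarrow> mderiv Z X f z v = 0 \<Longrightarrow>
       \<exists>v'. mderiv Z X f z v' = 0 \<and> mderiv Z Y g z v' = J' (g z) (mderiv Z Y g z v)"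
  shows "double_prefibration (\<zeta> ` \<Omega>) (\<xi> \<circ> f \<circ> inv_into Uz \<zeta>) (\<eta> \<circ> g \<circ> inv_into Uz \<zeta>)
    (in_chart X (Ux, \<xi>) J) (in_chart Y (Uy, \<eta>) J')"
proof (rule double_prefibration.intro)
  let ?F = "\<xi> \<circ> f \<circ> inv_into Uz \<zeta>" and ?G = "\<eta> \<circ> g \<circ> inv_into Uz \<zeta>"
  show "open (\<zeta> ` \<Omega>)"
    using chart_image_open[OF Z z \<Omega>(1)] \<Omega>(2) by (simp add: Int_absorb1)
  show "smooth_on (\<zeta> ` \<Omega>) ?F" "smooth_on (\<zeta> ` \<Omega>) ?G"
    by (rule smooth_on_subset[OF smooth_map_charts[OF f z x]], use \<Omega> in blast)
      (rule smooth_on_subset[OF smooth_map_charts[OF g z y]], use \<Omega> in blast)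
  fix q assume "q \<in> \<zeta> ` \<Omega>"
  then obtain p where p: "p \<in> \<Omega>" "q = \<zeta> p" by blast
  have P: "p \<in> Uz" "f p \<in> Ux" "f p \<in> UX" "g p \<in> Uy" "g p \<in> UY" using p(1) \<Omega> by auto
  note hX = half_fibration_in_charts[OF Z X Y f g z P(1) x P(2) y P(4) JX P(3) surj(1)[OF p(1)] inv(1)[OF p(1)], folded p(2)]
    and hY = half_fibration_in_charts[OF Z Y X g f z P(1) y P(4) x P(2) JY P(5) surj(2)[OF p(1)] inv(2)[OF p(1)], folded p(2)]
  show "surj (D ?F q)" "linear (in_chart X (Ux, \<xi>) J (?F q))"
    "surj (D ?G q)" "linear (in_chart Y (Uy, \<eta>) J' (?G q))" by (use hX(1,2) hY(1,2) in blast)+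
  show "in_chart X (Ux, \<xi>) J (?F q) (in_chart X (Ux, \<xi>) J (?F q) u) = - u"
    "(\<lambda>p. in_chart X (Ux, \<xi>) J p u) differentiable at (?F q)"
    "in_chart Y (Uy, \<eta>) J' (?G q) (in_chart Y (Uy, \<eta>) J' (?G q) u) = - u"
    "(\<lambda>p. in_chart Y (Uy, \<eta>) J' p u) differentiable at (?G q)" for u
    by (use hX(3,4) hY(3,4) in blast)+
  fix v
  show "D ?G q v = 0 \<Longrightarrow> \<exists>v'. D ?G q v' = 0 \<and> D ?F q v' = in_chart X (Ux, \<xi>) J (?F q) (D ?F q v)" by (rule hX(5))
  show "D ?F q v = 0 \<Longrightarrow> \<exists>v'. D ?F q v' = 0 \<and> D ?G q v' = in_chart Y (Uy, \<eta>) J' (?G q) (D ?G q v)" by (rule hY(5))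
  show "v = 0" if "D ?F q v = 0" "D ?G q v = 0"
  proof -
    note dz = differential_chart[OF Z z P(1)] and dx = differential_chart[OF X x P(2)] and dy = differential_chart[OF Y y P(4)]
    obtain w where v: "v = differential Z \<zeta> p w" using dz(2) by (metis bij_is_surj surjD)
    have "mderiv Z X f p w = 0" "mderiv Z Y g p w = 0"
      using that mderiv_charts[OF Z X f z P(1) x P(2), of w] mderiv_charts[OF Z Y g z P(1) y P(4), of w] dx dy
      unfolding p(2) v by (metis bij_is_inj linear_injective_0)+
    then show "v = 0" using ker[OF p(1)] linear_0[OF dz(1)] v by blast
  qed
qed

text \<open>The statement refers to a single projection \<open>\<pi>\<close>, so it covers
  \<open>X\<close> with \<open>fst\<close> and, through the exchanged fibration, \<open>Y\<close>
  with \<open>snd\<close>. The domain of \<open>J\<close> shrinks to that of the holomorphic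
  coordinates, and \<open>W\<close> shrinks to the part lying over it.\<close>

lemma integrable_structure_at:
  fixes M :: "('a, V) atlas"
  assumes M: "smooth_manifold M" and \<pi>: "smooth_map Z M \<pi>" and J: "almost_complex_on M U J"
    and c: "(Um, \<xi>) \<in> M" "\<pi> z0 \<in> Um" "\<pi> z0 \<in> U" and W: "openin (mtop Z) W" "z0 \<in> W"
    and F: "open_set_of_complex_lines M U J (F ` W)" "\<And>z. fst (F z) = \<pi> z"
    and fib: "double_fibration S f g (in_chart M (Um, \<xi>) J) J'" and q: "q \<in> S" "f q = \<xi> (\<pi> z0)"
  shows "\<exists>W U J. openin (mtop Z) W \<and> z0 \<in> W \<and> almost_complex_on M U J \<and> integrable_on_set M U J \<and>
    open_set_of_complex_lines M U J (F ` W)"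
proof -
  have U: "openin (mtop M) U" using J by (simp add: almost_complex_on_def)
  have "f q \<in> \<xi> ` (Um \<inter> U)" unfolding q(2) using c by blast
  then obtain B V and \<psi> :: "V \<Rightarrow> complex^2" and \<phi> where B: "open B" "f q \<in> B" "B \<subseteq> \<xi> ` (Um \<inter> U)" "open V"
    "homeomorphism B V \<psi> \<phi>" "smooth_on B \<psi>" "smooth_on V \<phi>"
    "\<And>x v. x \<in> B \<Longrightarrow> D \<psi> x (in_chart M (Um, \<xi>) J x v) = \<i> *s D \<psi> x v"
    by (rule double_fibration.holomorphic_coordinates[OF fib q(1) chart_image_open[OF M c(1) U]]) blast
  note I = integrable_near[OF M J c(1) B(1,3,4,5,6,7,8)]
  let ?U = "Um \<inter> \<xi> -` B"
  have "openin (mtop Z) (W \<inter> (mcarrier Z \<inter> \<pi> -` ?U))"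
    by (intro openin_Int W smooth_map_preimage_openin[OF \<pi> I(1)])
  moreover have "W \<inter> (mcarrier Z \<inter> \<pi> -` ?U) = W \<inter> \<pi> -` ?U"
    using openin_subset[OF W(1)] by (auto simp: topspace_mtop)
  ultimately have "openin (mtop Z) (W \<inter> \<pi> -` ?U)" by simp
  moreover have "z0 \<in> W \<inter> \<pi> -` ?U" using W(2) c(2) B(2)[unfolded q(2)] by simp
  ultimately show ?thesis
    using I(3,4) open_set_of_complex_lines_restrict[OF F I(2)] by blast
qed

section \<open>Invariance of the tangent planes and the conclusion\<close>

lemma complex_line_invariant:
  assumes "linear J" "\<And>v. J (J v) = - v" "v \<in> span {u, J u}"
  shows "J v \<in> span {u, J u}"
proof -
  obtain a b where "v = a *\<^sub>R u + b *\<^sub>R J u" using assms(3) span_pair by blast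
  then have "J v = (- b) *\<^sub>R u + a *\<^sub>R J u" using assms(1,2) by (simp add: linear_add linear_cmul)
  then show ?thesis using span_pair by blast
qed

text \<open>The basis \<open>(u, J u)\<close> of the dual plane comes from a pair \<open>w1\<close>,
  \<open>w2\<close> in \<open>ker \<lambda>'\<close>. Their images are independent, so by dimension
  the pair spans \<open>ker \<lambda>'\<close>, and the image of this kernel under
  \<open>\<rho>'\<close> is the complex line of \<open>u\<close>.\<close>

lemma dual_plane_invariant:
  assumes Z: "smooth_manifold Z" and C: "smooth_curve_family X E Y C Z" and z: "z \<in> mcarrier Z"
    and surj: "surj (mderiv Z X fst z)" and J: "almost_complex_on Y U J"
    and d: "dual_map X E Y C Z z \<in> complex_lines U J"
    and w: "mderiv Z X fst z w = 0"
  shows "\<exists>w'. mderiv Z X fst z w' = 0 \<and> mderiv Z Y snd z w' = J (snd z) (mderiv Z Y snd z w)"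
proof -
  have f: "smooth_map Z X fst" and g: "smooth_map Z Y snd"
    using C by (auto simp: smooth_curve_family_def submersion_def)
  note lf = linear_mderiv[OF f z] and lg = linear_mderiv[OF g z]
  let ?J = "J (snd z)"
  obtain u where u: "snd z \<in> U" "u \<noteq> 0" "dual_plane X E Y C Z z = oplane u (?J u)"
    using d by (auto simp: dual_map_def complex_lines_def)
  have J: "linear ?J" "\<And>v. ?J (?J v) = - v" using J u(1) by (auto simp: almost_complex_on_def)
  have "(1 *\<^sub>R u + 0 *\<^sub>R ?J u, 0 *\<^sub>R u + 1 *\<^sub>R ?J u) \<in> oplane u (?J u)"
    unfolding oplane_def by (intro CollectI exI conjI, rule refl) simp
  then have "(u, ?J u) \<in> dual_plane X E Y C Z z" using u(3) by simp
  then obtain w1 w2 where w12: "mderiv Z X fst z w1 = 0" "mderiv Z X fst z w2 = 0"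
    "mderiv Z Y snd z w1 = u" "mderiv Z Y snd z w2 = ?J u"
    unfolding dual_plane_def positive_basis_ker_lambda_def ker_lambda_def by auto
  define j where "j c = Re c *\<^sub>R w1 + Im c *\<^sub>R w2" for c
  have linj: "linear j" unfolding j_def by (rule linearI) (simp_all add: algebra_simps)
  have fj: "mderiv Z X fst z (j c) = 0" for c
    by (simp add: j_def linear_add[OF lf] linear_cmul[OF lf] w12)
  have gj: "mderiv Z Y snd z (j c) = complex_scale ?J c u" for c
    by (simp add: j_def linear_add[OF lg] linear_cmul[OF lg] w12 complex_scale_def)
  have "c = 0" if "j c = 0" for c
  proof (rule ccontr)
    assume "c \<noteq> 0"
    have "complex_scale ?J c u = 0" using gj[of c] that linear_0[OF lg] by simp
    then have "complex_scale ?J (1 / c) (complex_scale ?J c u) = 0"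
      using linear_0[OF J(1)] by (simp add: complex_scale_def)
    then show False using \<open>c \<noteq> 0\<close> u(2) by (simp add: complex_scale_mult[OF J])
  qed
  then have "inj j" using linear_injective_0[OF linj] by blast
  from exact_by_dimension[OF lf surj linj this fj _ w] obtain c where c: "w = j c" by auto
  have "mderiv Z Y snd z (j (\<i> * c)) = complex_scale ?J \<i> (complex_scale ?J c u)"
    by (simp only: gj complex_scale_mult[OF J])
  also have "\<dots> = ?J (mderiv Z Y snd z w)" by (simp add: c gj)
  finally show ?thesis using fj by blast
qed

theorem theorem10:
  fixes X :: "('x, real^4) atlas"
    and E :: "('x \<times> oplane) set"
    and Y :: "('y, real^4) atlas"
    and C :: "'y \<Rightarrow> ('x, real^2) atlas"
    and Z :: "('x \<times> 'y, real^6) atlas"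
  assumes "smooth_manifold X"
    and "pseudocomplex_structure X E"
    and "smooth_manifold Y"
    and "smooth_curve_family X E Y C Z"
    and "local_diffeo Z (submanifold6_atlas X E) (tau X C)"
    and "locally_almost_complex Z X (tau X C)"
    and "locally_almost_complex Z Y (dual_map X E Y C Z)"
  shows "locally_complex Z X (tau X C) \<and> locally_complex Z Y (dual_map X E Y C Z)"
proof -
  note X = assms(1) and E = assms(2) and Y = assms(3) and C = assms(4) and \<tau> = assms(5)
  let ?\<tau> = "tau X C" and ?\<delta> = "dual_map X E Y C Z"
  have Z: "smooth_manifold Z" and f: "smooth_map Z X fst" and g: "smooth_map Z Y snd"
    and surjg: "\<And>z. z \<in> mcarrier Z \<Longrightarrow> surj (mderiv Z Y snd z)"
    using C by (auto simp: smooth_curve_family_def submersion_def)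
  have fst_tau: "fst (?\<tau> z) = fst z" and fst_dual: "fst (?\<delta> z) = snd z" for z
    by (simp_all add: tau_def dual_map_def split: prod.split)
  have "(\<exists>W U J. openin (mtop Z) W \<and> z0 \<in> W \<and> almost_complex_on X U J \<and> integrable_on_set X U J \<and>
        open_set_of_complex_lines X U J (?\<tau> ` W)) \<and>
      (\<exists>W U J. openin (mtop Z) W \<and> z0 \<in> W \<and> almost_complex_on Y U J \<and> integrable_on_set Y U J \<and>
        open_set_of_complex_lines Y U J (?\<delta> ` W))" if z0: "z0 \<in> mcarrier Z" for z0
  proof -
    obtain WX UX JX where WX: "openin (mtop Z) WX" "z0 \<in> WX" and JX: "almost_complex_on X UX JX"
      and LX: "open_set_of_complex_lines X UX JX (?\<tau> ` WX)"
      using assms(6) z0 unfolding locally_almost_complex_def by blast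
    obtain WY UY JY where WY: "openin (mtop Z) WY" "z0 \<in> WY" and JY: "almost_complex_on Y UY JY"
      and LY: "open_set_of_complex_lines Y UY JY (?\<delta> ` WY)"
      using assms(7) z0 unfolding locally_almost_complex_def by blast
    have subX: "?\<tau> ` WX \<subseteq> complex_lines UX JX" and subY: "?\<delta> ` WY \<subseteq> complex_lines UY JY"
      using LX LY openin_subset unfolding open_set_of_complex_lines_def by fastforce+
    obtain Uz \<zeta> where z: "(Uz, \<zeta>) \<in> Z" "z0 \<in> Uz" using z0 by (auto simp: mcarrier_def)
    obtain Ux \<xi> where x: "(Ux, \<xi>) \<in> X" "fst z0 \<in> Ux"
      using smooth_map_in_carrier[OF f z0] by (auto simp: mcarrier_def)
    obtain Uy \<eta> where y: "(Uy, \<eta>) \<in> Y" "snd z0 \<in> Uy"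
      using smooth_map_in_carrier[OF g z0] by (auto simp: mcarrier_def)
    \<comment> \<open>Small enough for single charts of \<open>Z\<close>, \<open>X\<close> and
      \<open>Y\<close>, and for both almost complex structures to be defined on the images.\<close>
    define \<Omega> where "\<Omega> = Uz \<inter> (WX \<inter> WY) \<inter> ((mcarrier Z \<inter> fst -` Ux) \<inter> (mcarrier Z \<inter> snd -` Uy))"
    have \<Omega>: "openin (mtop Z) \<Omega>" unfolding \<Omega>_def
      by (intro openin_Int chart_domain_openin[OF z(1)] WX WY smooth_map_preimage_openin[OF f chart_domain_openin[OF x(1)]]
          smooth_map_preimage_openin[OF g chart_domain_openin[OF y(1)]])
    have z0\<Omega>: "z0 \<in> \<Omega>" using z x y z0 WX WY by (simp add: \<Omega>_def)
    have o: "z \<in> Uz" "z \<in> WX" "z \<in> WY" "z \<in> mcarrier Z" "fst z \<in> Ux" "snd z \<in> Uy" if "z \<in> \<Omega>" for z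
      using that by (auto simp: \<Omega>_def)
    have oX: "fst z \<in> UX" and invX: "mderiv Z Y snd z v = 0 \<Longrightarrow>
       \<exists>v'. mderiv Z Y snd z v' = 0 \<and> mderiv Z X fst z v' = JX (fst z) (mderiv Z X fst z v)"
      if z: "z \<in> \<Omega>" for z v
    proof -
      have "?\<tau> z \<in> complex_lines UX JX" using subX o(2)[OF z] by blast
      then obtain u where u: "fst (?\<tau> z) \<in> UX" "snd (?\<tau> z) = oplane u (JX (fst (?\<tau> z)) u)"
        by (auto simp: complex_lines_def)
      then show "fst z \<in> UX" by (simp add: fst_tau)
      then have J: "linear (JX (fst z))" "\<And>v. JX (fst z) (JX (fst z) v) = - v"
        using JX by (auto simp: almost_complex_on_def)
      \<comment> \<open>The image of the kernel of \<open>\<rho>'\<close> under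
        \<open>\<lambda>'\<close> is the tangent plane of the curve, and this is the complex line of
        \<open>u\<close>.\<close>
      note k = incidence_kernel(1)[OF Z C o(4)[OF z]]
      assume "mderiv Z Y snd z v = 0"
      then have "mderiv Z X fst z v \<in> span {u, JX (fst z) u}"
        using k by (auto simp: u(2) fst_tau plane_oplane)
      then have "JX (fst z) (mderiv Z X fst z v) \<in> span {u, JX (fst z) u}"
        by (rule complex_line_invariant[OF J])
      then have "JX (fst z) (mderiv Z X fst z v) \<in> mderiv Z X fst z ` {w. mderiv Z Y snd z w = 0}"
        unfolding k by (simp add: u(2) fst_tau plane_oplane)
      then obtain v' where "JX (fst z) (mderiv Z X fst z v) = mderiv Z X fst z v'" "v' \<in> {w. mderiv Z Y snd z w = 0}"
        by (rule imageE)
      then show "\<exists>v'. mderiv Z Y snd z v' = 0 \<and> mderiv Z X fst z v' = JX (fst z) (mderiv Z X fst z v)"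
        by (intro exI[of _ v']) simp
    qed
    have surjf: "surj (mderiv Z X fst z)" if "z \<in> \<Omega>" for z
      using tau_local[OF X E Z C \<tau> z(1) o(1)[OF that] x(1) o(5)[OF that]] by metis
    have dl: "?\<delta> z \<in> complex_lines UY JY" if "z \<in> \<Omega>" for z using subY o(3)[OF that] by blast
    have oY: "snd z \<in> UY" if "z \<in> \<Omega>" for z
      using dl[OF that] by (auto simp: complex_lines_def dual_map_def)
    let ?S = "\<zeta> ` \<Omega>" and ?F = "\<xi> \<circ> fst \<circ> inv_into Uz \<zeta>" and ?G = "\<eta> \<circ> snd \<circ> inv_into Uz \<zeta>"
    have pre: "double_prefibration ?S ?F ?G (in_chart X (Ux, \<xi>) JX) (in_chart Y (Uy, \<eta>) JY)"
    proof (rule double_prefibration_in_charts[OF Z X Y f g z(1) x(1) y(1) JX JY \<Omega>])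
      show "\<Omega> \<subseteq> Uz" "fst ` \<Omega> \<subseteq> Ux \<inter> UX" "snd ` \<Omega> \<subseteq> Uy \<inter> UY" using o oX oY by auto
      fix z w assume z: "z \<in> \<Omega>"
      note zZ = o(4)[OF z]
      show "surj (mderiv Z X fst z)" "surj (mderiv Z Y snd z)" using surjf[OF z] surjg[OF zZ] by auto
      show "w = 0" if "mderiv Z X fst z w = 0" "mderiv Z Y snd z w = 0"
        by (rule incidence_kernel(2)[OF Z C zZ that])
      show "\<exists>v'. mderiv Z Y snd z v' = 0 \<and> mderiv Z X fst z v' = JX (fst z) (mderiv Z X fst z w)"
        if "mderiv Z Y snd z w = 0" by (rule invX[OF z that])
      show "\<exists>v'. mderiv Z X fst z v' = 0 \<and> mderiv Z Y snd z v' = JY (snd z) (mderiv Z Y snd z w)"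
        if "mderiv Z X fst z w = 0"
        by (rule dual_plane_invariant[OF Z C zZ surjf[OF z] JY dl[OF z] that])
    qed
    interpret pre: double_prefibration ?S ?F ?G "in_chart X (Ux, \<xi>) JX" "in_chart Y (Uy, \<eta>) JY" by (rule pre)
    have injz: "inj_on \<zeta> Uz" by (rule manifold_chart_inj[OF Z z(1)])
    interpret fib: double_fibration ?S ?F ?G "in_chart X (Ux, \<xi>) JX" "in_chart Y (Uy, \<eta>) JY"
    proof
      fix q w assume q: "q \<in> ?S" and w: "D ?F q w = 0" "w \<noteq> 0"
      then obtain z where zz: "z \<in> \<Omega>" "q = \<zeta> z" by blast
      \<comment> \<open>Taken anew at each \<open>z\<close>, with a Grassmann chart centred at the
        plane of \<open>z\<close>. As \<open>w\<close> is nonzero and killed by \<open>D ?F\<close>,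
        the injectivity of the pair forces \<open>D a\<close> to be nonzero on it.\<close>
      obtain N p a where N: "open N" "\<zeta> z \<in> N" "N \<subseteq> \<zeta> ` Uz" and p: "linear p" "bij p"
        and a: "a differentiable at (\<zeta> z)"
        and gr: "\<And>q. q \<in> N \<Longrightarrow> map_prod (differential X \<xi> (fst (inv_into Uz \<zeta> q))) (differential X \<xi> (fst (inv_into Uz \<zeta> q))) `
         snd (?\<tau> (inv_into Uz \<zeta> q)) = gr_graph p (a q)"
        and inj: "\<And>w. D ?F (\<zeta> z) w = 0 \<Longrightarrow> D a (\<zeta> z) w = 0 \<Longrightarrow> w = 0"
        by (rule tau_local[OF X E Z C \<tau> z(1) o(1)[OF zz(1)] x(1) o(5)[OF zz(1)]]) blast
      show "\<exists>v. D ?G q v = 0 \<and> (\<forall>u v'. DD ?G q w v + D ?G q u = 0 \<longrightarrow> D ?G q v' = 0 \<longrightarrow>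
          DD ?F q w v + D ?F q u \<noteq> D ?F q v')"
      proof (rule pre.nondegenerate_from_graph[OF q _ _ _ p, of "N \<inter> ?S"])
        show "open (N \<inter> ?S)" "q \<in> N \<inter> ?S" "N \<inter> ?S \<subseteq> ?S"
          using N pre.open_S q by (auto simp: zz(2))
        show "a differentiable at q" "D a q w \<noteq> 0" using a inj w by (auto simp: zz(2))
        fix q' assume q': "q' \<in> N \<inter> ?S"
        then obtain z' where z': "z' \<in> \<Omega>" "q' = \<zeta> z'" by blast
        have iz: "inv_into Uz \<zeta> q' = z'" using injz o(1)[OF z'(1)] by (simp add: z'(2) inv_into_f_f)
        note dz = differential_chart[OF Z z(1) o(1)[OF z'(1)]] and dx = differential_chart[OF X x(1) o(5)[OF z'(1)]]
          and dy = differential_chart[OF Y y(1) o(6)[OF z'(1)]]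
        note F' = mderiv_charts[OF Z X f z(1) o(1)[OF z'(1)] x(1) o(5)[OF z'(1)]]
          and G' = mderiv_charts[OF Z Y g z(1) o(1)[OF z'(1)] y(1) o(6)[OF z'(1)]]
        have dy0: "differential Y \<eta> (snd z') v = 0 \<longleftrightarrow> v = 0" for v
          using dy by (metis bij_is_inj linear_0 linear_injective_0)
        \<comment> \<open>The plane of \<tau> is described by \<open>mderiv\<close> at
          \<open>z'\<close>, the graph by derivatives in fixed charts; \<open>differential\<close>
          passes from one to the other.\<close>
        have "{v. D ?G q' v = 0} = differential Z \<zeta> z' ` {w. mderiv Z Y snd z' w = 0}"
        proof (intro set_eqI iffI)
          fix v assume "v \<in> {v. D ?G q' v = 0}"
          moreover obtain w where "v = differential Z \<zeta> z' w" using dz(2) by (metis bij_is_surj surjD)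
          ultimately show "v \<in> differential Z \<zeta> z' ` {w. mderiv Z Y snd z' w = 0}"
            using G'[of w] by (simp add: z'(2) dy0)
        next
          fix v assume "v \<in> differential Z \<zeta> z' ` {w. mderiv Z Y snd z' w = 0}"
          then obtain w where "v = differential Z \<zeta> z' w" "mderiv Z Y snd z' w = 0" by blast
          then show "v \<in> {v. D ?G q' v = 0}" using G'[of w] by (simp add: z'(2) linear_0[OF dy(1)])
        qed
        then have "D ?F q' ` {v. D ?G q' v = 0} = differential X \<xi> (fst z') ` plane (snd (?\<tau> z'))"
          unfolding incidence_kernel(1)[OF Z C o(4)[OF z'(1)], symmetric]
          by (simp add: image_image z'(2) F')
        also have "\<dots> = plane (map_prod (differential X \<xi> (fst z')) (differential X \<xi> (fst z')) ` snd (?\<tau> z'))"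
          by (cases z') (use plane_map_prod[OF dx(1)] in \<open>simp add: tau_def tangent_plane_def\<close>)
        also have "\<dots> = range (\<lambda>e. p (e, a q' *v e))"
          using gr[of q'] q' by (simp add: iz plane_gr_graph[OF p(1)])
        finally show "D ?F q' ` {v. D ?G q' v = 0} = range (\<lambda>e. p (e, a q' *v e))" .
      qed
    qed
    have q0: "\<zeta> z0 \<in> ?S" "?F (\<zeta> z0) = \<xi> (fst z0)" "?G (\<zeta> z0) = \<eta> (snd z0)"
      using z0\<Omega> injz z(2) by (auto simp: inv_into_f_f)
    show ?thesis
      using integrable_structure_at[OF X f JX x oX[OF z0\<Omega>] WX LX fst_tau fib.double_fibration_axioms q0(1,2)]
        integrable_structure_at[OF Y g JY y oY[OF z0\<Omega>] WY LY fst_dual fib.dual_fibration q0(1,3)]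
      by (rule conjI)
  qed
  then show ?thesis unfolding locally_complex_def by blast
qed

end
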